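(* (a) For every $\beta\in(0,1)$, the equation (in the unknown $a$) $$\frac{1}{\Gamma(\beta-a)^2}=\frac{1}{\Gamma(\beta)\,\Gamma(\beta-2a)}$$ has a unique solution $a=\alpha_*(\beta)$ on $(0,1)$, and the density of $\mathbf{M}_{\alpha,\beta}$ is not log-concave for all $\alpha\in(\alpha_*(\beta),1]$. (b) The density of $\mathbf{M}_{\alpha,\beta}$ is log-concave in the following situations: (i) for all $\alpha\in[0,4/5]$ and $\beta=0$; (ii) for all $\alpha\in[0,1]$ and $\beta\ge\alpha$.
   Context: $1/\Gamma$ is the entire reciprocal Gamma function (equal to $0$ at the non-positive integers). The Wright function is $\phi(\rho,\beta,z)=\sum_{n\ge 0}\frac{z^n}{n!\,\Gamma(\beta+\rho n)}$ for $\beta,z\in\mathbb{C}$, $\rho>-1$. For $\alpha\in[0,1]$ and $\beta\ge 0$ with $(\alpha,\beta)\ne(1,0)$, $\mathbf{M}_{\alpha,\beta}$ is the positive random variable with $\mathbb{E}[\mathbf{M}_{\alpha,\beta}^s]=\frac{(1)_s}{(\alpha+\beta)_{\alpha s}}$ for $s>-1$, where $(a)_s=\Gamma(a+s)/\Gamma(a)$. Its density is: $\varphi_{\alpha,\beta}(x)=\Gamma(\alpha+\beta)\,\phi(-\alpha,\beta,-x)$ on $(0,\infty)$ for $\alpha\in(0,1)$; $e^{-x}$ on $(0,\infty)$ for $\alpha=0$ and any $\beta\ge 0$; $\beta(1-x)^{\beta-1}$ on $(0,1)$ for $\alpha=1$, $\beta>0$. The density is called log-concave if its logarithm is concave on the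 interior of its support ($(0,\infty)$ for $\alpha<1$, $(0,1)$ for $\alpha=1$). *)

theory Defs
  imports "HOL-Analysis.Analysis"
begin

text \<open>
  The total function \<^const>\<open>rGamma\<close> vanishes at the non-positive integers. The series
  converges for all arguments when \<open>\<rho> > -1\<close>.
\<close>

definition wright :: "real \<Rightarrow> 'a::Gamma \<Rightarrow> 'a \<Rightarrow> 'a" where
  "wright \<rho> \<beta> z = (\<Sum>n. z ^ n / fact n * rGamma (\<beta> + of_real (\<rho> * of_nat n)))"

text \<open>
  The density of the positive random variable \<open>M\<close> with
  \<open>E[M\<^sup>s] = \<Gamma>(1 + s) \<Gamma>(\<alpha> + \<beta>) / \<Gamma>(\<alpha> + \<beta> + \<alpha> s)\<close> for \<open>s > -1\<close>, where
  \<open>\<alpha> \<in> [0,1]\<close>, \<open>\<beta> \<ge> 0\<close> and \<open>(\<alpha>,\<beta>) \<noteq> (1,0)\<close>. The values for other parameters are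
  irrelevant. For \<open>\<alpha> = 0\<close> the quotient \<open>\<Gamma>(\<alpha> + \<beta>) / \<Gamma>(\<alpha> + \<beta> + \<alpha> s)\<close> is read as \<open>1\<close>, also when \<open>\<beta> = 0\<close>.
\<close>

definition M_density :: "real \<Rightarrow> real \<Rightarrow> real \<Rightarrow> real" where
  "M_density \<alpha> \<beta> x =
     (if \<alpha> = 0 then (if 0 < x then exp (- x) else 0)
      else if \<alpha> = 1 then (if 0 < x \<and> x < 1 then \<beta> * (1 - x) powr (\<beta> - 1) else 0)
      else (if 0 < x then Gamma (\<alpha> + \<beta>) * wright (- \<alpha>) \<beta> (- x) else 0))"

definition M_support_interior :: "real \<Rightarrow> real set" where
  "M_support_interior \<alpha> = (if \<alpha> < 1 then {0<..} else {0<..<1})"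

text \<open>
  \<^const>\<open>ln\<close> is total on the reals, with \<open>ln 0 = 0\<close> and \<open>ln (- x) = ln x\<close>. Positivity of the
  density on the interior of its support is therefore not implied by the following notion;
  it has to be stated separately where log-concavity is asserted. Where log-concavity is
  denied, leaving positivity out gives the stronger claim.
\<close>

definition M_log_concave :: "real \<Rightarrow> real \<Rightarrow> bool" where
  "M_log_concave \<alpha> \<beta> \<longleftrightarrow> concave_on (M_support_interior \<alpha>) (\<lambda>x. ln (M_density \<alpha> \<beta> x))"

definition is_alpha_star :: "real \<Rightarrow> real \<Rightarrow> bool" where
  "is_alpha_star \<beta> a \<longleftrightarrow>
     0 < a \<and> a < 1 \<and> (rGamma (\<beta> - a))\<^sup>2 = rGamma \<beta> * rGamma (\<beta> - 2 * a)"

definition alpha_star :: "real \<Rightarrow> real" where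
  "alpha_star \<beta> = (THE a. is_alpha_star \<beta> a)"

end

theory Submission imports Defs "HOL-Complex_Analysis.Complex_Analysis" begin

text \<open>Hankel's formula on a tilted ray writes the Wright function as the imaginary part of a contour
  integral of \<open>\<lambda>\<^bsup>-\<beta>\<^esup> exp (\<lambda> - x \<lambda>\<^sup>\<alpha>)\<close>. For \<open>\<beta> = 0\<close> and \<open>\<beta> = \<alpha>\<close> the contour can be moved to Kanter's curve,
  where the exponent is real, and a suitable parameter \<open>y\<close> makes the integrand
  \<open>y\<^bsup>\<delta>-1\<^esup> exp (- (y N (x / y))\<^bsup>1/(1-\<alpha>)\<^esup>)\<close>, where \<open>\<delta> \<ge> 1\<close>. If \<open>N\<close> is convex, so is its perspective \<open>y N (x / y)\<close>;
  the integrand is then log-concave in \<open>(x, y)\<close>, and so is its integral over \<open>y\<close> by Prekopa's theorem.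
  Convexity of \<open>N\<close> is a trigonometric inequality, true for all \<open>\<alpha>\<close> if \<open>\<beta> = \<alpha>\<close> and for \<open>\<alpha> \<le> 4/5\<close> if \<open>\<beta> = 0\<close>.
  The \<open>x\<close>-derivative lowers the index \<open>\<beta>\<close> by \<open>\<alpha>\<close>, so log-concavity means that the Wright function of index
  \<open>\<beta> - \<alpha>\<close> has increasing hazard rate. Fractional integration of order at most \<open>1\<close> raises \<open>\<beta>\<close> and preserves this.

  At \<open>x = 0\<close>, log-concavity is the inequality \<open>rGamma (\<beta> - \<alpha>)\<^sup>2 \<ge> rGamma \<beta> * rGamma (\<beta> - 2\<alpha>)\<close>. The quotient
  of the two sides is monotone in \<open>\<alpha>\<close> where the right-hand side is positive, so the inequality fails
  exactly beyond \<open>\<alpha>\<^sub>*(\<beta>)\<close>.\<close>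

subsection \<open>The Prekopa--Leindler inequality on the half-line\<close>

text \<open>The parameter \<open>y\<close> is forced by two demands. The differential
  \<open>\<lambda>^(-\<beta>) d\<lambda>\<close> belongs to
  \<open>\<lambda>^(1-\<beta>) / (1-\<beta>)\<close> and the exponential is real on the curve, so
  the integrand is explicit once \<open>Im \<lambda>^(1-\<beta>)\<close> is a power of
  \<open>y\<close>; and the exponent is a power of a perspective once \<open>y\<close> has degree
  one in \<open>x\<close> at a fixed angle. Both hold for \<open>y = x * sin (a\<theta>) / sin
  \<theta> * sin ((1-\<beta>)\<theta>)^((1-a)/(1-\<beta>))\<close>; \<open>kanter_t\<close> is
  \<open>x / y\<close> for the two indices. Log-concavity of \<open>y^(\<delta>-1)\<close> requires
  \<open>\<beta> \<le> a\<close>, so \<open>a\<close> is the largest index within reach of this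
  argument. Prekopa's theorem does not lead from there to all \<open>\<beta> \<ge> a\<close>: a
  small increase of the index is a fractional integral with kernel \<open>z^(c-1)\<close>,
  \<open>c < 1\<close>, which is log-convex. With the hazard rate, numerator and denominator are
  averaged with the same kernel and only the monotonicity of their quotient has to survive. Contours
  are shifted by means of a primitive on the slit plane, so that only the ends of the curves are
  compared.\<close>

lemma cdf_half_line:
  fixes f :: "real \<Rightarrow> real"
  assumes cont: "continuous_on {0<..} f" and pos: "\<forall>y>0. 0 < f y"
    and int: "set_integrable lborel {0<..} f"
  defines "F \<equiv> \<lambda>s. LINT y:{0<..s}|lborel. f y"
  shows cdf_deriv: "\<And>s. 0 < s \<Longrightarrow> (F has_real_derivative f s) (at s)"
    and cdf_strict_mono: "\<And>s t. 0 < s \<Longrightarrow> s < t \<Longrightarrow> F s < F t"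
    and cdf_at_0: "(F \<longlongrightarrow> 0) (at_right 0)"
    and cdf_at_top: "(F \<longlongrightarrow> (LINT y:{0<..}|lborel. f y)) at_top"
    and cdf_pos: "\<And>s. 0 < s \<Longrightarrow> 0 < F s"
    and cdf_less: "\<And>s. 0 < s \<Longrightarrow> F s < (LINT y:{0<..}|lborel. f y)"
proof -
  have split: "F t = F s + integral {s..t} f" if st: "0 < s" "s \<le> t" for s t
  proof -
    have i1: "set_integrable lborel {0<..s} f" "set_integrable lborel {s<..t} f" "set_integrable lborel {s..t} f"
      by (rule set_integrable_subset[OF int]; use st in auto)+
    have "{0<..t} = {0<..s} \<union> {s<..t}" using st by auto
    then have "F t = F s + (LINT y:{s<..t}|lborel. f y)"
      unfolding F_def using set_integral_Un[OF _ i1(1,2)] by auto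
    also have "(LINT y:{s<..t}|lborel. f y) = (LINT y:{s..t}|lborel. f y)"
    proof (rule set_integral_cong_set)
      show "set_borel_measurable lborel {s<..t} f" "set_borel_measurable lborel {s..t} f"
        using i1 by (auto simp: set_integrable_def set_borel_measurable_def)
      show "AE x in lborel. (x \<in> {s..t}) = (x \<in> {s<..t})"
        using AE_lborel_singleton[of s] by eventually_elim auto
    qed
    also have "\<dots> = integral {s..t} f"
      by (rule set_borel_integral_eq_integral(2)[OF i1(3)])
    finally show ?thesis .
  qed
  show der: "(F has_real_derivative f s) (at s)" if s: "0 < s" for s
  proof -
    have c: "continuous_on {s/2..2 * s} f" by (rule continuous_on_subset[OF cont]) (use s in auto)
    have "((\<lambda>x. integral {s/2..x} f) has_real_derivative f s) (at s within {s/2..2 * s})"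
      by (rule integral_has_real_derivative[OF c]) (use s in auto)
    then have "((\<lambda>x. F (s/2) + integral {s/2..x} f) has_real_derivative f s) (at s within {s/2..2 * s})"
      by (auto intro!: derivative_eq_intros)
    moreover have "at s within {s/2..2 * s} = at s"
      by (rule at_within_interior) (use s in auto)
    ultimately have *: "((\<lambda>x. F (s/2) + integral {s/2..x} f) has_real_derivative f s) (at s)" by simp
    show ?thesis
    proof (rule has_field_derivative_transform_within_open[OF *, of "{s/2<..}"])
      show "F (s/2) + integral {s/2..x} f = F x" if "x \<in> {s/2<..}" for x
        using split[of "s/2" x] s that by simp
    qed (use s in auto)
  qed
  show smono: "F s < F t" if st: "0 < s" "s < t" for s t
  proof (rule DERIV_pos_imp_increasing[OF st(2)])
    fix x assume "s \<le> x" "x \<le> t"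
    then show "\<exists>y. (F has_real_derivative y) (at x) \<and> 0 < y"
      using der[of x] pos st by (intro exI[of _ "f x"]) auto
  qed
  show lim0: "(F \<longlongrightarrow> 0) (at_right 0)"
  proof (rule tendsto_at_right_sequentially[of _ 1])
    fix S :: "nat \<Rightarrow> real" assume S: "\<And>n. 0 < S n" "\<And>n. S n < 1" "decseq S" "S \<longlonglongrightarrow> 0"
    have "(\<lambda>n. LINT y|lborel. indicator {0<..S n} y *\<^sub>R f y) \<longlonglongrightarrow> (LINT y::real|lborel. 0)"
    proof (rule Bochner_Integration.integral_dominated_convergence)
      show "integrable lborel (\<lambda>y. norm (indicator {0<..} y *\<^sub>R f y))"
        using int by (intro integrable_norm) (simp add: set_integrable_def)
      show "AE y in lborel. (\<lambda>n. indicator {0<..S n} y *\<^sub>R f y) \<longlonglongrightarrow> 0"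
      proof (rule AE_I2)
        fix y :: real
        show "(\<lambda>n. indicator {0<..S n} y *\<^sub>R f y) \<longlonglongrightarrow> 0"
        proof (cases "0 < y")
          case True
          have "eventually (\<lambda>n. S n < y) sequentially" by (rule order_tendstoD(2)[OF S(4) True])
          then have "eventually (\<lambda>n. indicator {0<..S n} y *\<^sub>R f y = 0) sequentially"
            by eventually_elim auto
          then show ?thesis by (rule tendsto_eventually)
        qed auto
      qed
      show "(\<lambda>y. indicator {0<..S i} y *\<^sub>R f y) \<in> borel_measurable lborel" for i
        using set_integrable_subset[OF int, of "{0<..S i}"] S(1) by (auto simp: set_integrable_def subset_iff)
      show "AE x in lborel. norm (indicator {0<..S i} x *\<^sub>R f x) \<le> norm (indicator {0<..} x *\<^sub>R f x)" for i
        by (auto simp: indicator_def)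
    qed auto
    then show "(\<lambda>n. F (S n)) \<longlonglongrightarrow> 0" by (simp add: F_def set_lebesgue_integral_def)
  qed auto
  have "(F \<longlongrightarrow> (LINT y:(\<Union>i::nat. {0<..real i})|lborel. f y)) at_top"
  proof -
    have U: "(\<Union>i::nat. {0<..real i}) = {0<..}" by (auto intro: real_arch_simple)
    have A: "(\<lambda>i. LINT y:{0<..real i}|lborel. f y) \<longlonglongrightarrow> (LINT y:(\<Union>i::nat. {0<..real i})|lborel. f y)"
      by (rule set_integral_cont_up) (use int U in \<open>auto simp: incseq_def\<close>)
    have mono: "F s \<le> F t" if "s \<le> t" "1 \<le> s" for s t
      using smono[of s t] that by (cases "s = t") auto
    define L where "L = (LINT y:(\<Union>i::nat. {0<..real i})|lborel. f y)"
    have A: "(\<lambda>i. F (real i)) \<longlonglongrightarrow> L" using A by (simp add: F_def L_def)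
    have up: "F s \<le> L" if "1 \<le> s" for s
    proof (rule tendsto_lowerbound[OF A])
      show "\<forall>\<^sub>F i in sequentially. F s \<le> F (real i)"
        using eventually_ge_at_top[of "nat \<lceil>s\<rceil>"]
        by eventually_elim (rule mono, use that in linarith, use that in linarith)
    qed auto
    show ?thesis unfolding L_def[symmetric]
    proof (rule order_tendstoI)
      fix a assume "a < L"
      then have "eventually (\<lambda>i. a < F (real i)) sequentially" by (rule order_tendstoD(1)[OF A])
      then obtain i where i: "a < F (real i)" "i \<ge> 1" 
        using eventually_ge_at_top[of "1::nat"] by (metis (mono_tags, lifting) eventually_at_top_linorder nat_le_linear)
      show "\<forall>\<^sub>F x in at_top. a < F x"
        using eventually_ge_at_top[of "real i"] by eventually_elim (use i mono[of "real i"] in force)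
    next
      fix a assume "L < a"
      show "\<forall>\<^sub>F x in at_top. F x < a"
        using eventually_ge_at_top[of 1] by eventually_elim (use up \<open>L < a\<close> in force)
    qed
  qed
  moreover have "(\<Union>i::nat. {0<..real i}) = {0<..}" by (auto intro: real_arch_simple)
  ultimately show limI: "(F \<longlongrightarrow> (LINT y:{0<..}|lborel. f y)) at_top" by simp
  show "0 < F s" if s: "0 < s" for s
  proof -
    have "0 \<le> F (s/2)"
    proof (rule tendsto_upperbound[OF lim0])
      show "\<forall>\<^sub>F x in at_right 0. F x \<le> F (s/2)"
        using s by (auto simp: eventually_at_right_field intro!: exI[of _ "s/2"] less_imp_le smono)
    qed auto
    then show ?thesis using smono[of "s/2" s] s by simp
  qed
  show "F s < (LINT y:{0<..}|lborel. f y)" if s: "0 < s" for s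
  proof -
    have "F (s+1) \<le> (LINT y:{0<..}|lborel. f y)"
    proof (rule tendsto_lowerbound[OF limI])
      show "\<forall>\<^sub>F x in at_top. F (s+1) \<le> F x"
        using eventually_gt_at_top[of "s+1"] by eventually_elim (rule less_imp_le, rule smono, use s in auto)
    qed auto
    then show ?thesis using smono[of s "s+1"] s by simp
  qed
qed

text \<open>Transport proof: \<open>T\<close> moves the normalised measure \<open>f\<close> to the normalised measure \<open>g\<close>;
  the distribution function of \<open>h\<close> at \<open>(1 - u) s + u T(s)\<close> then grows at least as fast as the
  claimed multiple of that of \<open>f\<close>, by the weighted arithmetic-geometric mean inequality for \<open>1\<close>
  and \<open>T'(s)\<close>.\<close>

lemma prekopa_leindler_half_line:
  fixes f g h :: "real \<Rightarrow> real"
  assumes f: "continuous_on {0<..} f" "\<forall>y>0. 0 < f y" "set_integrable lborel {0<..} f"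
    and g: "continuous_on {0<..} g" "\<forall>y>0. 0 < g y" "set_integrable lborel {0<..} g"
    and h: "continuous_on {0<..} h" "\<forall>y>0. 0 < h y" "set_integrable lborel {0<..} h"
    and u: "0 < u" "u < 1"
    and fgh: "\<And>y z. 0 < y \<Longrightarrow> 0 < z \<Longrightarrow> f y powr (1 - u) * g z powr u \<le> h ((1 - u) * y + u * z)"
  shows "(LINT y:{0<..}|lborel. f y) powr (1 - u) * (LINT y:{0<..}|lborel. g y) powr u
    \<le> (LINT y:{0<..}|lborel. h y)"
proof -
  define F where "F s = (LINT y:{0<..s}|lborel. f y)" for s
  define G where "G s = (LINT y:{0<..s}|lborel. g y)" for s
  define H where "H s = (LINT y:{0<..s}|lborel. h y)" for s
  define If where "If = (LINT y:{0<..}|lborel. f y)"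
  define Ig where "Ig = (LINT y:{0<..}|lborel. g y)"
  define Ih where "Ih = (LINT y:{0<..}|lborel. h y)"
  note Fp = cdf_half_line[OF f, folded F_def If_def]
  note Gp = cdf_half_line[OF g, folded G_def Ig_def]
  note Hp = cdf_half_line[OF h, folded H_def Ih_def]
  have Ipos: "0 < If" "0 < Ig" "0 < Ih"
    using Fp(5,6)[of 1] Gp(5,6)[of 1] Hp(5,6)[of 1] by auto
  define k where "k = Ig / If"
  have k: "0 < k" using Ipos by (simp add: k_def)
  have ex: "\<exists>t. 0 < t \<and> G t = v" if v: "0 < v" "v < Ig" for v
  proof -
    have "eventually (\<lambda>t. G t < v) (at_right 0)" by (rule order_tendstoD(2)[OF Gp(3) v(1)])
    moreover have "eventually (\<lambda>t. t > (0::real)) (at_right 0)" by (rule eventually_at_right_less)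
    ultimately have "eventually (\<lambda>t. G t < v \<and> 0 < t) (at_right 0)" by eventually_elim auto
    then obtain t1 where t1: "0 < t1" "G t1 < v" 
      using eventually_happens[of _ "at_right (0::real)"] by auto
    have "eventually (\<lambda>t. v < G t) at_top" by (rule order_tendstoD(1)[OF Gp(4) v(2)])
    moreover have "eventually (\<lambda>t. t > t1) at_top" by (rule eventually_gt_at_top)
    ultimately have "eventually (\<lambda>t. v < G t \<and> t1 < t) at_top" by eventually_elim auto
    then obtain t2 where t2: "t1 < t2" "v < G t2"
      using eventually_happens[of _ "at_top :: real filter"] by auto
    have "\<exists>x\<ge>t1. x \<le> t2 \<and> G x = v"
    proof (rule IVT)
      show "\<forall>x. t1 \<le> x \<and> x \<le> t2 \<longrightarrow> isCont G x"
        using t1 by (auto intro: DERIV_isCont[OF Gp(1)])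
    qed (use t1 t2 in auto)
    then obtain x where "t1 \<le> x" "G x = v" by blast
    then show ?thesis using t1 by (intro exI[of _ x]) auto
  qed
  define Q where "Q v = (SOME t. 0 < t \<and> G t = v)" for v
  have Q: "0 < Q v" "G (Q v) = v" if "0 < v" "v < Ig" for v
    using someI_ex[OF ex[OF that]] by (auto simp: Q_def)
  have QG: "Q (G t) = t" if t: "0 < t" for t
  proof -
    have "0 < Q (G t)" "G (Q (G t)) = G t" using Q Gp(5,6) t by auto
    then show ?thesis using Gp(2)[of t "Q (G t)"] Gp(2)[of "Q (G t)" t] t by (metis less_irrefl linorder_cases)
  qed
  have Qder: "(Q has_real_derivative inverse (g (Q v))) (at v)" if v: "0 < v" "v < Ig" for v
  proof (rule DERIV_inverse_function[where a=0 and b=Ig and f=G])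
    show "(G has_real_derivative g (Q v)) (at (Q v))" using Gp(1) Q v by auto
    show "g (Q v) \<noteq> 0" using g(2) Q v by (metis less_irrefl)
    have "isCont Q (G (Q v))"
      by (rule isCont_inverse_function2[of "Q v / 2" _ "2 * Q v"])
        (use Q(1)[OF v] QG in \<open>auto intro: DERIV_isCont[OF Gp(1)]\<close>)
    then show "isCont Q v" using Q v by simp
  qed (use v Q in auto)
  \<comment> \<open>\<open>T\<close> solves \<open>G (T s) = k * F s\<close>, where \<open>k\<close>
    equalises the total masses and \<open>Q\<close> is the inverse of \<open>G\<close>. It exists
    and is differentiable because the distribution functions are smooth bijections onto the open
    intervals from 0 to the total mass.\<close>
  define T where "T s = Q (k * F s)" for s
  have kF: "0 < k * F s" "k * F s < Ig" if "0 < s" for s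
    using Fp(5,6)[OF that] k Ipos by (auto simp: k_def field_simps)
  have T: "0 < T s" "G (T s) = k * F s" if "0 < s" for s
    using Q kF that by (auto simp: T_def)
  have Tder: "(T has_real_derivative k * f s / g (T s)) (at s)" if s: "0 < s" for s
    unfolding T_def[abs_def]
    by (rule DERIV_cong[OF DERIV_chain2[OF Qder DERIV_cmult[OF Fp(1)]]])
      (use kF s in \<open>auto simp: T_def field_simps\<close>)
  define Z where "Z s = (1 - u) * s + u * T s" for s
  have Zpos: "0 < Z s" if "0 < s" for s
    using T(1)[OF that] that u by (auto simp: Z_def intro!: add_pos_pos)
  \<comment> \<open>With this constant \<open>c * If\<close> equals
    \<open>If powr (1 - u) * Ig powr u\<close>, so the claim is the limit of
    \<open>c * F s \<le> H (Z s)\<close> as \<open>s\<close> grows.\<close>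
  define c where "c = k powr u"
  have Dder: "((\<lambda>s. H (Z s) - c * F s) has_real_derivative
      h (Z s) * ((1 - u) + u * (k * f s / g (T s))) - c * f s) (at s)" if s: "0 < s" for s
    unfolding Z_def
    by (rule DERIV_diff DERIV_chain2[OF Hp(1)] DERIV_add DERIV_cmult Tder Fp(1) s
        Zpos[OF s, unfolded Z_def] | (rule DERIV_cong, rule DERIV_cmult, rule DERIV_ident, simp))+
  have Dge: "0 \<le> h (Z s) * ((1 - u) + u * (k * f s / g (T s))) - c * f s" if s: "0 < s" for s
  proof -
    define q where "q = k * f s / g (T s)"
    have gp: "0 < g (T s)" "0 < f s" using g(2) f(2) T s by auto
    have q: "0 < q" using gp k by (simp add: q_def)
    have am: "q powr u \<le> (1 - u) + u * q"
      using Youngs_inequality_0[of "1 - u" u 1 q] u q by simp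
    have "c * f s = f s powr (1 - u) * g (T s) powr u * q powr u"
      using gp k u by (simp add: q_def c_def powr_mult powr_divide powr_diff)
    also have "\<dots> \<le> h (Z s) * ((1 - u) + u * q)"
      using fgh[OF s T(1)[OF s]] am h(2) Zpos[OF s] by (intro mult_mono) (auto simp: Z_def)
    finally show ?thesis by (simp add: q_def)
  qed
  have Dmono: "H (Z s) - c * F s \<le> H (Z t) - c * F t" if st: "0 < s" "s \<le> t" for s t
  proof (rule DERIV_nonneg_imp_nondecreasing[OF st(2)])
    fix x assume "s \<le> x" "x \<le> t"
    then have "0 < x" using st by simp
    then show "\<exists>y. ((\<lambda>s. H (Z s) - c * F s) has_real_derivative y) (at x) \<and> 0 \<le> y"
      using Dder Dge by blast
  qed
  have D0: "0 \<le> H (Z t) - c * F t" if t: "0 < t" for t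
  proof -
    \<comment> \<open>\<open>H (Z s)\<close> enters only through its sign, which makes the limit of
      \<open>c * F s\<close> at 0 sufficient.\<close>
    have "((\<lambda>s. - c * F s) \<longlongrightarrow> - c * 0) (at_right 0)" by (intro tendsto_intros Fp(3))
    then have "((\<lambda>s. - c * F s) \<longlongrightarrow> 0) (at_right 0)" by simp
    moreover have "\<forall>\<^sub>F s in at_right 0. - c * F s \<le> H (Z t) - c * F t"
    proof -
      have "- c * F s \<le> H (Z t) - c * F t" if s: "0 < s" "s < t" for s
        using Dmono[of s t] Hp(5)[OF Zpos[OF s(1)]] s by simp
      then show ?thesis using t by (auto simp: eventually_at_right_field)
    qed
    ultimately show ?thesis by (rule tendsto_upperbound) auto
  qed
  have "c * F t \<le> Ih" if "0 < t" for t using D0[OF that] Hp(6)[OF Zpos[OF that]] by simp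
  then have ev: "\<forall>\<^sub>F t in at_top. c * F t \<le> Ih"
    by (intro eventually_mono[OF eventually_gt_at_top[of 0]]) auto
  have "((\<lambda>t. c * F t) \<longlongrightarrow> c * If) at_top" by (intro tendsto_intros Fp(4))
  then have "c * If \<le> Ih" by (rule tendsto_upperbound[OF _ ev]) auto
  moreover have "c * If = If powr (1 - u) * Ig powr u"
    using Ipos by (simp add: c_def k_def powr_divide powr_diff)
  ultimately show ?thesis by (simp add: If_def Ig_def Ih_def)
qed

subsection \<open>Trigonometric inequalities\<close>

lemma mult_cos_le_sin:
  fixes y :: real
  assumes "0 \<le> y" "y \<le> pi"
  shows "y * cos y \<le> sin y"
proof -
  have "sin 0 - 0 * cos 0 \<le> sin y - y * cos y"
  proof (rule DERIV_nonneg_imp_nondecreasing[OF assms(1)])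
    fix x :: real assume x: "0 \<le> x" "x \<le> y"
    have "((\<lambda>y. sin y - y * cos y) has_real_derivative x * sin x) (at x)"
      by (auto intro!: derivative_eq_intros)
    moreover have "0 \<le> x * sin x" using x assms by (intro mult_nonneg_nonneg sin_ge_zero) auto
    ultimately show "\<exists>D. ((\<lambda>y. sin y - y * cos y) has_real_derivative D) (at x) \<and> 0 \<le> D" by blast
  qed
  then show ?thesis by simp
qed

lemma mult_cot_le_1:
  fixes y :: real
  assumes "0 < y" "y < pi"
  shows "y * cot y \<le> 1"
  using mult_cos_le_sin[of y] sin_gt_zero[of y] assms by (simp add: cot_def field_simps)

lemma cos_bound_lower:
  fixes x :: real
  assumes "0 \<le> x"
  shows "1 - x\<^sup>2 / 2 \<le> cos x"
proof -
  have "(sin (x / 2))\<^sup>2 \<le> (x / 2)\<^sup>2"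
    using abs_sin_x_le_abs_x[of "x / 2"] unfolding abs_le_square_iff .
  then show ?thesis using cos_double_sin[of "x / 2"] by (simp add: power_divide)
qed

text \<open>Minus the derivative of \<open>y * cot y\<close>. Terms such as
  \<open>a * cot (a * \<theta>)\<close> become values of \<open>y * cot y\<close> after
  multiplication by \<open>\<theta>\<close>, so their differences are mean values of this
  function.\<close>

definition xcot_slope :: "real \<Rightarrow> real" where
  "xcot_slope y = (y - sin y * cos y) / (sin y)\<^sup>2"

lemma DERIV_xcot:
  assumes "0 < y" "y < pi"
  shows "((\<lambda>y. y * cot y) has_real_derivative - xcot_slope y) (at y)"
proof -
  have s: "sin y \<noteq> 0" using sin_gt_zero[of y] assms by simp
  have "((\<lambda>y. y * cot y) has_real_derivative 1 * cot y + - inverse ((sin y)\<^sup>2) * y) (at y)"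
    by (intro DERIV_mult DERIV_ident DERIV_cot s)
  moreover have "1 * cot y + - inverse ((sin y)\<^sup>2) * y = - xcot_slope y"
    using s by (simp add: xcot_slope_def cot_def field_simps power2_eq_square)
  ultimately show ?thesis by simp
qed

lemma xcot_slope_pos:
  assumes "0 < y" "y < pi"
  shows "0 < xcot_slope y"
proof -
  have s: "0 < sin y" "sin y \<le> y" using sin_gt_zero[of y] sin_x_le_x[of y] assms by auto
  have "cos y < 1" using cos_monotone_0_pi[of 0 y] assms by simp
  then have "sin y * cos y < sin y * 1" using s by (intro mult_strict_left_mono) auto
  then have "0 < y - sin y * cos y" using s by linarith
  then show ?thesis using s by (simp add: xcot_slope_def)
qed

text \<open>Multiplied by \<open>(sin y)^2\<close> the claim reads
  \<open>cos y * (sin y - y * cos y) \<ge> 0\<close>, whence the restriction to angles up to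
  \<open>\<pi>/2\<close>.\<close>

lemma xcot_slope_le:
  assumes "0 < y" "y \<le> pi / 2"
  shows "xcot_slope y \<le> y"
proof -
  have s: "0 < sin y" using sin_gt_zero[of y] assms by simp
  have "y * (cos y)\<^sup>2 \<le> sin y * cos y"
    using mult_right_mono[OF mult_cos_le_sin[of y], of "cos y"] cos_ge_zero[of y] assms
    by (simp add: power2_eq_square mult.assoc)
  then have "y - sin y * cos y \<le> y * (sin y)\<^sup>2"
    by (simp add: sin_squared_eq algebra_simps)
  then show ?thesis using s by (simp add: xcot_slope_def divide_le_eq)
qed

text \<open>The derivative reduces to \<open>2 * (sin z - z * cos z) / (sin z)^3\<close>; in other
  words, \<open>y * cot y\<close> is concave on \<open>(0, \<pi>)\<close>.\<close>

lemma xcot_slope_mono: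
  assumes "0 < x" "x \<le> y" "y < pi"
  shows "xcot_slope x \<le> xcot_slope y"
proof (rule DERIV_nonneg_imp_nondecreasing[OF assms(2)])
  fix z assume z: "x \<le> z" "z \<le> y"
  have s: "0 < sin z" using sin_gt_zero[of z] assms z by simp
  have cs: "cos z * cos z = 1 - sin z * sin z"
    using sin_cos_squared_add[of z] by (simp add: power2_eq_square algebra_simps)
  have "(xcot_slope has_real_derivative
      ((1 - (cos z * cos z - sin z * sin z)) * (sin z)\<^sup>2 - (z - sin z * cos z) * (2 * sin z * cos z))
        / ((sin z)\<^sup>2)\<^sup>2) (at z)"
    unfolding xcot_slope_def[abs_def]
    by (rule derivative_eq_intros refl | use s in \<open>simp; fail\<close>
      | (use s in \<open>simp add: power2_eq_square algebra_simps\<close>))+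
  also have "(1 - (cos z * cos z - sin z * sin z)) * (sin z)\<^sup>2 - (z - sin z * cos z) * (2 * sin z * cos z)
    = 2 * sin z * (sin z - z * cos z) + 2 * (sin z)^2 * (cos z * cos z + sin z * sin z - 1)"
    using cs by algebra
  also have "\<dots> = 2 * sin z * (sin z - z * cos z)" unfolding cs by simp
  finally have "(xcot_slope has_real_derivative
     2 * sin z * (sin z - z * cos z) / ((sin z)\<^sup>2)\<^sup>2) (at z)" .
  moreover have "0 \<le> 2 * sin z * (sin z - z * cos z) / ((sin z)\<^sup>2)\<^sup>2"
    using s mult_cos_le_sin[of z] z assms by (intro divide_nonneg_nonneg mult_nonneg_nonneg) auto
  ultimately show "\<exists>D. (xcot_slope has_real_derivative D) (at z) \<and> 0 \<le> D" by blast
qed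

lemma xcot_mvt:
  assumes "0 < x" "x < y" "y < pi"
  obtains \<xi> where "x < \<xi>" "\<xi> < y" "x * cot x - y * cot y = (y - x) * xcot_slope \<xi>"
proof -
  have "\<exists>z>x. z < y \<and> y * cot y - x * cot x = (y - x) * - xcot_slope z"
    by (rule MVT2[OF assms(2)]) (use DERIV_xcot assms in auto)
  then show ?thesis using that by (auto simp: algebra_simps)
qed

lemma xcot_antimono:
  assumes "0 < x" "x \<le> y" "y < pi"
  shows "y * cot y \<le> x * cot x"
proof (cases "x = y")
  case False
  then obtain \<xi> where "x < \<xi>" "\<xi> < y" "x * cot x - y * cot y = (y - x) * xcot_slope \<xi>"
    using xcot_mvt[of x y] assms by auto
  moreover have "0 < (y - x) * xcot_slope \<xi>"
    using calculation assms by (intro mult_pos_pos xcot_slope_pos) auto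
  ultimately show ?thesis by simp
qed simp

lemma xcot_diff_le:
  assumes "0 < x" "x \<le> y" "y \<le> pi / 2"
  shows "x * cot x - y * cot y \<le> (y\<^sup>2 - x\<^sup>2) / 2"
proof -
  have "x * cot x + x\<^sup>2 / 2 \<le> y * cot y + y\<^sup>2 / 2"
  proof (rule DERIV_nonneg_imp_nondecreasing[OF assms(2)])
    fix z assume z: "x \<le> z" "z \<le> y"
    have "((\<lambda>y. y * cot y + y\<^sup>2 / 2) has_real_derivative - xcot_slope z + z) (at z)"
      by (rule DERIV_add[OF DERIV_xcot]) (use z assms in \<open>auto intro!: derivative_eq_intros\<close>)
    moreover have "0 \<le> - xcot_slope z + z" using xcot_slope_le[of z] z assms by simp
    ultimately show "\<exists>D. ((\<lambda>y. y * cot y + y\<^sup>2 / 2) has_real_derivative D) (at z) \<and> 0 \<le> D" by blast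
  qed
  then show ?thesis by (simp add: diff_divide_distrib)
qed

section \<open>The two slope inequalities\<close>

text \<open>With \<open>p = cot (a\<theta>)\<close>, \<open>s = cot ((1 - a)\<theta>)\<close>, \<open>t = p + s\<close> and \<open>d = a p - (1 - a) s\<close>, this is
  the monotonicity of the slope \<open>dn / dt\<close> of the curve with \<open>\<beta> = \<alpha>\<close>.\<close>

lemma slope_inequality_ge_half:
  fixes a \<theta> :: real
  defines "p \<equiv> cot (a * \<theta>)" and "s \<equiv> cot ((1 - a) * \<theta>)"
  defines "t \<equiv> p + s" and "d \<equiv> a * p - (1 - a) * s"
  assumes a: "1 / 2 \<le> a" "a < 1" and th: "0 < \<theta>" "\<theta> < pi"
  shows "0 < t" and "0 \<le> (1 + d\<^sup>2)\<^sup>2 + a * (1 - a) * t\<^sup>2 * (1 - 3 * d\<^sup>2) - 2 * (2 * a - 1) * t * d * (1 + d\<^sup>2)"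
proof -
  define A where "A = a * \<theta>"
  define C where "C = (1 - a) * \<theta>"
  have AC: "0 < C" "C \<le> A" "A < \<theta>" "A + C = \<theta>" 
    using a th by (auto simp: A_def C_def algebra_simps)
  have sn: "0 < sin A" "0 < sin C" "0 < sin (A + C)"
    using AC th by (auto intro!: sin_gt_zero)
  have "t = sin (A + C) / (sin A * sin C)"
    using sn unfolding t_def p_def s_def A_def[symmetric] C_def[symmetric] cot_def sin_add
    by (simp add: field_simps)
  then show t: "0 < t" using sn by simp
  define \<delta> where "\<delta> = (2 * a - 1) * \<theta>"
  define D where "D = - d"
  have dth: "D * \<theta> = C * cot C - A * cot A"
    by (simp add: D_def d_def p_def s_def A_def C_def algebra_simps)
  have \<delta>AC: "\<delta> = A - C" "0 \<le> \<delta>" using a th by (auto simp: \<delta>_def A_def C_def algebra_simps)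
  have D0: "0 \<le> D"
  proof -
    have "0 \<le> D * \<theta>" using xcot_antimono[of C A] AC th dth by simp
    then show ?thesis using th by (simp add: zero_le_mult_iff)
  qed
  \<comment> \<open>Together with \<open>a * (1 - a) * t * \<theta> \<le> 1\<close> this settles all
    terms other than the square \<open>(1 + d^2)^2\<close>, of which only nonnegativity is used. If
    \<open>D \<le> \<delta>\<close>, replacing \<open>\<delta>\<close> by \<open>D\<close> leaves
    the positive gap \<open>2 * D^4 - D^2 + 1\<close>.\<close>
  have key: "3 * D\<^sup>2 - 1 \<le> 2 * \<delta> * D * (1 + D\<^sup>2)"
  proof (cases "D \<le> \<delta>")
    case True
    have "2 * D * D * (1 + D\<^sup>2) \<le> 2 * \<delta> * D * (1 + D\<^sup>2)"
      using True D0 by (intro mult_right_mono) auto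
    moreover have "3 * D\<^sup>2 - 1 \<le> 2 * D * D * (1 + D\<^sup>2)"
      using zero_le_power2[of "D\<^sup>2 - 1/4"] by (simp add: power2_eq_square algebra_simps)
    ultimately show ?thesis by simp
  next
    case False
    \<comment> \<open>With \<open>3/4\<close> in place of \<open>\<delta>\<close> the gap in
      \<open>key\<close> is \<open>1 + 3/2 * D * (D - 1)^2\<close>. For smaller
      \<open>\<delta>\<close> the mean slope of \<open>y * cot y\<close> between \<open>C\<close>
      and \<open>A\<close> is at most \<open>\<theta>\<close>, which would force
      \<open>D \<le> \<delta>\<close>.\<close>
    have "3 / 4 \<le> \<delta>"
    proof (rule ccontr)
      assume d34: "\<not> 3 / 4 \<le> \<delta>"
      have "C \<noteq> A" using False \<delta>AC dth th D0 by auto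
      then obtain \<xi> where x: "C < \<xi>" "\<xi> < A" "C * cot C - A * cot A = (A - C) * xcot_slope \<xi>"
        using xcot_mvt[of C A] AC th by auto
      have "xcot_slope \<xi> \<le> \<theta>"
      proof (cases "\<xi> \<le> pi / 2")
        case True
        then show ?thesis using xcot_slope_le[of \<xi>] x AC by simp
      next
        case False
        define z where "z = \<xi> - pi / 2"
        \<comment> \<open>Since \<open>A = (\<theta> + \<delta>) / 2\<close>, the assumption
          \<open>\<delta> < 3/4\<close> keeps \<open>A\<close>, hence \<open>\<xi>\<close>, below
          \<open>\<pi>/2 + 3/8\<close>. Read the other way,
          \<open>\<theta> = 2 * A - \<delta>\<close> gives the lower bound
          \<open>th2\<close>.\<close>
        have z: "0 < z" "z < 3 / 8" using False x d34 AC \<delta>AC th by (auto simp: z_def)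
        have xz: "\<xi> = pi / 2 + z" by (simp add: z_def)
        have th2: "pi - 3 / 4 + 2 * z \<le> \<theta>" using x AC \<delta>AC d34 xz by simp
        have sz: "0 < sin z" "sin z \<le> z" "0 < cos z"
          using z pi_gt3 by (auto intro!: sin_gt_zero cos_gt_zero sin_x_le_x)
        have e: "xcot_slope \<xi> = (pi / 2 + z + sin z * cos z) / (cos z)\<^sup>2"
          by (simp add: xcot_slope_def xz sin_add cos_add)
        have m: "sin z * cos z \<le> z * 1" using sz z by (intro mult_mono) auto
        have c2: "1 - z\<^sup>2 \<le> (cos z)\<^sup>2"
          using power_mono[OF sz(2), of 2] sz by (simp add: cos_squared_eq)
        have z2: "z\<^sup>2 \<le> (3/8)\<^sup>2" using z by (intro power_mono) auto
        have "pi / 2 + z + sin z * cos z \<le> pi / 2 + 2 * z" using m by simp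
        also have "\<dots> \<le> (pi - 3 / 4 + 2 * z) * (1 - z\<^sup>2)"
        proof -
          have "z\<^sup>2 * (pi - 3 / 4 + 2 * z) \<le> (3/8)\<^sup>2 * (3.2 - 3/4 + 2 * (3/8))"
            using z z2 pi_approx by (intro mult_mono) auto
          also have "\<dots> \<le> pi / 2 - 3 / 4" using pi_approx by (simp add: power2_eq_square)
          finally have "pi / 2 + 2 * z \<le> (pi - 3 / 4 + 2 * z) - z\<^sup>2 * (pi - 3 / 4 + 2 * z)"
            by linarith
          moreover have "(pi - 3 / 4 + 2 * z) * (1 - z\<^sup>2) = (pi - 3 / 4 + 2 * z) - z\<^sup>2 * (pi - 3 / 4 + 2 * z)"
          proof -
            have "q * (1 - w) = q - w * q" for q w :: real by (simp add: algebra_simps)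
            then show ?thesis .
          qed
          ultimately show ?thesis by linarith
        qed
        also have "\<dots> \<le> \<theta> * (cos z)\<^sup>2"
          using th2 c2 z z2 th by (intro mult_mono) (auto simp: power2_eq_square)
        finally show ?thesis using sz by (simp add: e divide_le_eq)
      qed
      then have "D * \<theta> \<le> \<delta> * \<theta>" unfolding dth x(3) \<delta>AC(1) using AC by (intro mult_left_mono) auto
      then show False using False th by simp
    qed
    then have "2 * (3/4) * D * (1 + D\<^sup>2) \<le> 2 * \<delta> * D * (1 + D\<^sup>2)"
      using D0 by (intro mult_right_mono) auto
    moreover have "3 * D\<^sup>2 - 1 \<le> 2 * (3/4) * D * (1 + D\<^sup>2)"
      using mult_nonneg_nonneg[OF D0 zero_le_power2[of "D - 1"]] by (simp add: power2_eq_square algebra_simps)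
    ultimately show ?thesis by simp
  qed
  have actth: "a * (1 - a) * t * \<theta> \<le> 1"
  proof -
    have "a * (1 - a) * t * \<theta> = (1 - a) * (A * cot A) + a * (C * cot C)"
      by (simp add: t_def p_def s_def A_def C_def algebra_simps)
    also have "\<dots> \<le> (1 - a) * 1 + a * 1"
      using mult_cot_le_1[of A] mult_cot_le_1[of C] AC th a by (intro add_mono mult_left_mono) auto
    finally show ?thesis by simp
  qed
  have "a * (1 - a) * t\<^sup>2 * (3 * D\<^sup>2 - 1) \<le> 2 * (2 * a - 1) * t * D * (1 + D\<^sup>2)"
  proof (cases "3 * D\<^sup>2 \<le> 1")
    case True
    have "a * (1 - a) * t\<^sup>2 * (3 * D\<^sup>2 - 1) \<le> 0"
      using True a by (intro mult_nonneg_nonpos) auto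
    also have "0 \<le> 2 * (2 * a - 1) * t * D * (1 + D\<^sup>2)" using a t D0 by (intro mult_nonneg_nonneg) auto
    finally show ?thesis .
  next
    case False
    have "\<theta> * (a * (1 - a) * t\<^sup>2 * (3 * D\<^sup>2 - 1)) = (a * (1 - a) * t * \<theta>) * (t * (3 * D\<^sup>2 - 1))"
      by (simp add: power2_eq_square algebra_simps)
    also have "\<dots> \<le> 1 * (t * (3 * D\<^sup>2 - 1))"
      using actth False t by (intro mult_right_mono) auto
    also have "\<dots> \<le> t * (2 * \<delta> * D * (1 + D\<^sup>2))" using key t by simp
    also have "\<dots> = \<theta> * (2 * (2 * a - 1) * t * D * (1 + D\<^sup>2))" by (simp add: \<delta>_def algebra_simps)
    finally show ?thesis using th by simp
  qed
  then show "0 \<le> (1 + d\<^sup>2)\<^sup>2 + a * (1 - a) * t\<^sup>2 * (1 - 3 * d\<^sup>2) - 2 * (2 * a - 1) * t * d * (1 + d\<^sup>2)"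
  proof -
    have "(1 + d\<^sup>2)\<^sup>2 + a * (1 - a) * t\<^sup>2 * (1 - 3 * d\<^sup>2) - 2 * (2 * a - 1) * t * d * (1 + d\<^sup>2)
      = (1 + D\<^sup>2)\<^sup>2 + (2 * (2 * a - 1) * t * D * (1 + D\<^sup>2) - a * (1 - a) * t\<^sup>2 * (3 * D\<^sup>2 - 1))"
      by (simp add: D_def algebra_simps)
    then show "a * (1 - a) * t\<^sup>2 * (3 * D\<^sup>2 - 1) \<le> 2 * (2 * a - 1) * t * D * (1 + D\<^sup>2) \<Longrightarrow> ?thesis"
      using zero_le_power2[of "1 + D\<^sup>2"] by linarith
  qed
qed

text \<open>Exchanging \<open>a\<close> and \<open>1 - a\<close> swaps \<open>p\<close> and
  \<open>s\<close> and changes the signs of \<open>d\<close> and \<open>2 * a - 1\<close>, which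
  leaves the expression invariant; so the case \<open>1/2 \<le> a\<close> suffices.\<close>

lemma slope_inequality:
  fixes a \<theta> :: real
  defines "p \<equiv> cot (a * \<theta>)" and "s \<equiv> cot ((1 - a) * \<theta>)"
  defines "t \<equiv> p + s" and "d \<equiv> a * p - (1 - a) * s"
  assumes a: "0 < a" "a < 1" and th: "0 < \<theta>" "\<theta> < pi"
  shows "0 < t" and "0 \<le> (1 + d\<^sup>2)\<^sup>2 + a * (1 - a) * t\<^sup>2 * (1 - 3 * d\<^sup>2) - 2 * (2 * a - 1) * t * d * (1 + d\<^sup>2)"
proof -
  have "0 < t \<and> 0 \<le> (1 + d\<^sup>2)\<^sup>2 + a * (1 - a) * t\<^sup>2 * (1 - 3 * d\<^sup>2) - 2 * (2 * a - 1) * t * d * (1 + d\<^sup>2)"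
  proof (cases "1 / 2 \<le> a")
    case True
    then show ?thesis
      using slope_inequality_ge_half[of a \<theta>] a th unfolding d_def t_def p_def s_def by blast
  next
    case False
    define d' where "d' = - d"
    have e: "(1 - a) * s - a * p = d'" "s + p = t" by (auto simp: d'_def d_def t_def)
    have "0 < t" "0 \<le> (1 + d'\<^sup>2)\<^sup>2 + (1 - a) * a * t\<^sup>2 * (1 - 3 * d'\<^sup>2) - 2 * (2 * (1 - a) - 1) * t * d' * (1 + d'\<^sup>2)"
      using slope_inequality_ge_half[of "1 - a" \<theta>] a th False e unfolding p_def s_def by auto
    then show ?thesis by (simp add: d'_def algebra_simps)
  qed
  then show "0 < t" and "0 \<le> (1 + d\<^sup>2)\<^sup>2 + a * (1 - a) * t\<^sup>2 * (1 - 3 * d\<^sup>2) - 2 * (2 * a - 1) * t * d * (1 + d\<^sup>2)"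
    by auto
qed

text \<open>The corresponding inequality for \<open>\<beta> = 0\<close>, with \<open>P = a cot (a\<theta>)\<close>,
  \<open>\<sigma> = (1 - a) cot ((1 - a)\<theta>)\<close> and \<open>r = cot \<theta>\<close>. The constant \<open>4/5\<close> enters only here.\<close>

lemma slope_inequality_0_le_half:
  fixes a \<theta> :: real
  defines "P \<equiv> a * cot (a * \<theta>)" and "\<sigma> \<equiv> (1 - a) * cot ((1 - a) * \<theta>)" and "r \<equiv> cot \<theta>"
  assumes a: "0 < a" "a \<le> 1 / 2" and th: "0 < \<theta>" "\<theta> < pi"
  shows "a * P * (P - \<sigma>) + (\<sigma> - r) * (r - (1 + a) * (P - \<sigma>)) \<le> 2 * a"
proof -
  define A where "A = a * \<theta>"
  define C where "C = (1 - a) * \<theta>"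
  define X where "X = P - \<sigma>"
  have AC: "0 < A" "0 < C" "A \<le> C" "C < \<theta>" "A \<le> pi / 2" "A + C = \<theta>"
    using a th mult_mono[of a "1/2" \<theta> pi] by (auto simp: A_def C_def algebra_simps)
  have Xth: "X * \<theta> = A * cot A - C * cot C" and rth: "(\<sigma> - r) * \<theta> = C * cot C - \<theta> * cot \<theta>"
    by (auto simp: X_def P_def \<sigma>_def r_def A_def C_def algebra_simps)
  have X0: "0 \<le> X"
  proof -
    have "0 \<le> X * \<theta>" using xcot_antimono[of A C] AC th Xth by simp
    then show ?thesis using th by (simp add: zero_le_mult_iff)
  qed
  have sr0: "0 \<le> \<sigma> - r"
  proof -
    have "0 \<le> (\<sigma> - r) * \<theta>" using xcot_antimono[of C \<theta>] AC th rth by simp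
    then show ?thesis using th by (simp add: zero_le_mult_iff)
  qed
  have Pth: "P * \<theta> \<le> 1" using mult_cot_le_1[of A] AC th by (simp add: P_def A_def mult.commute mult.left_commute)
  have P0: "0 \<le> P"
  proof -
    have "0 \<le> cot A" unfolding cot_def using AC th
      by (intro divide_nonneg_nonneg cos_ge_zero sin_ge_zero) auto
    then show ?thesis using a by (simp add: P_def A_def)
  qed
  \<comment> \<open>For \<open>r > 0\<close> all angles are acute, and the quadratic bounds for
    \<open>y * cot y\<close> give \<open>P * X \<le> 1/2\<close> and
    \<open>(\<sigma> - r) * r \<le> a\<close>, in total at most \<open>3/2 * a\<close>.\<close>
  show ?thesis
  proof (cases "0 < r")
    case True
    have th2: "\<theta> < pi / 2"
    proof (rule ccontr)
      assume "\<not> ?thesis"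
      then have "cos \<theta> \<le> 0" using th cos_monotone_0_pi_le[of "pi/2" \<theta>] by simp
      then show False using True sin_gt_zero[OF th] by (simp add: r_def cot_def zero_less_divide_iff)
    qed
    have "X * \<theta> \<le> (C\<^sup>2 - A\<^sup>2) / 2" unfolding Xth by (rule xcot_diff_le) (use AC th2 in auto)
    also have "\<dots> \<le> \<theta>\<^sup>2 / 2"
    proof -
      have "C\<^sup>2 \<le> \<theta>\<^sup>2" using AC by (intro power_mono) auto
      then have "C\<^sup>2 - A\<^sup>2 \<le> \<theta>\<^sup>2" by (rule order_trans[rotated]) simp
      then show ?thesis by (rule divide_right_mono) simp
    qed
    finally have "X \<le> \<theta> / 2" using th by (simp add: power2_eq_square)
    then have "P * X \<le> P * (\<theta> / 2)" by (intro mult_left_mono P0)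
    then have PX: "P * X \<le> 1 / 2" using Pth by simp
    have "(\<sigma> - r) * \<theta> \<le> (\<theta>\<^sup>2 - C\<^sup>2) / 2" unfolding rth by (rule xcot_diff_le) (use AC th2 in auto)
    also have "\<dots> = a * \<theta>\<^sup>2 - (a * \<theta>)\<^sup>2 / 2" by (simp add: C_def power2_eq_square field_simps)
    also have "\<dots> \<le> a * \<theta>\<^sup>2" by simp
    finally have "\<sigma> - r \<le> a * \<theta>" using th by (simp add: power2_eq_square)
    then have "(\<sigma> - r) * r \<le> (a * \<theta>) * r" using True by (intro mult_right_mono) auto
    also have "\<dots> \<le> a" using mult_cot_le_1[OF th] a by (simp add: r_def mult.assoc)
    finally have "(\<sigma> - r) * r \<le> a" .
    moreover have "0 \<le> (\<sigma> - r) * ((1 + a) * X)" using sr0 X0 a by (intro mult_nonneg_nonneg) auto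
    moreover have "a * (P * X) \<le> a * (1 / 2)" using PX a by (intro mult_left_mono) auto
    moreover have "(\<sigma> - r) * (r - (1 + a) * X) = (\<sigma> - r) * r - (\<sigma> - r) * ((1 + a) * X)"
      by (rule right_diff_distrib)
    moreover have "a * P * X = a * (P * X)" by simp
    ultimately show ?thesis using a unfolding X_def[symmetric] by linarith
  next
    case False
    \<comment> \<open>Both sides are mean slopes of \<open>y * cot y\<close>, with weights
      \<open>a * (1 - 2 * a)\<close> and \<open>a\<close>, and the slope increases. The factor
      multiplying \<open>\<sigma> - r\<close> is nonpositive here, so \<open>\<sigma> - r\<close>
      may be replaced by \<open>a * X\<close>; then \<open>a * X\<close> can be taken out of the
      whole expression.\<close>
    have aX: "a * X \<le> \<sigma> - r"
    proof (cases "A = C")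
      case True
      then have "X = 0" using Xth th by simp
      then show ?thesis using sr0 by simp
    next
      case False
      obtain \<xi>1 where x1: "A < \<xi>1" "\<xi>1 < C" "A * cot A - C * cot C = (C - A) * xcot_slope \<xi>1"
        using xcot_mvt[of A C] AC False th by auto
      obtain \<xi>2 where x2: "C < \<xi>2" "\<xi>2 < \<theta>" "C * cot C - \<theta> * cot \<theta> = (\<theta> - C) * xcot_slope \<xi>2"
        using xcot_mvt[of C \<theta>] AC th by auto
      have h0: "0 < xcot_slope \<xi>1" using xcot_slope_pos[of \<xi>1] x1 AC th by simp
      have h: "xcot_slope \<xi>1 \<le> xcot_slope \<xi>2" by (rule xcot_slope_mono) (use x1 x2 AC th in auto)
      have "X * \<theta> = ((1 - 2 * a) * xcot_slope \<xi>1) * \<theta>" unfolding Xth x1(3) by (simp add: A_def C_def algebra_simps)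
      then have X: "X = (1 - 2 * a) * xcot_slope \<xi>1" using th by simp
      have "(\<sigma> - r) * \<theta> = (a * xcot_slope \<xi>2) * \<theta>" unfolding rth x2(3) by (simp add: A_def C_def algebra_simps)
      then have S: "\<sigma> - r = a * xcot_slope \<xi>2" using th by simp
      have "(1 - 2 * a) * xcot_slope \<xi>1 \<le> 1 * xcot_slope \<xi>2" using h h0 a by (intro mult_mono) auto
      then show ?thesis unfolding X S using a by simp
    qed
    have "0 \<le> (1 + a) * X" using X0 a by (intro mult_nonneg_nonneg) auto
    then have "r - (1 + a) * X \<le> 0" using False by linarith
    then have "(\<sigma> - r) * (r - (1 + a) * X) \<le> (a * X) * (r - (1 + a) * X)"
      using aX by (intro mult_right_mono_neg)
    then have "a * P * X + (\<sigma> - r) * (r - (1 + a) * X) \<le> a * (X * (r + ((1 + a) * \<sigma> - a * P)))"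
      by (simp add: X_def algebra_simps)
    also have "\<dots> \<le> a * 1"
    proof (rule mult_left_mono)
      show "X * (r + ((1 + a) * \<sigma> - a * P)) \<le> 1"
      proof (cases "\<sigma> \<le> 0")
        case True
        have "r + ((1 + a) * \<sigma> - a * P) \<le> 0"
        proof -
          have "(1 + a) * \<sigma> \<le> 0" using True a by (intro mult_nonneg_nonpos) auto
          moreover have "0 \<le> a * P" using P0 a by (intro mult_nonneg_nonneg) auto
          ultimately show ?thesis using False by linarith
        qed
        then have "X * (r + ((1 + a) * \<sigma> - a * P)) \<le> 0" using X0 by (intro mult_nonneg_nonpos)
        then show ?thesis by linarith
      next
        case s0: False
        have "\<sigma> \<le> P" using X0 by (simp add: X_def)
        then have "a * \<sigma> \<le> a * P" using a by simp
        moreover have "(1 + a) * \<sigma> = \<sigma> + a * \<sigma>" by (simp add: algebra_simps)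
        ultimately have "r + ((1 + a) * \<sigma> - a * P) \<le> \<sigma>" using False by linarith
        then have "X * (r + ((1 + a) * \<sigma> - a * P)) \<le> X * \<sigma>" using X0 by (intro mult_left_mono)
        also have "\<dots> \<le> P\<^sup>2 / 4" using zero_le_power2[of "P - 2 * \<sigma>"] by (simp add: X_def power2_eq_square algebra_simps)
        also have "\<dots> \<le> 1"
        proof -
          have "1 \<le> \<theta>"
          proof (rule ccontr)
            assume "\<not> 1 \<le> \<theta>"
            then have "0 < cot \<theta>" using th pi_gt3 by (intro cot_gt_zero) auto
            then show False using False by (simp add: r_def)
          qed
          then have "P * 1 \<le> P * \<theta>" using P0 by (intro mult_left_mono) auto
          then have "P \<le> 1" using Pth by simp
          then show ?thesis using power_mono[of P 1 2] P0 by simp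
        qed
        finally show ?thesis .
      qed
    qed (use a in auto)
    finally show ?thesis using a unfolding X_def[symmetric] by linarith
  qed
qed

text \<open>Stands for \<open>R = - cot \<theta>\<close> and \<open>D = \<sigma> - P\<close>. The
  expression is a square in \<open>R - (1 + a) / 2 * D\<close>, plus
  \<open>\<sigma> * (R - D) + 2 * a\<close>, minus a multiple of \<open>D^2\<close>. The parameters
  are numerical bounds: \<open>g\<close> for the root of the square, \<open>m\<close> for the
  negative part of \<open>R - D\<close>, \<open>S\<close> and \<open>D0\<close> for
  \<open>\<sigma>\<close> and \<open>D\<close>; \<open>9/10\<close> is \<open>(1 + a) / 2\<close> at
  \<open>a = 4/5\<close>.\<close>

lemma slope_inequality_0_obtuse:
  fixes a \<sigma> D R :: real
  assumes a: "1 / 2 \<le> a" "a \<le> 4 / 5" and D: "0 \<le> D" "D \<le> D0" and \<sigma>: "0 \<le> \<sigma>" "\<sigma> \<le> S"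
    and RD: "- m \<le> R - D" "0 \<le> m" and g: "0 \<le> g" "g \<le> R - 9 / 10 * D0 \<or> g = 0"
    and num: "D0\<^sup>2 * (3 / 20 + 73 / 40 * a) + S * m \<le> 2 * a + g\<^sup>2"
  shows "0 \<le> (R + \<sigma>) * (R - (1 + a) * D) + a * D * (\<sigma> - D) + 2 * a"
proof -
  have "g\<^sup>2 \<le> (R - (1 + a) / 2 * D)\<^sup>2"
  proof (cases "g = 0")
    case False
    have "(1 + a) / 2 * D \<le> 9 / 10 * D0" using a D by (intro mult_mono) auto
    then have "g \<le> R - (1 + a) / 2 * D" using g False by linarith
    then show ?thesis using g by (intro power_mono) auto
  qed simp
  moreover have "- (S * m) \<le> \<sigma> * (R - D)"
  proof -
    have "- (S * m) \<le> - (\<sigma> * m)" using \<sigma> RD by (simp add: mult_right_mono)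
    also have "\<dots> \<le> \<sigma> * (R - D)" using mult_left_mono[OF RD(1) \<sigma>(1)] by simp
    finally show ?thesis .
  qed
  moreover have "(a + (1 + a)\<^sup>2 / 4) * D\<^sup>2 \<le> (3 / 20 + 73 / 40 * a) * D0\<^sup>2"
  proof (rule mult_mono)
    \<comment> \<open>The line \<open>3/20 + 73/40 * a\<close> is the chord of the convex quadratic
      \<open>a + (1 + a)^2 / 4\<close> over \<open>[1/2, 4/5]\<close>.\<close>
    have "0 \<le> (a - 1/2) * (4/5 - a)" using a by (intro mult_nonneg_nonneg) auto
    moreover have "(a - 1/2) * (4/5 - a) = 13 / 10 * a - 4 / 10 - a * a" by (simp add: field_simps)
    ultimately have "a * a \<le> 13 / 10 * a - 4 / 10" by linarith
    moreover have "a + (1 + a)\<^sup>2 / 4 = a * a / 4 + 3 / 2 * a + 1 / 4" by (simp add: power2_eq_square field_simps)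
    ultimately show "a + (1 + a)\<^sup>2 / 4 \<le> 3 / 20 + 73 / 40 * a" by linarith
  qed (use D a power_mono[of D D0 2] in auto)
  ultimately have "0 \<le> (R - (1 + a) / 2 * D)\<^sup>2 + \<sigma> * (R - D) + 2 * a - (a + (1 + a)\<^sup>2 / 4) * D\<^sup>2"
    using num by (simp add: mult.commute)
  also have "\<dots> = (R + \<sigma>) * (R - (1 + a) * D) + a * D * (\<sigma> - D) + 2 * a"
    by (simp add: power2_eq_square field_simps)
  finally show ?thesis .
qed

text \<open>For acute angles the quadratic bounds for \<open>y * cot y\<close> leave at most
  \<open>1.45 * a\<close>. For obtuse angles the claim becomes a quadratic inequality in
  \<open>- cot \<theta>\<close> and \<open>\<sigma> - P\<close>, which is verified numerically on
  five intervals of \<open>\<theta>\<close>.\<close>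

lemma slope_inequality_0_ge_half:
  fixes a \<theta> :: real
  defines "P \<equiv> a * cot (a * \<theta>)" and "\<sigma> \<equiv> (1 - a) * cot ((1 - a) * \<theta>)" and "r \<equiv> cot \<theta>"
  assumes a: "1 / 2 \<le> a" "a \<le> 4 / 5" and th: "0 < \<theta>" "\<theta> < pi"
  shows "a * P * (P - \<sigma>) + (\<sigma> - r) * (r - (1 + a) * (P - \<sigma>)) \<le> 2 * a"
proof -
  define A where "A = a * \<theta>"
  define C where "C = (1 - a) * \<theta>"
  define D where "D = \<sigma> - P"
  define E where "E = P - r"
  have AC: "0 < C" "C \<le> A" "A < \<theta>" "C \<le> pi / 2" "A + C = \<theta>"
    using a th mult_mono[of "1 - a" "1/2" \<theta> pi] by (auto simp: A_def C_def algebra_simps)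
  have Dth: "D * \<theta> = C * cot C - A * cot A" and Eth: "E * \<theta> = A * cot A - \<theta> * cot \<theta>"
    by (auto simp: D_def E_def P_def \<sigma>_def r_def A_def C_def algebra_simps)
  have D0: "0 \<le> D"
  proof -
    have "0 \<le> D * \<theta>" using xcot_antimono[of C A] AC th Dth by simp
    then show ?thesis using th by (simp add: zero_le_mult_iff)
  qed
  have E0: "0 \<le> E"
  proof -
    have "0 \<le> E * \<theta>" using xcot_antimono[of A \<theta>] AC th Eth by simp
    then show ?thesis using th by (simp add: zero_le_mult_iff)
  qed
  have \<sigma>th: "\<sigma> * \<theta> \<le> 1" using mult_cot_le_1[of C] AC th by (simp add: \<sigma>_def C_def mult.commute mult.left_commute)
  have \<sigma>0: "0 \<le> \<sigma>"
  proof -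
    have "0 \<le> cot C" unfolding cot_def using AC th
      by (intro divide_nonneg_nonneg cos_ge_zero sin_ge_zero) auto
    then show ?thesis using a by (simp add: \<sigma>_def C_def)
  qed
  show ?thesis
  proof (cases "\<theta> < pi / 2")
    case True
    have r: "0 < r" "r * \<theta> \<le> 1" using cot_gt_zero th True mult_cot_le_1[OF th] by (auto simp: r_def mult.commute)
    have "D * \<theta> \<le> (A\<^sup>2 - C\<^sup>2) / 2" unfolding Dth by (rule xcot_diff_le) (use AC True in auto)
    also have "\<dots> = ((2 * a - 1) / 2 * \<theta>) * \<theta>" by (simp add: A_def C_def power2_eq_square field_simps)
    finally have D1: "D \<le> (2 * a - 1) / 2 * \<theta>" using th by simp
    have "E * \<theta> \<le> (\<theta>\<^sup>2 - A\<^sup>2) / 2" unfolding Eth by (rule xcot_diff_le) (use AC True in auto)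
    also have "\<dots> = ((1 - a * a) / 2 * \<theta>) * \<theta>" by (simp add: A_def C_def power2_eq_square field_simps)
    finally have E1: "E \<le> (1 - a * a) / 2 * \<theta>" using th by simp
    have "(1 - a) * D + E \<le> (1 - a) * ((2 * a - 1) / 2 * \<theta>) + (1 - a * a) / 2 * \<theta>"
      using D1 E1 a by (intro add_mono mult_left_mono) auto
    also have "\<dots> = 3 / 2 * a * (1 - a) * \<theta>" by (simp add: field_simps)
    finally have "r * ((1 - a) * D + E) \<le> r * (3 / 2 * a * (1 - a) * \<theta>)" using r by (intro mult_left_mono) auto
    also have "\<dots> = 3 / 2 * a * (1 - a) * (r * \<theta>)" by simp
    also have "\<dots> \<le> 3 / 2 * a * (1 - a) * 1" using r a by (intro mult_left_mono) auto
    also have "\<dots> \<le> 3 / 4 * a" using a by simp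
    finally have t1: "r * ((1 - a) * D + E) \<le> 3 / 4 * a" .
    have "(1 + a) * D + E \<le> (1 + a) * ((2 * a - 1) / 2 * \<theta>) + (1 - a * a) / 2 * \<theta>"
      using D1 E1 a by (intro add_mono mult_left_mono) auto
    also have "\<dots> = a * ((1 + a) / 2 * \<theta>)" by (simp add: field_simps)
    also have "\<dots> \<le> a * (9 / 10 * \<theta>)" using a th by (intro mult_left_mono mult_right_mono) auto
    finally have t2: "(1 + a) * D + E \<le> a * (9 / 10 * \<theta>)" .
    have "(2 * a - 1) / 2 * \<theta> \<le> 3 / 10 * \<theta>" using a th by (intro mult_right_mono) auto
    then have D3: "D \<le> 3 / 10 * \<theta>" using D1 by linarith
    have "D * ((1 + a) * D + E) \<le> (3 / 10 * \<theta>) * (a * (9 / 10 * \<theta>))"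
      using D3 t2 D0 E0 a th by (intro mult_mono) auto
    also have "\<dots> = 27 / 100 * a * (\<theta> * \<theta>)" by simp
    also have "\<dots> \<le> 27 / 100 * a * (1.6 * 1.6)"
      using True th pi_approx a by (intro mult_left_mono mult_mono) auto
    finally have "D * ((1 + a) * D + E) \<le> 0.7 * a" using a by simp
    then have "- (a * P * D) + (\<sigma> - r) * (r + (1 + a) * D) \<le> 2 * a"
      using t1 a by (simp add: D_def E_def algebra_simps)
    then show ?thesis by (simp add: D_def algebra_simps)
  next
    case False
    define R where "R = - r"
    have R0: "0 \<le> R"
    proof -
      have "cos \<theta> \<le> 0" using False th cos_monotone_0_pi_le[of "pi/2" \<theta>] by simp
      then show ?thesis using sin_gt_zero[OF th] by (simp add: R_def r_def cot_def divide_nonpos_pos)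
    qed
    have Rge: "(1 - \<phi>\<^sup>2 / 2) / \<phi> \<le> R" if ph: "pi - \<theta> \<le> \<phi>" "\<phi>\<^sup>2 \<le> 2" "0 < \<phi>" for \<phi>
    proof -
      define f where "f = pi - \<theta>"
      have f: "0 < f" "f \<le> \<phi>" "0 < sin f" using th ph by (auto simp: f_def intro!: sin_gt_zero)
      have "f\<^sup>2 \<le> \<phi>\<^sup>2" using f by (intro power_mono) auto
      then have "1 - \<phi>\<^sup>2 / 2 \<le> 1 - f\<^sup>2 / 2" by simp
      also have "\<dots> \<le> cos f" using cos_bound_lower[of f] f by simp
      finally have "(1 - \<phi>\<^sup>2 / 2) / \<phi> \<le> cos f / sin f"
        using f ph sin_x_le_x[of f] by (intro frac_le) auto
      also have "\<dots> = R" by (simp add: R_def r_def f_def cot_def sin_diff cos_diff)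
      finally show ?thesis .
    qed
    have \<sigma>le: "\<sigma> \<le> 1 / u" if "u \<le> \<theta>" "0 < u" for u
    proof -
      have "\<sigma> * u \<le> \<sigma> * \<theta>" using \<sigma>0 that by (intro mult_left_mono) auto
      then have "\<sigma> * u \<le> 1" using \<sigma>th by linarith
      then show ?thesis using that by (simp add: field_simps)
    qed
    \<comment> \<open>\<open>\<sigma>\<close> is at most \<open>1 / \<theta>\<close>, and
      \<open>- P\<close> is positive only if \<open>A\<close> exceeds \<open>\<pi>/2\<close>; then
      \<open>- cot A\<close> is the tangent of the excess, which \<open>a \<le> 4/5\<close> bounds
      by \<open>y\<close>.\<close>
    have Dle: "D \<le> 1 / u + 4 / 5 * (y / (1 - y\<^sup>2 / 2))"
      if u: "u \<le> \<theta>" "0 < u" and y: "4 / 5 * \<theta> - pi / 2 \<le> y" "0 \<le> y" "y \<le> 1" for u y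
    proof -
      have y2: "y\<^sup>2 \<le> 1" using y power_mono[of y 1 2] by simp
      have nn: "0 \<le> y / (1 - y\<^sup>2 / 2)" using y y2 by (intro divide_nonneg_nonneg) auto
      have "- P \<le> 4 / 5 * (y / (1 - y\<^sup>2 / 2))"
      proof (cases "A \<le> pi / 2")
        case True
        have "0 \<le> cot A" unfolding cot_def using AC th True
          by (intro divide_nonneg_nonneg cos_ge_zero sin_ge_zero) auto
        then have "- P \<le> 0" using a by (simp add: P_def A_def)
        also have "0 \<le> 4 / 5 * (y / (1 - y\<^sup>2 / 2))" using nn by (intro mult_nonneg_nonneg) auto
        finally show ?thesis .
      next
        case False
        define v where "v = A - pi / 2"
        have "A \<le> 4 / 5 * \<theta>" unfolding A_def using a th by (intro mult_right_mono) auto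
        then have v: "0 < v" "v \<le> y" using False y by (auto simp: v_def)
        have c: "1 - v\<^sup>2 / 2 \<le> cos v" using cos_bound_lower[of v] v by simp
        have vy: "v\<^sup>2 \<le> y\<^sup>2" using v by (intro power_mono) auto
        have c': "1 - y\<^sup>2 / 2 \<le> cos v" using c vy by linarith
        have "- cot A = sin v / cos v" by (simp add: v_def cot_def sin_diff cos_diff)
        also have "\<dots> \<le> y / (1 - y\<^sup>2 / 2)"
          using v c' y2 sin_x_le_x[of v] by (intro frac_le) auto
        finally have "- cot A \<le> y / (1 - y\<^sup>2 / 2)" .
        then have "a * (- cot A) \<le> a * (y / (1 - y\<^sup>2 / 2))" using a by (intro mult_left_mono) auto
        also have "\<dots> \<le> 4 / 5 * (y / (1 - y\<^sup>2 / 2))" using a nn by (intro mult_right_mono) auto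
        finally show ?thesis by (simp add: P_def A_def)
      qed
      then show ?thesis using \<sigma>le[OF u] by (simp add: D_def)
    qed
    have "0 \<le> (R + \<sigma>) * (R - (1 + a) * D) + a * D * (\<sigma> - D) + 2 * a"
    proof -
      \<comment> \<open>Beyond the first interval, \<open>u\<close> is the left end,
        \<open>y\<close> bounds \<open>4/5 * \<theta> - \<pi>/2\<close> at the right end, and the
        argument of \<open>Rge\<close> bounds \<open>\<pi> - \<theta>\<close> at the left end. Up to
        2.5 the square is given up (\<open>g = 0\<close>); afterwards \<open>R\<close> exceeds
        \<open>D0\<close>, so \<open>m = 0\<close> and the square compensates the growth of
        \<open>D0\<close>.\<close>
      consider "\<theta> \<le> 2.2" | "2.2 \<le> \<theta>" "\<theta> \<le> 2.5" | "2.5 \<le> \<theta>" "\<theta> \<le> 2.7"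
        | "2.7 \<le> \<theta>" "\<theta> \<le> 2.9" | "2.9 \<le> \<theta>" by linarith
      then show ?thesis
      proof cases
        case 1
        \<comment> \<open>While \<open>4/5 * \<theta> \<le> \<pi>/2\<close> the term
          \<open>- P\<close> contributes nothing; otherwise \<open>\<theta>\<close> is at least
          1.96, which improves the bound for \<open>\<sigma>\<close>.\<close>
        have "D \<le> 0.67"
        proof (cases "4 / 5 * \<theta> \<le> pi / 2")
          case True
          have "D \<le> 1 / 1.57 + 4 / 5 * (0 / (1 - 0\<^sup>2 / 2))"
            by (rule Dle) (use True False pi_approx in auto)
          then show ?thesis by simp
        next
          case f: False
          have "D \<le> 1 / 1.96 + 4 / 5 * (0.19 / (1 - 0.19\<^sup>2 / 2))"
            by (rule Dle) (use f 1 pi_approx in auto)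
          then show ?thesis by (simp add: power2_eq_square)
        qed
        moreover have "\<sigma> \<le> 1 / 1.57" by (rule \<sigma>le) (use False pi_approx in auto)
        ultimately show ?thesis
          by (intro slope_inequality_0_obtuse[of a D "0.67" \<sigma> "1/1.57" "0.67" R 0])
            (use a D0 \<sigma>0 R0 in \<open>auto simp: power2_eq_square field_simps\<close>)
      next
        case 2
        have "D \<le> 1 / 2.2 + 4 / 5 * (0.43 / (1 - 0.43\<^sup>2 / 2))"
          by (rule Dle) (use 2 pi_approx in auto)
        then have "D \<le> 0.834" by (simp add: power2_eq_square)
        moreover have "\<sigma> \<le> 1 / 2.2" by (rule \<sigma>le) (use 2 pi_approx in auto)
        moreover have "(1 - 0.9416\<^sup>2 / 2) / 0.9416 \<le> R"
          by (rule Rge) (use 2 pi_approx in \<open>auto simp: power2_eq_square\<close>)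
        then have "0.59 \<le> R" by (simp add: power2_eq_square)
        ultimately show ?thesis
          by (intro slope_inequality_0_obtuse[of a D "0.834" \<sigma> "1/2.2" "0.244" R 0])
            (use a D0 \<sigma>0 R0 in \<open>auto simp: power2_eq_square field_simps\<close>)
      next
        case 3
        have "D \<le> 1 / 2.5 + 4 / 5 * (0.59 / (1 - 0.59\<^sup>2 / 2))"
          by (rule Dle) (use 3 pi_approx in auto)
        then have "D \<le> 0.9715" by (simp add: power2_eq_square)
        moreover have "\<sigma> \<le> 1 / 2.5" by (rule \<sigma>le) (use 3 pi_approx in auto)
        moreover have "(1 - 0.6416\<^sup>2 / 2) / 0.6416 \<le> R"
          by (rule Rge) (use 3 pi_approx in \<open>auto simp: power2_eq_square\<close>)
        then have "1.237 \<le> R" by (simp add: power2_eq_square)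
        ultimately show ?thesis
          by (intro slope_inequality_0_obtuse[of a D "0.9715" \<sigma> "1/2.5" 0 R "0.36"])
            (use a D0 \<sigma>0 R0 in \<open>auto simp: power2_eq_square field_simps\<close>)
      next
        case 4
        have "D \<le> 1 / 2.7 + 4 / 5 * (0.75 / (1 - 0.75\<^sup>2 / 2))"
          by (rule Dle) (use 4 pi_approx in auto)
        then have "D \<le> 1.206" by (simp add: power2_eq_square)
        moreover have "\<sigma> \<le> 1 / 2.7" by (rule \<sigma>le) (use 4 pi_approx in auto)
        moreover have "(1 - 0.4416\<^sup>2 / 2) / 0.4416 \<le> R"
          by (rule Rge) (use 4 pi_approx in \<open>auto simp: power2_eq_square\<close>)
        then have "2.04 \<le> R" by (simp add: power2_eq_square)
        ultimately show ?thesis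
          by (intro slope_inequality_0_obtuse[of a D "1.206" \<sigma> "1/2.7" 0 R "0.95"])
            (use a D0 \<sigma>0 R0 in \<open>auto simp: power2_eq_square field_simps\<close>)
      next
        case 5
        have "D \<le> 1 / 2.9 + 4 / 5 * (0.9426 / (1 - 0.9426\<^sup>2 / 2))"
          by (rule Dle) (use 5 th pi_approx in auto)
        then have "D \<le> 1.71" by (simp add: power2_eq_square)
        moreover have "\<sigma> \<le> 1 / 2.9" by (rule \<sigma>le) (use 5 pi_approx in auto)
        moreover have "(1 - 0.2416\<^sup>2 / 2) / 0.2416 \<le> R"
          by (rule Rge) (use 5 pi_approx in \<open>auto simp: power2_eq_square\<close>)
        then have "4 \<le> R" by (simp add: power2_eq_square)
        ultimately show ?thesis
          by (intro slope_inequality_0_obtuse[of a D "1.71" \<sigma> "1/2.9" 0 R "2.4"])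
            (use a D0 \<sigma>0 R0 in \<open>auto simp: power2_eq_square field_simps\<close>)
      qed
    qed
    then show ?thesis by (simp add: D_def R_def algebra_simps)
  qed
qed

lemma slope_inequality_0:
  fixes a \<theta> :: real
  defines "P \<equiv> a * cot (a * \<theta>)" and "\<sigma> \<equiv> (1 - a) * cot ((1 - a) * \<theta>)" and "r \<equiv> cot \<theta>"
  assumes a: "0 < a" "a \<le> 4 / 5" and th: "0 < \<theta>" "\<theta> < pi"
  shows "a * P * (P - \<sigma>) + (\<sigma> - r) * (r - (1 + a) * (P - \<sigma>)) \<le> 2 * a"
  using slope_inequality_0_le_half[of a \<theta>] slope_inequality_0_ge_half[of a \<theta>] a th
  unfolding P_def \<sigma>_def r_def by linarith

section \<open>Tangents of parametrised curves and derivatives of cotangents\<close>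

text \<open>The slope \<open>D\<close> of the curve \<open>(t, n)\<close> decreases in the
  parameter, and so does \<open>t\<close>; hence \<open>D\<close> increases with \<open>t\<close>
  and the curve lies above its tangents. In the proof, \<open>n\<close> minus the slope at
  \<open>x\<close> times \<open>t\<close> has its minimum at \<open>x\<close>.\<close>

lemma supporting_line:
  fixes n t t' D :: "real \<Rightarrow> real"
  assumes n: "\<And>\<theta>. \<theta> \<in> {l<..<u} \<Longrightarrow> (n has_real_derivative D \<theta> * t' \<theta>) (at \<theta>)"
    and t: "\<And>\<theta>. \<theta> \<in> {l<..<u} \<Longrightarrow> (t has_real_derivative t' \<theta>) (at \<theta>)"
    and t': "\<And>\<theta>. \<theta> \<in> {l<..<u} \<Longrightarrow> t' \<theta> \<le> 0"
    and D: "\<And>\<theta> \<theta>'. \<theta> \<in> {l<..<u} \<Longrightarrow> \<theta>' \<in> {l<..<u} \<Longrightarrow> \<theta> \<le> \<theta>' \<Longrightarrow> D \<theta>' \<le> D \<theta>"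
    and x: "x \<in> {l<..<u}" and y: "y \<in> {l<..<u}"
  shows "n x + D x * (t y - t x) \<le> n y"
proof -
  define g where "g z = n z - D x * t z" for z
  have g: "(g has_real_derivative (D z - D x) * t' z) (at z)" if "z \<in> {l<..<u}" for z
    unfolding g_def by (rule DERIV_cong[OF DERIV_diff[OF n[OF that] DERIV_cmult[OF t[OF that]]]])
      (simp add: algebra_simps)
  have "g x \<le> g y"
  proof (cases "x \<le> y")
    case True
    show ?thesis
    proof (rule DERIV_nonneg_imp_nondecreasing[OF True])
      fix z assume z: "x \<le> z" "z \<le> y"
      then have zi: "z \<in> {l<..<u}" using x y by auto
      have "0 \<le> (D z - D x) * t' z"
        using D[OF x zi z(1)] t'[OF zi] by (intro mult_nonpos_nonpos) auto
      then show "\<exists>d. (g has_real_derivative d) (at z) \<and> 0 \<le> d" using g[OF zi] by blast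
    qed
  next
    case False
    show ?thesis
    proof (rule DERIV_nonpos_imp_nonincreasing[of y x])
      show "y \<le> x" using False by simp
      fix z assume z: "y \<le> z" "z \<le> x"
      then have zi: "z \<in> {l<..<u}" using x y by auto
      have "(D z - D x) * t' z \<le> 0"
        using D[OF zi x z(2)] t'[OF zi] by (intro mult_nonneg_nonpos) auto
      then show "\<exists>d. (g has_real_derivative d) (at z) \<and> d \<le> 0" using g[OF zi] by blast
    qed
  qed
  then show ?thesis by (simp add: g_def algebra_simps)
qed

lemma DERIV_antimono_on_interval:
  fixes f f' :: "real \<Rightarrow> real"
  assumes "\<And>x. x \<in> {l<..<u} \<Longrightarrow> (f has_real_derivative f' x) (at x)"
    and "\<And>x. x \<in> {l<..<u} \<Longrightarrow> f' x \<le> 0"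
    and "x \<in> {l<..<u}" "y \<in> {l<..<u}" "x \<le> y"
  shows "f y \<le> f x"
proof (rule DERIV_nonpos_imp_nonincreasing[OF assms(5)])
  fix z assume "x \<le> z" "z \<le> y"
  then have "z \<in> {l<..<u}" using assms(3,4) by auto
  then show "\<exists>d. (f has_real_derivative d) (at z) \<and> d \<le> 0" using assms(1,2) by blast
qed

text \<open>Writing \<open>1 + cot^2\<close> instead of \<open>1 / sin^2\<close> makes all later
  derivatives polynomial in cotangents, so that sign conditions become polynomial
  identities.\<close>

lemma DERIV_cot_mult:
  fixes a \<theta> :: real
  assumes "sin (a * \<theta>) \<noteq> 0"
  shows "((\<lambda>\<theta>. cot (a * \<theta>)) has_real_derivative - a * (1 + (cot (a * \<theta>))\<^sup>2)) (at \<theta>)"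
proof -
  have "((\<lambda>\<theta>. cot (a * \<theta>)) has_real_derivative - inverse ((sin (a * \<theta>))\<^sup>2) * a) (at \<theta>)"
    by (rule DERIV_chain2[OF DERIV_cot[OF assms] DERIV_cmult_Id])
  moreover have "- inverse ((sin (a * \<theta>))\<^sup>2) * a = - a * (1 + (cot (a * \<theta>))\<^sup>2)"
    using assms sin_cos_squared_add[of "a * \<theta>"] by (simp add: cot_def field_simps)
  ultimately show ?thesis by (rule DERIV_cong)
qed

lemma DERIV_ln_sin_mult:
  fixes a \<theta> :: real
  assumes "0 < sin (a * \<theta>)"
  shows "((\<lambda>\<theta>. ln (sin (a * \<theta>))) has_real_derivative a * cot (a * \<theta>)) (at \<theta>)"
  using assms by (auto intro!: derivative_eq_intros simp: cot_def)

lemma sin_mult_pos: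
  fixes a \<theta> :: real
  assumes "0 < a" "a \<le> 1" "0 < \<theta>" "\<theta> < pi"
  shows "0 < sin (a * \<theta>)"
proof (rule sin_gt_zero)
  have "a * \<theta> \<le> 1 * \<theta>" using assms by (intro mult_right_mono) auto
  then show "a * \<theta> < pi" using assms by linarith
qed (use assms in auto)

subsection \<open>Kanter's curve\<close>

text \<open>Kanter's curve consists of the \<open>r e\<^sup>i\<^sup>\<theta>\<close> on which the exponent of the contour integral is real.
  In the coordinates \<open>(x, y)\<close> with \<open>x / y = kanter_t\<close> the exponent is
  \<open>- (y kanter_n)\<^bsup>1/(1-a)\<^esup>\<close>, and its concavity is the convexity of \<open>kanter_n\<close> as a function of
  \<open>kanter_t\<close>. The first argument is \<open>\<beta>\<close>, which is \<open>0\<close> or \<open>a\<close>.\<close>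

definition kanter_t :: "real \<Rightarrow> real \<Rightarrow> real \<Rightarrow> real" where
  "kanter_t \<beta> a \<theta> = (if \<beta> = 0 then sin \<theta> powr a / sin (a * \<theta>)
     else sin \<theta> / (sin (a * \<theta>) * sin ((1 - a) * \<theta>)))"

definition kanter_n :: "real \<Rightarrow> real \<Rightarrow> real \<Rightarrow> real" where
  "kanter_n \<beta> a \<theta> = kanter_t \<beta> a \<theta> * (sin (a * \<theta>) powr a * sin ((1 - a) * \<theta>) powr (1 - a) / sin \<theta>)"

text \<open>By the addition theorem \<open>kanter_t\<close> is the sum \<open>t = p + s\<close> of
  two cotangents, and \<open>n\<close> has logarithmic derivative \<open>- a * (1 - a) * t\<close>.
  With \<open>W = - t'\<close> the slope is \<open>D = a * (1 - a) * t * n / W\<close>. The sign of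
  its derivative is a polynomial condition in \<open>p\<close> and \<open>s\<close>; in the
  coordinates \<open>t\<close> and \<open>d\<close> it is \<open>slope_inequality\<close>.\<close>

lemma kanter_convex_a:
  fixes a :: real
  assumes a: "0 < a" "a < 1"
  obtains D t' where
    "\<And>\<theta>. \<theta> \<in> {0<..<pi} \<Longrightarrow> (kanter_t a a has_real_derivative t' \<theta>) (at \<theta>)"
    "\<And>\<theta>. \<theta> \<in> {0<..<pi} \<Longrightarrow> t' \<theta> < 0"
    "\<And>\<theta> \<eta>. \<theta> \<in> {0<..<pi} \<Longrightarrow> \<eta> \<in> {0<..<pi} \<Longrightarrow>
       kanter_n a a \<theta> + D \<theta> * (kanter_t a a \<eta> - kanter_t a a \<theta>) \<le> kanter_n a a \<eta>"
proof -
  define p where "p \<theta> = cot (a * \<theta>)" for \<theta>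
  define s where "s \<theta> = cot ((1 - a) * \<theta>)" for \<theta>
  define t where "t \<theta> = p \<theta> + s \<theta>" for \<theta>
  define W where "W \<theta> = 1 + a * (p \<theta>)\<^sup>2 + (1 - a) * (s \<theta>)\<^sup>2" for \<theta>
  define n where "n \<theta> = exp (- (1 - a) * ln (sin (a * \<theta>)) + - a * ln (sin ((1 - a) * \<theta>)))" for \<theta>
  define D where "D \<theta> = a * (1 - a) * t \<theta> * n \<theta> / W \<theta>" for \<theta>
  have pos: "0 < sin (a * \<theta>)" "0 < sin ((1 - a) * \<theta>)" "0 < sin \<theta>" if "\<theta> \<in> {0<..<pi}" for \<theta>
    using sin_mult_pos[of a \<theta>] sin_mult_pos[of "1 - a" \<theta>] sin_gt_zero[of \<theta>] a that by auto
  have W: "1 \<le> W \<theta>" for \<theta> using a by (simp add: W_def)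
  have tt: "kanter_t a a \<theta> = t \<theta>" if "\<theta> \<in> {0<..<pi}" for \<theta>
  proof -
    have "sin \<theta> = sin (a * \<theta> + (1 - a) * \<theta>)" by (simp add: algebra_simps)
    then show ?thesis using pos[OF that] a
      unfolding kanter_t_def t_def p_def s_def cot_def sin_add by (simp add: field_simps)
  qed
  have nn: "kanter_n a a \<theta> = n \<theta>" if "\<theta> \<in> {0<..<pi}" for \<theta>
  proof -
    have x: "x powr a / x = exp (- (1 - a) * ln x)" if "0 < x" for x :: real
    proof -
      have "x powr a / x = x powr (a - 1)" using that by (simp add: powr_diff)
      then show ?thesis using that by (simp add: powr_def algebra_simps)
    qed
    have y: "x powr (1 - a) / x = exp (- a * ln x)" if "0 < x" for x :: real
    proof -
      have "x powr (1 - a) / x = x powr (1 - a - 1)" using that by (simp only: powr_diff powr_one)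
      then show ?thesis using that by (simp add: powr_def)
    qed
    have "kanter_n a a \<theta> = (sin (a * \<theta>) powr a / sin (a * \<theta>)) * (sin ((1 - a) * \<theta>) powr (1 - a) / sin ((1 - a) * \<theta>))"
      using pos[OF that] a by (simp add: kanter_n_def kanter_t_def)
    also have "\<dots> = n \<theta>"
      unfolding n_def exp_add x[OF pos(1)[OF that]] y[OF pos(2)[OF that]] ..
    finally show ?thesis .
  qed
  have dp: "(p has_real_derivative - a * (1 + (p \<theta>)\<^sup>2)) (at \<theta>)" if "\<theta> \<in> {0<..<pi}" for \<theta>
    unfolding p_def[abs_def] by (rule DERIV_cot_mult) (use pos[OF that] in simp)
  have ds: "(s has_real_derivative - (1 - a) * (1 + (s \<theta>)\<^sup>2)) (at \<theta>)" if "\<theta> \<in> {0<..<pi}" for \<theta>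
    unfolding s_def[abs_def] by (rule DERIV_cot_mult) (use pos[OF that] in simp)
  have dt: "(t has_real_derivative - W \<theta>) (at \<theta>)" if "\<theta> \<in> {0<..<pi}" for \<theta>
    unfolding t_def[abs_def]
    by (rule DERIV_cong[OF DERIV_add[OF dp[OF that] ds[OF that]]]) (simp add: W_def algebra_simps)
  have dn: "(n has_real_derivative - a * (1 - a) * t \<theta> * n \<theta>) (at \<theta>)" if "\<theta> \<in> {0<..<pi}" for \<theta>
    unfolding n_def[abs_def]
    by (rule DERIV_cong[OF DERIV_fun_exp[OF DERIV_add[OF DERIV_cmult[OF DERIV_ln_sin_mult] DERIV_cmult[OF DERIV_ln_sin_mult]]]])
      (use pos[OF that] in \<open>auto simp: t_def p_def s_def algebra_simps\<close>)
  have dW: "(W has_real_derivative - 2 * (a\<^sup>2 * p \<theta> * (1 + (p \<theta>)\<^sup>2) + (1 - a)\<^sup>2 * s \<theta> * (1 + (s \<theta>)\<^sup>2))) (at \<theta>)"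
    if "\<theta> \<in> {0<..<pi}" for \<theta>
    unfolding W_def[abs_def]
    by (rule DERIV_cong[OF DERIV_add[OF DERIV_add[OF DERIV_const DERIV_cmult[OF DERIV_power[OF dp[OF that]]]]
        DERIV_cmult[OF DERIV_power[OF ds[OF that]]]]])
      (simp add: power2_eq_square algebra_simps)
  define V where "V \<theta> = a\<^sup>2 * p \<theta> * (1 + (p \<theta>)\<^sup>2) + (1 - a)\<^sup>2 * s \<theta> * (1 + (s \<theta>)\<^sup>2)" for \<theta>
  define D' where "D' \<theta> = a * (1 - a) * n \<theta> * (2 * V \<theta> * t \<theta> - W \<theta> * (a * (1 - a) * (t \<theta>)\<^sup>2 + W \<theta>)) / (W \<theta> * W \<theta>)" for \<theta>
  have dD: "(D has_real_derivative D' \<theta>) (at \<theta>)" if "\<theta> \<in> {0<..<pi}" for \<theta>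
    unfolding D_def[abs_def]
    by (rule DERIV_cong[OF DERIV_divide[OF DERIV_mult[OF DERIV_cmult[OF dt[OF that]] dn[OF that]] dW[OF that]]])
      (use W[of \<theta>] in \<open>auto simp: D'_def V_def power2_eq_square algebra_simps\<close>)
  have D'0: "D' \<theta> \<le> 0" if "\<theta> \<in> {0<..<pi}" for \<theta>
  proof -
    define d where "d = a * p \<theta> - (1 - a) * s \<theta>"
    have K: "0 \<le> (1 + d\<^sup>2)\<^sup>2 + a * (1 - a) * (t \<theta>)\<^sup>2 * (1 - 3 * d\<^sup>2) - 2 * (2 * a - 1) * t \<theta> * d * (1 + d\<^sup>2)"
      using slope_inequality(2)[of a \<theta>] a that by (simp add: d_def t_def p_def s_def)
    have p: "p \<theta> = (1 - a) * t \<theta> + d" and s: "s \<theta> = a * t \<theta> - d"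
      by (simp_all add: d_def t_def algebra_simps)
    have "W \<theta> * (a * (1 - a) * (t \<theta>)\<^sup>2 + W \<theta>) - 2 * V \<theta> * t \<theta>
      = (1 + d\<^sup>2)\<^sup>2 + a * (1 - a) * (t \<theta>)\<^sup>2 * (1 - 3 * d\<^sup>2) - 2 * (2 * a - 1) * t \<theta> * d * (1 + d\<^sup>2)"
      unfolding W_def V_def p s by algebra
    then have "2 * V \<theta> * t \<theta> - W \<theta> * (a * (1 - a) * (t \<theta>)\<^sup>2 + W \<theta>) \<le> 0" using K by linarith
    then show ?thesis using a W[of \<theta>] unfolding D'_def
      by (intro divide_nonpos_pos mult_nonneg_nonpos mult_pos_pos) (auto simp: n_def)
  qed
  show ?thesis
  proof (rule that[of "\<lambda>\<theta>. - W \<theta>" D])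
    fix \<theta> assume th: "\<theta> \<in> {0<..<pi}"
    show "(kanter_t a a has_real_derivative - W \<theta>) (at \<theta>)"
      by (rule has_field_derivative_transform_within_open[OF dt[OF th], of "{0<..<pi}"]) (use th tt in auto)
    show "- W \<theta> < 0" using W[of \<theta>] by simp
  next
    fix \<theta> \<eta> assume th: "\<theta> \<in> {0<..<pi}" "\<eta> \<in> {0<..<pi}"
    have "n \<theta> + D \<theta> * (t \<eta> - t \<theta>) \<le> n \<eta>"
    proof (rule supporting_line[of 0 pi n D "\<lambda>\<theta>. - W \<theta>" t])
      fix x assume x: "x \<in> {0<..<pi}"
      show "(n has_real_derivative D x * - W x) (at x)"
        using dn[OF x] W[of x] by (simp add: D_def)
      show "- W x \<le> 0" using W[of x] by simp
    qed (use dt th DERIV_antimono_on_interval[of 0 pi D D'] dD D'0 in auto)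
    then show "kanter_n a a \<theta> + D \<theta> * (kanter_t a a \<eta> - kanter_t a a \<theta>) \<le> kanter_n a a \<eta>"
      using tt nn th by simp
  qed
qed

text \<open>Everything is governed by \<open>e = cot (a\<theta>) - cot \<theta>\<close>:
  \<open>kanter_n\<close> is \<open>e powr (1 - a)\<close> and the logarithmic derivative of
  \<open>kanter_t\<close> is \<open>- a * e\<close>. The sign of the derivative of the slope is that
  of \<open>e^2 * G\<close>, where \<open>G \<le> 0\<close> is
  \<open>slope_inequality_0\<close>.\<close>

lemma kanter_convex_0:
  fixes a :: real
  assumes a: "0 < a" "a \<le> 4 / 5"
  obtains D where
    "\<And>\<theta> \<eta>. \<theta> \<in> {0<..<pi} \<Longrightarrow> \<eta> \<in> {0<..<pi} \<Longrightarrow>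
       kanter_n 0 a \<theta> + D \<theta> * (kanter_t 0 a \<eta> - kanter_t 0 a \<theta>) \<le> kanter_n 0 a \<eta>"
proof -
  define p where "p \<theta> = cot (a * \<theta>)" for \<theta>
  define r where "r \<theta> = cot (1 * \<theta>)" for \<theta> :: real
  define e where "e \<theta> = p \<theta> - r \<theta>" for \<theta>
  define e' where "e' \<theta> = - a * (1 + (p \<theta>)\<^sup>2) + (1 + (r \<theta>)\<^sup>2)" for \<theta>
  define t where "t \<theta> = exp (a * ln (sin (1 * \<theta>)) - ln (sin (a * \<theta>)))" for \<theta>
  define c where "c = 1 - a"
  define D where "D \<theta> = - (c / a) * (e \<theta> powr (c - 2) * e' \<theta> / t \<theta>)" for \<theta>
  have c: "0 < c" "c < 1" using a by (auto simp: c_def)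
  have pos: "0 < sin (a * \<theta>)" "0 < sin (c * \<theta>)" "0 < sin \<theta>" if "\<theta> \<in> {0<..<pi}" for \<theta>
    using sin_mult_pos[of a \<theta>] sin_mult_pos[of c \<theta>] sin_gt_zero[of \<theta>] a c that by auto
  have ee: "e \<theta> = sin (c * \<theta>) / (sin (a * \<theta>) * sin \<theta>)" if "\<theta> \<in> {0<..<pi}" for \<theta>
  proof -
    have "sin (c * \<theta>) = sin (\<theta> - a * \<theta>)" by (simp add: c_def algebra_simps)
    then show ?thesis using pos[OF that]
      unfolding e_def p_def r_def cot_def sin_diff by (simp add: field_simps)
  qed
  have e0: "0 < e \<theta>" if "\<theta> \<in> {0<..<pi}" for \<theta> using pos[OF that] by (simp add: ee[OF that])
  have tt: "kanter_t 0 a \<theta> = t \<theta>" if "\<theta> \<in> {0<..<pi}" for \<theta>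
    using pos[OF that] a by (simp add: kanter_t_def t_def exp_diff powr_def)
  have nn: "kanter_n 0 a \<theta> = e \<theta> powr c" if "\<theta> \<in> {0<..<pi}" for \<theta>
    using pos[OF that] a c
    by (simp add: kanter_n_def kanter_t_def ee[OF that] powr_divide powr_mult c_def powr_diff field_simps)
  have dp: "(p has_real_derivative - a * (1 + (p \<theta>)\<^sup>2)) (at \<theta>)" if "\<theta> \<in> {0<..<pi}" for \<theta>
    unfolding p_def[abs_def] by (rule DERIV_cot_mult) (use pos[OF that] in simp)
  have dr: "(r has_real_derivative - 1 * (1 + (r \<theta>)\<^sup>2)) (at \<theta>)" if "\<theta> \<in> {0<..<pi}" for \<theta>
    unfolding r_def[abs_def] by (rule DERIV_cot_mult) (use pos[OF that] in simp)
  have de: "(e has_real_derivative e' \<theta>) (at \<theta>)" if "\<theta> \<in> {0<..<pi}" for \<theta>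
    unfolding e_def[abs_def]
    by (rule DERIV_cong[OF DERIV_diff[OF dp[OF that] dr[OF that]]]) (simp add: e'_def)
  define e'' where "e'' \<theta> = 2 * a\<^sup>2 * p \<theta> * (1 + (p \<theta>)\<^sup>2) - 2 * r \<theta> * (1 + (r \<theta>)\<^sup>2)" for \<theta>
  have de': "(e' has_real_derivative e'' \<theta>) (at \<theta>)" if "\<theta> \<in> {0<..<pi}" for \<theta>
    unfolding e'_def[abs_def]
    by (rule DERIV_cong[OF DERIV_add[OF DERIV_cmult[OF DERIV_add[OF DERIV_const DERIV_power[OF dp[OF that]]]]
        DERIV_add[OF DERIV_const DERIV_power[OF dr[OF that]]]]])
      (simp add: e''_def power2_eq_square algebra_simps)
  have dt: "(t has_real_derivative - (a * e \<theta> * t \<theta>)) (at \<theta>)" if "\<theta> \<in> {0<..<pi}" for \<theta>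
    unfolding t_def[abs_def]
    by (rule DERIV_cong[OF DERIV_fun_exp[OF DERIV_diff[OF DERIV_cmult[OF DERIV_ln_sin_mult] DERIV_ln_sin_mult]]])
      (use pos[OF that] in \<open>auto simp: e_def p_def r_def algebra_simps\<close>)
  have t0: "0 < t \<theta>" for \<theta> by (simp add: t_def)
  have dpow: "((\<lambda>\<theta>. e \<theta> powr k) has_real_derivative k * e \<theta> powr (k - 1) * e' \<theta>) (at \<theta>)"
    if "\<theta> \<in> {0<..<pi}" for \<theta> k
    by (rule DERIV_chain2[OF has_real_derivative_powr de]) (use e0 that in auto)
  have dn: "((\<lambda>\<theta>. e \<theta> powr c) has_real_derivative D \<theta> * - (a * e \<theta> * t \<theta>)) (at \<theta>)" if "\<theta> \<in> {0<..<pi}" for \<theta>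
  proof (rule DERIV_cong[OF dpow[OF that]])
    have "e \<theta> powr (c - 1) = e \<theta> powr (c - 2) * e \<theta>"
      using e0[OF that] powr_add[of "e \<theta>" "c - 2" 1] by simp
    then show "c * e \<theta> powr (c - 1) * e' \<theta> = D \<theta> * - (a * e \<theta> * t \<theta>)"
      using a t0[of \<theta>] by (simp add: D_def)
  qed
  define D' where "D' \<theta> = - (c / a) * (e \<theta> powr (c - 2) / (e \<theta> * t \<theta>)
      * ((c - 2) * (e' \<theta>)\<^sup>2 + e \<theta> * e'' \<theta> + a * (e \<theta>)\<^sup>2 * e' \<theta>))" for \<theta>
  have dD: "(D has_real_derivative D' \<theta>) (at \<theta>)" if "\<theta> \<in> {0<..<pi}" for \<theta>
    unfolding D_def[abs_def]
  proof (rule DERIV_cong[OF DERIV_cmult[OF DERIV_divide[OF DERIV_mult[OF dpow[OF that] de'[OF that]] dt[OF that]]]])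
    have e1: "e \<theta> powr (c - 2 - 1) = e \<theta> powr (c - 2) / e \<theta>"
      using e0[OF that] by (simp only: powr_diff powr_one)
    show "- (c / a) * ((((c - 2) * e \<theta> powr (c - 2 - 1) * e' \<theta> * e' \<theta> + e'' \<theta> * e \<theta> powr (c - 2)) * t \<theta>
       - e \<theta> powr (c - 2) * e' \<theta> * - (a * e \<theta> * t \<theta>)) / (t \<theta> * t \<theta>)) = D' \<theta>"
      unfolding e1 D'_def using e0[OF that] t0[of \<theta>] a by (simp add: field_simps power2_eq_square)
  qed (use t0[of \<theta>] in simp)
  have D'0: "D' \<theta> \<le> 0" if "\<theta> \<in> {0<..<pi}" for \<theta>
  proof -
    define P where "P = a * p \<theta>"
    define s where "s = cot ((1 - a) * \<theta>)"
    define \<sigma> where "\<sigma> = c * s"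
    define G where "G = a * P * (P - \<sigma>) + (\<sigma> - r \<theta>) * (r \<theta> - (1 + a) * (P - \<sigma>)) - 2 * a"
    have G: "G \<le> 0" using slope_inequality_0[of a \<theta>] a that
      by (simp add: G_def P_def \<sigma>_def s_def c_def p_def r_def)
    \<comment> \<open>Addition theorem for \<open>cot (\<theta> - a * \<theta>)\<close>. It
      eliminates \<open>s\<close>, after which the identity with \<open>G\<close> is purely
      algebraic.\<close>
    have "s * (p \<theta> - r \<theta>) = p \<theta> * r \<theta> + 1"
    proof -
      have "cos (c * \<theta>) = cos (\<theta> - a * \<theta>)" by (simp add: c_def algebra_simps)
      then have cc: "cos (c * \<theta>) = cos \<theta> * cos (a * \<theta>) + sin \<theta> * sin (a * \<theta>)"
        by (simp add: cos_diff)
      have "s * e \<theta> = cos (c * \<theta>) / (sin (a * \<theta>) * sin \<theta>)"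
        using pos[OF that] by (simp add: ee[OF that] s_def c_def cot_def)
      also have "\<dots> = p \<theta> * r \<theta> + 1"
        using pos[OF that] unfolding cc by (simp add: p_def r_def cot_def field_simps)
      finally show ?thesis by (simp add: e_def)
    qed
    then have rel: "\<sigma> * e \<theta> = c * (p \<theta> * r \<theta> + 1)" by (simp add: \<sigma>_def e_def)
    have "(c - 2) * (e' \<theta>)\<^sup>2 + e \<theta> * e'' \<theta> + a * (e \<theta>)\<^sup>2 * e' \<theta> = - ((e \<theta>)\<^sup>2 * G)"
      using rel unfolding G_def P_def e'_def e''_def e_def c_def by algebra
    also have "0 \<le> \<dots>" using G by (simp add: mult_nonneg_nonpos)
    finally have "0 \<le> (c - 2) * (e' \<theta>)\<^sup>2 + e \<theta> * e'' \<theta> + a * (e \<theta>)\<^sup>2 * e' \<theta>" .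
    then have "0 \<le> (c / a) * (e \<theta> powr (c - 2) / (e \<theta> * t \<theta>)
      * ((c - 2) * (e' \<theta>)\<^sup>2 + e \<theta> * e'' \<theta> + a * (e \<theta>)\<^sup>2 * e' \<theta>))"
      using a c e0[OF that] t0[of \<theta>] by (intro mult_nonneg_nonneg divide_nonneg_nonneg) auto
    then show ?thesis by (simp add: D'_def)
  qed
  show ?thesis
  proof (rule that[of D])
    fix \<theta> \<eta> assume th: "\<theta> \<in> {0<..<pi}" "\<eta> \<in> {0<..<pi}"
    have "e \<theta> powr c + D \<theta> * (t \<eta> - t \<theta>) \<le> e \<eta> powr c"
    proof (rule supporting_line[of 0 pi "\<lambda>\<theta>. e \<theta> powr c" D "\<lambda>\<theta>. - (a * e \<theta> * t \<theta>)" t])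
      fix x assume x: "x \<in> {0<..<pi}"
      show "- (a * e x * t x) \<le> 0" using a e0[OF x] t0[of x] by simp
    qed (use dt dn th DERIV_antimono_on_interval[of 0 pi D D'] dD D'0 in auto)
    then show "kanter_n 0 a \<theta> + D \<theta> * (kanter_t 0 a \<eta> - kanter_t 0 a \<theta>) \<le> kanter_n 0 a \<eta>"
      using tt nn th by simp
  qed
qed

text \<open>Separate from the convexity at index 0 because it is needed for all
  \<open>a < 1\<close>: positivity at index 0 makes the numerator of the hazard rate at
  \<open>\<beta> = a\<close> positive.\<close>

lemma DERIV_kanter_t_0:
  fixes a \<theta> :: real
  assumes a: "0 < a" "a < 1" and th: "0 < \<theta>" "\<theta> < pi"
  obtains t' where "(kanter_t 0 a has_real_derivative t') (at \<theta>)" "t' < 0"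
proof -
  have pos: "0 < sin (a * x)" "0 < sin x" "0 < sin ((1 - a) * x)" if "x \<in> {0<..<pi}" for x
    using sin_mult_pos[of a x] sin_mult_pos[of "1 - a" x] sin_gt_zero[of x] a that by auto
  have th': "\<theta> \<in> {0<..<pi}" using th by simp
  define t where "t \<theta> = exp (a * ln (sin (1 * \<theta>)) - ln (sin (a * \<theta>)))" for \<theta>
  have dt: "(t has_real_derivative t \<theta> * (a * (1 * cot (1 * \<theta>)) - a * cot (a * \<theta>))) (at \<theta>)"
    unfolding t_def[abs_def]
    by (rule DERIV_fun_exp[OF DERIV_diff[OF DERIV_cmult[OF DERIV_ln_sin_mult] DERIV_ln_sin_mult]])
      (use pos[OF th'] in auto)
  have *: "(kanter_t 0 a has_real_derivative t \<theta> * (a * (1 * cot (1 * \<theta>)) - a * cot (a * \<theta>))) (at \<theta>)"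
  proof (rule has_field_derivative_transform_within_open[OF dt, of "{0<..<pi}"])
    fix x :: real assume "x \<in> {0<..<pi}"
    then show "t x = kanter_t 0 a x"
      using pos[of x] a by (simp add: kanter_t_def t_def exp_diff powr_def)
  qed (use th in auto)
  have "cot (a * \<theta>) - cot \<theta> = sin ((1 - a) * \<theta>) / (sin (a * \<theta>) * sin \<theta>)"
  proof -
    have "sin ((1 - a) * \<theta>) = sin (\<theta> - a * \<theta>)" by (simp add: algebra_simps)
    then show ?thesis using pos[OF th'] unfolding cot_def sin_diff by (simp add: field_simps)
  qed
  also have "\<dots> > 0" using pos[OF th'] by simp
  finally have "a * (cot \<theta> - cot (a * \<theta>)) < 0" using a by (simp add: mult_pos_neg)
  then have "a * (1 * cot (1 * \<theta>)) - a * cot (a * \<theta>) < 0" by (simp add: algebra_simps)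
  then have "t \<theta> * (a * (1 * cot (1 * \<theta>)) - a * cot (a * \<theta>)) < 0"
    by (intro mult_pos_neg) (simp add: t_def)
  then show ?thesis using that * by blast
qed

subsection \<open>Contour integrals for the reciprocal Gamma function\<close>

text \<open>The slit plane is star-shaped about 1. With a primitive, an integral along a path is a
  difference of end values, so replacing one contour by another never requires a homotopy.\<close>

lemma slit_plane_primitive:
  assumes "f holomorphic_on (- \<real>\<^sub>\<le>\<^sub>0)"
  shows "\<exists>P. \<forall>z. z \<notin> \<real>\<^sub>\<le>\<^sub>0 \<longrightarrow> (P has_field_derivative f z) (at z)"
proof -
  have op: "open (- \<real>\<^sub>\<le>\<^sub>0 :: complex set)" using closed_nonpos_Reals_complex by (simp add: open_Compl)
  have "starlike (- \<real>\<^sub>\<le>\<^sub>0 :: complex set)"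
    unfolding starlike_def
  proof (intro bexI[of _ 1] ballI subsetI)
    fix z w :: complex assume z: "z \<in> - \<real>\<^sub>\<le>\<^sub>0" and w: "w \<in> closed_segment 1 z"
    then obtain u where u: "0 \<le> u" "u \<le> 1" "w = (1 - u) *\<^sub>R 1 + u *\<^sub>R z" by (auto simp: in_segment)
    show "w \<in> - \<real>\<^sub>\<le>\<^sub>0"
    proof (cases "u = 0")
      case False
      show ?thesis
      proof (cases "Im z = 0")
        case True
        then have "0 < Re z" using z by (auto simp: complex_nonpos_Reals_iff)
        then have "0 < Re w" using u False by (auto simp: intro!: add_nonneg_pos)
        then show ?thesis by (auto simp: complex_nonpos_Reals_iff)
      next
        case f: False
        then have "Im w \<noteq> 0" using u False by simp
        then show ?thesis by (auto simp: complex_nonpos_Reals_iff)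
      qed
    qed (use u in auto)
  qed auto
  then have "\<exists>g. \<forall>x\<in>- \<real>\<^sub>\<le>\<^sub>0. (g has_field_derivative f x) (at x)"
    by (rule holomorphic_starlike_primitive[OF holomorphic_on_imp_continuous_on[OF assms] _ op, of "{}"])
      (use assms op in \<open>auto simp: holomorphic_on_open field_differentiable_def\<close>)
  then show ?thesis by auto
qed

text \<open>Takes the place of estimates on connecting arcs: the ends of two contours are joined by
  a segment on which the integrand is small.\<close>

lemma primitive_diff_le:
  fixes P f :: "complex \<Rightarrow> complex"
  assumes P: "\<And>z. z \<notin> \<real>\<^sub>\<le>\<^sub>0 \<Longrightarrow> (P has_field_derivative f z) (at z)"
    and "\<And>\<zeta>. \<zeta> \<in> closed_segment z w \<Longrightarrow> \<zeta> \<notin> \<real>\<^sub>\<le>\<^sub>0 \<and> norm (f \<zeta>) \<le> B"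
  shows "norm (P z - P w) \<le> B * norm (z - w)"
  by (rule field_differentiable_bound[of "closed_segment z w"])
    (use assms in \<open>auto intro: has_field_derivative_at_within\<close>)

text \<open>All integrands are real on the positive axis, so for imaginary parts it makes no
  difference where on this axis a contour starts.\<close>

lemma Im_primitive_const:
  fixes P f :: "complex \<Rightarrow> complex"
  assumes P: "\<And>z. z \<notin> \<real>\<^sub>\<le>\<^sub>0 \<Longrightarrow> (P has_field_derivative f z) (at z)"
    and f: "\<And>t. 0 < t \<Longrightarrow> Im (f (of_real t)) = 0" and t: "0 < t"
  shows "Im (P (of_real t)) = Im (P 1)"
proof -
  have d: "((\<lambda>t. Im (P (of_real t))) has_real_derivative 0) (at s)" if s: "0 < s" for s
  proof -
    have "complex_of_real s \<notin> \<real>\<^sub>\<le>\<^sub>0" using s by (auto simp: complex_nonpos_Reals_iff)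
    then have "(P \<circ> of_real has_vector_derivative 1 * f (of_real s)) (at s)"
      by (intro field_vector_diff_chain_at has_vector_derivative_of_real P)
        (auto intro!: derivative_eq_intros)
    then have "((\<lambda>t. P (of_real t)) has_vector_derivative f (of_real s)) (at s)" by (simp add: o_def)
    then have "((\<lambda>t. Im (P (of_real t))) has_vector_derivative Im (f (of_real s))) (at s)"
      by (rule bounded_linear.has_vector_derivative[OF bounded_linear_Im])
    then show ?thesis using f[OF s] by (simp add: has_real_derivative_iff_has_vector_derivative)
  qed
  have "\<exists>c. \<forall>x\<in>{0<..}. Im (P (of_real x)) = c"
    by (rule has_field_derivative_zero_constant) (auto intro: d has_field_derivative_at_within)
  then obtain c where c: "\<And>x. x \<in> {0<..} \<Longrightarrow> Im (P (complex_of_real x)) = c" by auto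
  show ?thesis using c[of t] c[of 1] t by simp
qed

text \<open>The integrand may be singular at 0, where the primitive along the path need not have a
  value; hence the exhaustion by compact intervals that approach both ends.\<close>

lemma half_line_FTC_sequentially:
  fixes g G :: "real \<Rightarrow> complex"
  assumes G: "\<And>t. 0 < t \<Longrightarrow> (G has_vector_derivative g t) (at t)"
    and cont: "continuous_on {0<..} g" and int: "set_integrable lborel {0<..} g"
  shows "(\<lambda>n. G (real (Suc n)) - G (1 / real (Suc n))) \<longlonglongrightarrow> (LINT t:{0<..}|lborel. g t)"
proof -
  define A where "A n = {1 / real (Suc n)..real (Suc n)}" for n
  have U: "(\<Union>n. A n) = {0<..}"
  proof safe
    fix x :: real assume x: "0 < x"
    obtain n where n: "x \<le> real n" using real_arch_simple by blast
    obtain m where m: "1 / x \<le> real m" using real_arch_simple by blast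
    have "1 / x \<le> real (Suc (max n m))" using m by simp
    then have "1 / real (Suc (max n m)) \<le> x" using x by (simp add: field_simps)
    then show "x \<in> (\<Union>n. A n)" using n by (auto simp: A_def intro!: exI[of _ "max n m"])
  next
    fix x n assume "x \<in> A n"
    then have "0 < 1 / real (Suc n)" "1 / real (Suc n) \<le> x" by (auto simp: A_def)
    then show "0 < x" by linarith
  qed
  have "(\<lambda>n. LINT t:A n|lborel. g t) \<longlonglongrightarrow> (LINT t:(\<Union>n. A n)|lborel. g t)"
  proof (rule set_integral_cont_up)
    show "incseq A"
      by (rule incseq_SucI) (auto simp: A_def field_simps intro: order_trans)
    show "set_integrable lborel (\<Union>n. A n) g" using int U by simp
  qed (auto simp: A_def)
  moreover have "(LINT t:A n|lborel. g t) = G (real (Suc n)) - G (1 / real (Suc n))" for n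
  proof -
    have le: "1 / real (Suc n) \<le> real (Suc n)" by (simp add: field_simps)
    have pos: "0 < x" if "1 / real (Suc n) \<le> x" for x
    proof -
      have "0 < 1 / real (Suc n)" by simp
      then show ?thesis using that by linarith
    qed
    have "(\<integral>x. indicator {1 / real (Suc n)..real (Suc n)} x *\<^sub>R g x \<partial>lborel) = G (real (Suc n)) - G (1 / real (Suc n))"
      by (rule integral_FTC_Icc[OF le])
        (use pos in \<open>auto intro!: has_vector_derivative_at_within[OF G] continuous_on_subset[OF cont]\<close>)
    then show ?thesis by (simp add: A_def set_lebesgue_integral_def)
  qed
  ultimately show ?thesis using U by simp
qed

lemma half_line_FTC_at_top:
  fixes g G :: "real \<Rightarrow> complex"
  assumes G: "\<And>t. 0 \<le> t \<Longrightarrow> (G has_vector_derivative g t) (at t)"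
    and cont: "continuous_on {0..} g" and int: "set_integrable lborel {0<..} g"
  shows "((\<lambda>R. G R - G 0) \<longlongrightarrow> (LINT t:{0<..}|lborel. g t)) at_top"
proof -
  have ae: "AE x::real in lborel. (x \<in> {0<..}) = (x \<in> {0..})"
    using AE_lborel_singleton[of "0::real"] by eventually_elim auto
  have int': "set_integrable lborel {0..} g"
  proof -
    have "(\<lambda>x. indicator {0..} x *\<^sub>R g x) \<in> borel_measurable lborel"
      using borel_measurable_continuous_on_indicator[OF _ cont] by simp
    then show ?thesis unfolding set_integrable_def
      by (rule integrable_cong_AE_imp[OF int[unfolded set_integrable_def]])
        (use ae in eventually_elim, auto simp: indicator_def)
  qed
  have eq: "(LINT t:{0<..}|lborel. g t) = (LINT t:{0..}|lborel. g t)"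
    by (rule set_integral_cong_set)
      (use int int' ae in \<open>auto simp: set_integrable_def set_borel_measurable_def\<close>)
  have "((\<lambda>b. LINT t:{0..b}|lborel. g t) \<longlongrightarrow> (LINT t:{0..}|lborel. g t)) at_top"
    by (rule tendsto_set_lebesgue_integral_at_top[OF _ int']) auto
  moreover have "\<forall>\<^sub>F b in at_top. (LINT t:{0..b}|lborel. g t) = G b - G 0"
    using eventually_ge_at_top[of 0]
  proof eventually_elim
    case (elim b)
    have "(\<integral>x. indicator {0..b} x *\<^sub>R g x \<partial>lborel) = G b - G 0"
      by (rule integral_FTC_Icc[OF elim])
        (auto intro!: has_vector_derivative_at_within[OF G] continuous_on_subset[OF cont])
    then show ?case by (simp add: set_lebesgue_integral_def)
  qed
  ultimately show ?thesis unfolding eq by (rule Lim_transform_eventually)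
qed

lemma set_integrable_gamma:
  fixes c u :: real
  assumes "0 < c" "0 < u"
  shows "set_integrable lborel {0<..} (\<lambda>t. t powr (c - 1) * exp (- (u * t)))"
proof -
  let ?f = "\<lambda>t. complex_of_real t powr (complex_of_real c - 1) / of_real (exp (u * t))"
  have "set_integrable lebesgue {0<..} (\<lambda>t. norm (?f t))"
    by (rule set_integrable_norm, rule absolutely_integrable_Gamma_integral) (use assms in auto)
  moreover have "norm (?f t) = t powr (c - 1) * exp (- (u * t))" if "t \<in> {0<..}" for t
    using that by (simp add: norm_divide norm_powr_real_powr exp_minus field_simps)
  then have "(\<lambda>t. indicator {0<..} t *\<^sub>R norm (?f t))
      = (\<lambda>t. indicator {0<..} t *\<^sub>R (t powr (c - 1) * exp (- (u * t))))"
    by (auto simp: indicator_def fun_eq_iff)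
  ultimately have "set_integrable lebesgue {0<..} (\<lambda>t. t powr (c - 1) * exp (- (u * t)))"
    unfolding set_integrable_def by simp
  then show ?thesis unfolding set_integrable_def
    by (subst (asm) integrable_completion) auto
qed

lemma set_integrable_exp_bound:
  fixes f :: "real \<Rightarrow> 'a :: {banach, second_countable_topology}"
  assumes "continuous_on {0<..} f" "0 < \<mu>" "\<And>s. 0 < s \<Longrightarrow> norm (f s) \<le> C * exp (- (\<mu> * s))"
  shows "set_integrable lborel {0<..} f"
proof (rule set_integrable_bound)
  have "set_integrable lborel {0<..} (\<lambda>s. C * (s powr (1 - 1) * exp (- (\<mu> * s))))"
    using set_integrable_gamma[of 1 \<mu>] assms(2) by (intro set_integrable_mult_right) auto
  then show "set_integrable lborel {0<..} (\<lambda>s. C * exp (- (\<mu> * s)))"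
    by (rule set_integrable_cong[THEN iffD1, rotated -1]) auto
  show "set_borel_measurable lborel {0<..} f"
    unfolding set_borel_measurable_def
    using borel_measurable_continuous_on_indicator[OF _ assms(1)] by simp
  show "AE x in lborel. x \<in> {0<..} \<longrightarrow> norm (f x) \<le> norm (C * exp (- (\<mu> * x)))"
    using assms(3) by (auto intro: order_trans[OF _ abs_ge_self])
qed

text \<open>Young's inequality absorbs the power and \<open>ln v \<le> v / U + ln U\<close> the
  logarithm, each into half of \<open>\<epsilon> * v\<close>. Using \<open>x + 1\<close> and
  \<open>y + 1\<close> keeps \<open>T\<close> and \<open>U\<close> positive when a coefficient is
  0.\<close>

lemma sublinear_bound:
  fixes x y \<alpha> \<epsilon> :: real
  assumes "0 \<le> x" "0 \<le> y" "0 < \<alpha>" "\<alpha> < 1" "0 < \<epsilon>"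
  obtains C where "\<And>v. 0 < v \<Longrightarrow> x * v powr \<alpha> + y * ln v \<le> C + \<epsilon> * v"
proof -
  define T where "T = (2 * (x + 1) / \<epsilon>) powr (1 / (1 - \<alpha>))"
  have T: "0 < T" using assms by (simp add: T_def)
  have Ta: "T powr (1 - \<alpha>) = 2 * (x + 1) / \<epsilon>" using assms by (simp add: T_def powr_powr)
  define U where "U = 2 * (y + 1) / \<epsilon>"
  have U: "0 < U" using assms by (simp add: U_def)
  show ?thesis
  proof (rule that[of "\<epsilon> / 2 * T + y * ln U"])
    fix v :: real assume v: "0 < v"
    have "v powr \<alpha> * T powr (1 - \<alpha>) \<le> \<alpha> * v + (1 - \<alpha>) * T"
      using Youngs_inequality_0[of \<alpha> "1 - \<alpha>" v T] assms v T by simp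
    also have "\<dots> \<le> 1 * v + 1 * T" using assms v T by (intro add_mono mult_right_mono) auto
    finally have "v powr \<alpha> * (2 * (x + 1) / \<epsilon>) \<le> v + T" using Ta by simp
    then have "(x + 1) * v powr \<alpha> \<le> \<epsilon> / 2 * v + \<epsilon> / 2 * T" using assms by (simp add: field_simps)
    moreover have "x * v powr \<alpha> \<le> (x + 1) * v powr \<alpha>" by (intro mult_right_mono) auto
    moreover have "y * ln v \<le> \<epsilon> / 2 * v + y * ln U"
    proof -
      have "ln v = ln (v / U) + ln U" using v U by (simp add: ln_div)
      also have "ln (v / U) \<le> v / U" by (rule less_imp_le, rule ln_less_self) (use v U in simp)
      finally have "y * ln v \<le> y * (v / U + ln U)" using assms by (intro mult_left_mono) auto
      then have "y * ln v \<le> y * (v / U) + y * ln U" by (simp only: distrib_left)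
      moreover have "y * (v / U) \<le> (y + 1) * (v / U)" using v U by (intro mult_right_mono) auto
      moreover have "(y + 1) * (v / U) = \<epsilon> / 2 * v" using assms by (simp add: U_def field_simps)
      ultimately show ?thesis by linarith
    qed
    ultimately show "x * v powr \<alpha> + y * ln v \<le> \<epsilon> / 2 * T + y * ln U + \<epsilon> * v" by linarith
  qed
qed

text \<open>One constant for exponents of either sign: for \<open>e \<ge> 0\<close> the upper bound
  \<open>V\<close> is used, otherwise the lower bound \<open>k\<close>, and the remaining factor is
  at least 1.\<close>

lemma powr_le_two_sided:
  fixes k v V e :: real
  assumes "0 < k" "k \<le> 1" "k \<le> v" "v \<le> V" "1 \<le> V"
  shows "v powr e \<le> k powr (- \<bar>e\<bar>) * V powr \<bar>e\<bar>"
proof (cases "0 \<le> e")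
  case True
  have e: "\<bar>e\<bar> = e" using True by simp
  have "1 * v powr e \<le> k powr (- e) * V powr e"
    using True assms by (intro mult_mono powr_mono2) (auto simp: powr_minus one_le_inverse_iff powr_le1)
  then show ?thesis by (simp add: e)
next
  case False
  have e: "\<bar>e\<bar> = - e" using False by simp
  have "v powr e * 1 \<le> k powr e * V powr (- e)"
    using False assms by (intro mult_mono ge_one_powr_ge_zero powr_mono2') auto
  then show ?thesis by (simp add: e)
qed

section \<open>Euler's integral on a rotated half-line and the reflection formula\<close>

text \<open>Multiplied by \<open>w powr c\<close>, the integral is the increment of a primitive of
  \<open>exp (- z) * z powr (c - 1)\<close> along the half-line through \<open>w\<close>. This
  increment is the same for \<open>w\<close> and for 1, where the integral is Euler's.\<close>

lemma Gamma_integral_rotated: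
  fixes c :: real and w :: complex
  assumes c: "0 < c" and w: "0 < Re w"
  shows "set_integrable lborel {0<..} (\<lambda>t. of_real (t powr (c - 1)) * exp (- (of_real t * w)))"
    and "(LINT t:{0<..}|lborel. of_real (t powr (c - 1)) * exp (- (of_real t * w)))
      = of_real (Gamma c) * w powr (- of_real c)"
proof -
  define k :: complex where "k = of_real (c - 1)"
  define f where "f z = exp (- z) * z powr k" for z :: complex
  have "f holomorphic_on (- \<real>\<^sub>\<le>\<^sub>0)"
    unfolding f_def by (intro holomorphic_intros) auto
  then obtain P where P: "\<And>z. z \<notin> \<real>\<^sub>\<le>\<^sub>0 \<Longrightarrow> (P has_field_derivative f z) (at z)"
    using slit_plane_primitive by blast
  have slit: "z \<notin> \<real>\<^sub>\<le>\<^sub>0" if "0 < Re z" for z using that by (auto simp: complex_nonpos_Reals_iff)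
  have int: "set_integrable lborel {0<..} (\<lambda>t. of_real (t powr (c - 1)) * exp (- (of_real t * v)))"
    if v: "0 < Re v" for v :: complex
  proof (rule set_integrable_bound[OF set_integrable_gamma[OF c v]])
    have "continuous_on {0<..} (\<lambda>t. of_real (t powr (c - 1)) * exp (- (of_real t * v)))"
      by (intro continuous_intros) auto
    then show "set_borel_measurable lborel {0<..} (\<lambda>t. of_real (t powr (c - 1)) * exp (- (of_real t * v)))"
      unfolding set_borel_measurable_def by (simp add: borel_measurable_continuous_on_indicator)
  qed (auto simp: norm_mult mult.commute)
  show "set_integrable lborel {0<..} (\<lambda>t. of_real (t powr (c - 1)) * exp (- (of_real t * w)))"
    by (rule int[OF w])
  have lim: "(\<lambda>n. P (of_real (real (Suc n)) * v) - P (of_real (1 / real (Suc n)) * v)) \<longlonglongrightarrow>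
      v powr (of_real c) * (LINT t:{0<..}|lborel. of_real (t powr (c - 1)) * exp (- (of_real t * v)))"
    if v: "0 < Re v" for v :: complex
  proof -
    define g where "g t = v powr (of_real c) * (of_real (t powr (c - 1)) * exp (- (of_real t * v)))" for t
    have "(\<lambda>n. P (of_real (real (Suc n)) * v) - P (of_real (1 / real (Suc n)) * v))
      \<longlonglongrightarrow> (LINT t:{0<..}|lborel. g t)"
    proof (rule half_line_FTC_sequentially[of "\<lambda>t. P (of_real t * v)"])
      fix t :: real assume t: "0 < t"
      have "0 < Re (of_real t * v)" using t v by simp
      then have "(P \<circ> (\<lambda>t. of_real t * v) has_vector_derivative v * f (of_real t * v)) (at t)"
        by (intro field_vector_diff_chain_at P slit) (auto intro!: derivative_eq_intros)
      moreover have "v * f (of_real t * v) = g t"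
      proof -
        have v0: "v \<noteq> 0" using v by auto
        have "(of_real t * v) powr k = of_real t powr k * v powr k"
          using t v0 by (intro powr_times_real_left) auto
        moreover have "v * v powr k = v powr (of_real c)"
          using v0 by (simp add: k_def powr_diff)
        moreover have "complex_of_real t powr k = of_real (t powr (c - 1))"
          using t by (simp add: k_def powr_of_real del: of_real_diff)
        ultimately show ?thesis unfolding f_def g_def by (simp add: mult_ac)
      qed
      ultimately show "((\<lambda>t. P (of_real t * v)) has_vector_derivative g t) (at t)" by (simp add: o_def)
    next
      show "continuous_on {0<..} g" unfolding g_def by (intro continuous_intros) auto
      show "set_integrable lborel {0<..} g" unfolding g_def by (intro set_integrable_mult_right int v)
    qed
    then show ?thesis by (simp add: g_def)
  qed
  define m where "m = min 1 (Re w)"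
  define M where "M = max 1 (norm w)"
  have m: "0 < m" "m \<le> 1" "m \<le> Re w" and M: "1 \<le> M" "norm w \<le> M" using w by (auto simp: m_def M_def)
  define K where "K = m powr (- \<bar>c - 1\<bar>) * M powr \<bar>c - 1\<bar>"
  \<comment> \<open>On the segment between \<open>t * w\<close> and \<open>t\<close> the modulus is
    comparable to \<open>t\<close> and the real part is at least \<open>m * t\<close>. With the
    length \<open>t * norm (w - 1)\<close> the difference is of order
    \<open>t powr c * exp (- m * t)\<close>, which vanishes at both ends because
    \<open>c > 0\<close>.\<close>
  have bound: "norm (P (of_real t * w) - P (of_real t * 1)) \<le> (exp (- (m * t)) * (t powr (c - 1) * K)) * norm (of_real t * w - of_real t * 1)"
    if t: "0 < t" for t :: real
  proof (rule primitive_diff_le[of P f])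
    fix \<zeta> assume "\<zeta> \<in> closed_segment (of_real t * w) (of_real t * 1)"
    then obtain u where u: "0 \<le> u" "u \<le> 1" "\<zeta> = (1 - u) *\<^sub>R (of_real t * w) + u *\<^sub>R (of_real t * 1)"
      by (auto simp: in_segment)
    define q where "q = (1 - u) *\<^sub>R w + u *\<^sub>R 1"
    have zq: "\<zeta> = of_real t * q" by (simp add: u(3) q_def scaleR_conv_of_real algebra_simps)
    have "(1 - u) * m + u * m \<le> (1 - u) * Re w + u * 1" using u m by (intro add_mono mult_left_mono) auto
    then have Rq: "m \<le> Re q" by (simp add: q_def algebra_simps)
    have nq: "m \<le> norm q" using Rq complex_Re_le_cmod[of q] by linarith
    have "norm q \<le> (1 - u) * norm w + u * norm (1::complex)"
      unfolding q_def by (rule norm_triangle_le) (use u in simp)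
    also have "\<dots> \<le> (1 - u) * M + u * M" using u M by (intro add_mono mult_left_mono) auto
    finally have Nq: "norm q \<le> M" by (simp add: algebra_simps)
    have "norm (f \<zeta>) = exp (- (t * Re q)) * (t * norm q) powr (c - 1)"
      using t unfolding f_def zq k_def by (simp add: norm_mult norm_powr_real_powr')
    also have "\<dots> \<le> exp (- (m * t)) * (t powr (c - 1) * K)"
    proof (rule mult_mono)
      show "exp (- (t * Re q)) \<le> exp (- (m * t))" using Rq t by (simp add: mult.commute)
      show "(t * norm q) powr (c - 1) \<le> t powr (c - 1) * K"
        using powr_le_two_sided[of m "norm q" M "c - 1"] m nq Nq M t by (simp add: powr_mult K_def)
    qed auto
    finally show "\<zeta> \<notin> \<real>\<^sub>\<le>\<^sub>0 \<and> norm (f \<zeta>) \<le> exp (- (m * t)) * (t powr (c - 1) * K)"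
      using slit[of \<zeta>] Rq t m zq by simp
  qed (rule P)
  have bound': "norm (P (of_real t * w) - P (of_real t * 1)) \<le> (K * norm (w - 1)) * (t powr c * exp (- (m * t)))"
    if t: "0 < t" for t :: real
  proof -
    have "norm (of_real t * w - of_real t * 1) = t * norm (w - 1)"
    proof -
      have "of_real t * w - of_real t * 1 = of_real t * (w - 1)" by (simp add: algebra_simps)
      then show ?thesis using t by (simp only: norm_mult norm_of_real abs_of_pos)
    qed
    moreover have tc: "t powr (c - 1) * t = t powr c" using t by (simp add: powr_diff)
    moreover have "(exp (- (m * t)) * (t powr (c - 1) * K)) * (t * norm (w - 1))
        = (K * norm (w - 1)) * ((t powr (c - 1) * t) * exp (- (m * t)))"
      by (simp only: mult_ac)
    ultimately show ?thesis using bound[OF t] by (simp only: tc)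
  qed
  have one: "0 < Re (1 :: complex)" by simp
  have z1: "(\<lambda>n. P (of_real (real (Suc n)) * w) - P (of_real (real (Suc n)) * 1)) \<longlonglongrightarrow> 0"
  proof (rule Lim_null_comparison)
    show "\<forall>\<^sub>F n in sequentially. norm (P (of_real (real (Suc n)) * w) - P (of_real (real (Suc n)) * 1))
      \<le> (K * norm (w - 1)) * (real (Suc n) powr c * exp (- (m * real (Suc n))))"
      by (intro always_eventually allI bound') simp
    have "((\<lambda>t. t powr c * exp (- (m * t))) \<longlongrightarrow> 0) at_top" using m c by real_asymp
    then have "(\<lambda>n. real (Suc n) powr c * exp (- (m * real (Suc n)))) \<longlonglongrightarrow> 0"
      by (rule filterlim_compose) (rule filterlim_compose[OF filterlim_real_sequentially filterlim_Suc])
    then show "(\<lambda>n. (K * norm (w - 1)) * (real (Suc n) powr c * exp (- (m * real (Suc n))))) \<longlonglongrightarrow> 0"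
      by (rule tendsto_mult_right_zero)
  qed
  have z2: "(\<lambda>n. P (of_real (1 / real (Suc n)) * w) - P (of_real (1 / real (Suc n)) * 1)) \<longlonglongrightarrow> 0"
  proof (rule Lim_null_comparison)
    show "\<forall>\<^sub>F n in sequentially. norm (P (of_real (1 / real (Suc n)) * w) - P (of_real (1 / real (Suc n)) * 1))
      \<le> (K * norm (w - 1)) * ((1 / real (Suc n)) powr c * exp (- (m * (1 / real (Suc n)))))"
      by (intro always_eventually allI bound') simp
    have "((\<lambda>t. (1 / t) powr c * exp (- (m * (1 / t)))) \<longlongrightarrow> 0) at_top" using m c by real_asymp
    then have "(\<lambda>n. (1 / real (Suc n)) powr c * exp (- (m * (1 / real (Suc n))))) \<longlonglongrightarrow> 0"
      by (rule filterlim_compose) (rule filterlim_compose[OF filterlim_real_sequentially filterlim_Suc])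
    then show "(\<lambda>n. (K * norm (w - 1)) * ((1 / real (Suc n)) powr c * exp (- (m * (1 / real (Suc n)))))) \<longlonglongrightarrow> 0"
      by (rule tendsto_mult_right_zero)
  qed
  define I where "I v = (LINT t:{0<..}|lborel. of_real (t powr (c - 1)) * exp (- (of_real t * v)))" for v :: complex
  have "w powr (of_real c) * I w = 1 powr (of_real c) * I 1"
  proof (rule LIMSEQ_unique)
    show "(\<lambda>n. P (of_real (real (Suc n)) * w) - P (of_real (1 / real (Suc n)) * w)) \<longlonglongrightarrow> w powr (of_real c) * I w"
      using lim[OF w] by (simp only: I_def)
    have "(\<lambda>n. (P (of_real (real (Suc n)) * w) - P (of_real (real (Suc n)) * 1))
        + (P (of_real (real (Suc n)) * 1) - P (of_real (1 / real (Suc n)) * 1))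
        - (P (of_real (1 / real (Suc n)) * w) - P (of_real (1 / real (Suc n)) * 1))) \<longlonglongrightarrow> 0 + 1 powr (of_real c) * I 1 - 0"
      using lim[OF one] by (intro tendsto_diff tendsto_add z1 z2) (simp only: I_def)
    then show "(\<lambda>n. P (of_real (real (Suc n)) * w) - P (of_real (1 / real (Suc n)) * w)) \<longlonglongrightarrow> 1 powr (of_real c) * I 1"
      by (simp add: algebra_simps)
  qed
  moreover have "I 1 = of_real (Gamma c)"
  proof -
    have "((\<lambda>t. of_real t powr (complex_of_real c - 1) / of_real (exp t)) has_integral Gamma (complex_of_real c)) {0..}"
      by (rule Gamma_integral_complex) (use c in auto)
    then have "((\<lambda>t. of_real (t powr (c - 1)) * exp (- (of_real t * 1))) has_integral Gamma (complex_of_real c)) {0..}"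
    proof (rule has_integral_eq[rotated])
      fix t :: real assume "t \<in> {0..}"
      then show "of_real t powr (complex_of_real c - 1) / of_real (exp t) = of_real (t powr (c - 1)) * exp (- (of_real t * 1))"
        by (cases "t = 0") (simp_all add: powr_of_real[symmetric] exp_of_real exp_minus field_simps)
    qed
    then have "((\<lambda>t. of_real (t powr (c - 1)) * exp (- (of_real t * 1))) has_integral Gamma (complex_of_real c)) {0<..}"
      by (subst (asm) has_integral_spike_set_eq[where T="{0<..}"])
        (auto intro: negligible_subset[of "{0}"])
    moreover have "((\<lambda>t. of_real (t powr (c - 1)) * exp (- (of_real t * 1))) has_integral I 1) {0<..}"
      using set_borel_integral_eq_integral[OF int[OF one]] unfolding I_def
      by (simp only: integrable_integral)
    ultimately have "I 1 = Gamma (complex_of_real c)" using has_integral_unique by blast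
    then show ?thesis by (simp add: Gamma_complex_of_real)
  qed
  ultimately have "w powr (of_real c) * I w = of_real (Gamma c)" by simp
  moreover have "w \<noteq> 0" using w by auto
  ultimately show "(LINT t:{0<..}|lborel. of_real (t powr (c - 1)) * exp (- (of_real t * w)))
      = of_real (Gamma c) * w powr (- of_real c)"
    by (simp add: I_def powr_minus field_simps)
qed

text \<open>Formulated with \<open>rGamma\<close> on the left so that the zeros at the non-positive
  integers are covered; \<open>z < 1\<close> keeps \<open>1 - z\<close> away from the poles of
  \<open>Gamma\<close>.\<close>

lemma rGamma_reflection_real:
  fixes z :: real
  assumes "z < 1"
  shows "rGamma z = Gamma (1 - z) * sin (pi * z) / pi"
proof -
  have "complex_of_real (rGamma z * rGamma (1 - z)) = of_real (sin (pi * z) / pi)"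
    using rGamma_reflection_complex[of "of_real z"]
    by (simp flip: rGamma_complex_of_real sin_of_real)
  then have e: "rGamma z * rGamma (1 - z) = sin (pi * z) / pi" by (simp only: of_real_eq_iff)
  have "0 < Gamma (1 - z)" using assms by (intro Gamma_real_pos) simp
  then have "rGamma z = (rGamma z * rGamma (1 - z)) * Gamma (1 - z)"
    by (simp add: rGamma_inverse_Gamma[of "1 - z"])
  then show ?thesis unfolding e by (simp add: mult.commute)
qed

lemma set_integrable_congI:
  assumes "set_integrable M A f" "\<And>x. x \<in> A \<Longrightarrow> f x = g x"
  shows "set_integrable M A g"
proof -
  have "(\<lambda>x. indicator A x *\<^sub>R f x) = (\<lambda>x. indicator A x *\<^sub>R g x)"
  proof
    show "indicator A x *\<^sub>R f x = indicator A x *\<^sub>R g x" for x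
      by (cases "x \<in> A") (auto simp: assms(2))
  qed
  then show ?thesis using assms(1) by (simp add: set_integrable_def)
qed

section \<open>Hankel's formula on a tilted ray\<close>

text \<open>Hankel's contour for the reciprocal Gamma function is replaced by the ray
  \<open>{1 + s e\<^sup>i\<^sup>\<omega> | s \<ge> 0}\<close> with \<open>\<pi>/2 < \<omega> < \<pi>\<close>, of which the complex conjugate ray is the
  other half. For \<open>\<omega>\<close> close to \<open>\<pi>/2\<close> the powers \<open>\<lambda>\<^sup>\<alpha>\<close> on it have positive real part.\<close>

locale tilted_ray =
  fixes \<omega> :: real
  assumes omega: "pi / 2 < \<omega>" "\<omega> < pi"
begin

definition ray :: "real \<Rightarrow> complex" where "ray s = 1 + of_real s * cis \<omega>"

lemma cos_omega: "cos \<omega> < 0"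
  using cos_lt_zero_pi[of \<omega>] omega cos_monotone_0_pi[of "pi/2" \<omega>] by simp

lemma sin_omega: "0 < sin \<omega>" "sin \<omega> \<le> 1"
  using sin_gt_zero[of \<omega>] omega by auto

lemma ray_slit: "0 \<le> s \<Longrightarrow> ray s \<notin> \<real>\<^sub>\<le>\<^sub>0"
proof (cases "s = 0")
  case False
  moreover assume "0 \<le> s"
  ultimately have "0 < Im (ray s)" using sin_omega by (simp add: ray_def)
  then show ?thesis by (auto simp: complex_nonpos_Reals_iff)
qed (simp add: ray_def)

text \<open>\<open>sin \<omega>\<close> is the distance of the origin from the line that carries the
  ray.\<close>

lemma norm_ray_ge: "sin \<omega> \<le> norm (ray s)"
proof -
  have "(sin \<omega>)\<^sup>2 \<le> (s + cos \<omega>)\<^sup>2 + (sin \<omega>)\<^sup>2" by simp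
  also have "\<dots> = (1 + s * cos \<omega>)\<^sup>2 + (s * sin \<omega>)\<^sup>2"
    using sin_cos_squared_add[of \<omega>] by algebra
  also have "\<dots> = (norm (ray s))\<^sup>2" by (simp add: ray_def cmod_power2)
  finally show ?thesis by (rule power2_le_imp_le) simp
qed

lemma norm_ray_le: "0 \<le> s \<Longrightarrow> norm (ray s) \<le> 1 + s"
  unfolding ray_def by (rule norm_triangle_le) (simp add: norm_mult)

lemma Re_ray: "Re (ray s) = 1 + s * cos \<omega>"
  by (simp add: ray_def)

lemma ray_nonzero: "ray s \<noteq> 0"
  using norm_ray_ge[of s] sin_omega by auto

text \<open>The integrand of Hankel's formula for the Wright function of index \<open>b\<close>;
  \<open>cis \<omega>\<close> is the derivative of \<open>ray\<close>. At \<open>x = 0\<close> it is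
  the integrand for \<open>rGamma b\<close>.\<close>

definition kernel :: "real \<Rightarrow> real \<Rightarrow> real \<Rightarrow> real \<Rightarrow> complex" where
  "kernel x a b s = exp (ray s - of_real x * ray s powr of_real a) * ray s powr (- of_real b) * cis \<omega>"

definition kernel_bound :: "real \<Rightarrow> real \<Rightarrow> real \<Rightarrow> real \<Rightarrow> real" where
  "kernel_bound x a b s = exp (1 + s * cos \<omega> + x * (1 + s) powr a)
     * (sin \<omega> powr (- \<bar>b\<bar>) * (1 + s) powr \<bar>b\<bar>)"

lemma kernel_bound_exp:
  assumes "0 \<le> x" "0 < a" "a < 1"
  obtains C where "0 \<le> C" "\<And>s. 0 \<le> s \<Longrightarrow> kernel_bound x a b s \<le> C * exp (- ((- cos \<omega> / 2) * s))"
proof -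
  obtain C where C: "\<And>v. 0 < v \<Longrightarrow> x * v powr a + \<bar>b\<bar> * ln v \<le> C + (- cos \<omega> / 2) * v"
    using sublinear_bound[of x "\<bar>b\<bar>" a "- cos \<omega> / 2"] assms cos_omega by auto
  define C' where "C' = sin \<omega> powr (- \<bar>b\<bar>) * exp (1 + C + (- cos \<omega> / 2))"
  show ?thesis
  proof (rule that[of C'])
    fix s :: real assume s: "0 \<le> s"
    have "(1 + s) powr \<bar>b\<bar> = exp (\<bar>b\<bar> * ln (1 + s))" using s by (simp add: powr_def)
    then have "kernel_bound x a b s = sin \<omega> powr (- \<bar>b\<bar>) * exp (1 + s * cos \<omega> + (x * (1 + s) powr a + \<bar>b\<bar> * ln (1 + s)))"
      by (simp add: kernel_bound_def exp_add)
    also have "\<dots> \<le> sin \<omega> powr (- \<bar>b\<bar>) * exp (1 + C + (- cos \<omega> / 2) + - ((- cos \<omega> / 2) * s))"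
      using C[of "1 + s"] s by (intro mult_left_mono) (auto simp: algebra_simps add_divide_distrib)
    also have "\<dots> = C' * exp (- ((- cos \<omega> / 2) * s))" by (simp only: C'_def exp_add mult.assoc)
    finally show "kernel_bound x a b s \<le> C' * exp (- ((- cos \<omega> / 2) * s))" .
  qed (simp add: C'_def)
qed

lemma kernel_bound_tendsto_0:
  assumes "0 \<le> x" "0 < a" "a < 1"
  shows "(kernel_bound x a b \<longlongrightarrow> 0) at_top"
proof -
  obtain C where C: "0 \<le> C" "\<And>s. 0 \<le> s \<Longrightarrow> kernel_bound x a b s \<le> C * exp (- ((- cos \<omega> / 2) * s))"
    using kernel_bound_exp assms by blast
  have "((\<lambda>s. C * exp (- ((- cos \<omega> / 2) * s))) \<longlongrightarrow> C * 0) at_top"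
    using cos_omega by (intro tendsto_mult tendsto_const) real_asymp
  then have lim: "((\<lambda>s. C * exp (- ((- cos \<omega> / 2) * s))) \<longlongrightarrow> 0) at_top" by simp
  show ?thesis
  proof (rule tendsto_sandwich[OF _ _ tendsto_const lim])
    show "\<forall>\<^sub>F s in at_top. kernel_bound x a b s \<le> C * exp (- ((- cos \<omega> / 2) * s))"
      by (rule eventually_mono[OF eventually_ge_at_top[of 0] C(2)])
  qed (auto intro: always_eventually simp: kernel_bound_def)
qed

lemma norm_kernel_le:
  assumes "0 \<le> s" "0 < a" "a < 1"
  shows "norm (kernel x a b s) \<le> kernel_bound \<bar>x\<bar> a b s"
proof -
  have "Re (- (of_real x * ray s powr of_real a)) \<le> norm (- (of_real x * ray s powr of_real a))"
    by (rule complex_Re_le_cmod)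
  also have "\<dots> = \<bar>x\<bar> * norm (ray s) powr a" by (simp add: norm_mult norm_powr_real_powr')
  also have "\<dots> \<le> \<bar>x\<bar> * (1 + s) powr a"
    using norm_ray_le[OF assms(1)] assms by (intro mult_left_mono powr_mono2) auto
  finally have "Re (ray s - of_real x * ray s powr of_real a) \<le> 1 + s * cos \<omega> + \<bar>x\<bar> * (1 + s) powr a"
    by (simp add: Re_ray)
  moreover have "norm (ray s) powr (- b) \<le> sin \<omega> powr (- \<bar>b\<bar>) * (1 + s) powr \<bar>b\<bar>"
    using powr_le_two_sided[OF sin_omega norm_ray_ge[of s] norm_ray_le[OF assms(1)], of "- b"] assms by simp
  ultimately have "exp (Re (ray s - of_real x * ray s powr of_real a)) * norm (ray s) powr (- b)
      \<le> kernel_bound \<bar>x\<bar> a b s"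
    unfolding kernel_bound_def by (intro mult_mono) auto
  moreover have "norm (kernel x a b s) = exp (Re (ray s - of_real x * ray s powr of_real a)) * norm (ray s) powr (- b)"
    unfolding kernel_def norm_mult norm_exp_eq_Re using norm_powr_real_powr'[of "- of_real b" "ray s"] by simp
  ultimately show ?thesis by simp
qed

lemma continuous_on_ray [continuous_intros]: "continuous_on S ray"
  unfolding ray_def[abs_def] by (intro continuous_intros)

lemma continuous_on_kernel: "continuous_on {0..} (kernel x a b)"
  unfolding kernel_def[abs_def]
  by (intro continuous_intros) (use ray_slit ray_nonzero in \<open>auto simp: complex_nonpos_Reals_iff\<close>)

lemma kernel_integrable:
  assumes "0 < a" "a < 1"
  shows "set_integrable lborel {0<..} (kernel x a b)"
proof -
  obtain C where C: "0 \<le> C" "\<And>s. 0 \<le> s \<Longrightarrow> kernel_bound \<bar>x\<bar> a b s \<le> C * exp (- ((- cos \<omega> / 2) * s))"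
    using kernel_bound_exp[of "\<bar>x\<bar>" a b] assms by auto
  show ?thesis
  proof (rule set_integrable_exp_bound[of _ "- cos \<omega> / 2" C])
    show "continuous_on {0<..} (kernel x a b)"
      by (rule continuous_on_subset[OF continuous_on_kernel]) auto
    show "norm (kernel x a b s) \<le> C * exp (- ((- cos \<omega> / 2) * s))" if "0 < s" for s
      using norm_kernel_le[OF _ assms, of s x b] C(2)[of s] that by linarith
  qed (use cos_omega in simp)
qed

text \<open>For \<open>z < 1\<close> the singularity of \<open>\<lambda>^(-z)\<close> at the origin
  is integrable, so the ray may start there. As \<open>- cis \<omega>\<close> has positive real
  part, this is a rotated Euler integral with value
  \<open>Gamma (1 - z) * cis ((1 - z) * pi)\<close>, and the reflection formula identifies the
  imaginary part.\<close>

lemma Im_integral_ray_from_0: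
  assumes z: "z < 1"
  defines "g \<equiv> \<lambda>r. exp (of_real r * cis \<omega>) * (of_real r * cis \<omega>) powr (- of_real z) * cis \<omega>"
  shows "set_integrable lborel {0<..} g" and "Im (LINT r:{0<..}|lborel. g r) = pi * rGamma z"
proof -
  define w where "w = - cis \<omega>"
  define k where "k = cis ((1 - z) * \<omega>)"
  define h where "h r = of_real (r powr (1 - z - 1)) * exp (- (of_real r * w))" for r
  have w: "0 < Re w" using cos_omega by (simp add: w_def)
  have Lncis: "Ln (cis t) = \<i> * of_real t" if "- pi < t" "t \<le> pi" for t
    using that by (simp add: cis_conv_exp Ln_exp)
  have cp: "cis \<omega> powr v = exp (v * (\<i> * of_real \<omega>))" for v
    using Lncis[of \<omega>] omega by (simp add: powr_def)
  have eq: "g r = h r * k" if "r \<in> {0<..}" for r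
  proof -
    have "(of_real r * cis \<omega>) powr (- of_real z) = of_real r powr (- of_real z) * cis \<omega> powr (- of_real z)"
      using that by (intro powr_times_real_left) auto
    also have "of_real r powr (- complex_of_real z) = of_real (r powr (- z))"
      using that powr_of_real[of r "- z"] by simp
    also have "cis \<omega> powr (- of_real z) = cis (- (z * \<omega>))"
      unfolding cp by (simp add: cis_conv_exp mult_ac)
    finally show ?thesis
      by (simp add: g_def h_def w_def k_def mult_ac cis_mult algebra_simps)
  qed
  note rot = Gamma_integral_rotated[OF _ w, of "1 - z"]
  have "set_integrable lborel {0<..} (\<lambda>r. h r * k)"
    unfolding h_def by (intro set_integrable_mult_left rot(1)) (use z in simp)
  then show "set_integrable lborel {0<..} g"
    by (rule set_integrable_congI) (simp add: eq)
  have "(LINT r:{0<..}|lborel. g r) = (LINT r:{0<..}|lborel. h r * k)"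
    by (rule set_lebesgue_integral_cong) (auto simp: eq)
  also have "\<dots> = (LINT r:{0<..}|lborel. h r) * k" by simp
  also have "(LINT r:{0<..}|lborel. h r) = of_real (Gamma (1 - z)) * w powr (- of_real (1 - z))"
    unfolding h_def by (rule rot(2)) (use z in simp)
  also have "w powr (- of_real (1 - z)) = cis ((z - 1) * (\<omega> - pi))"
  proof -
    have "w = cis (\<omega> - pi)" by (simp add: w_def complex_eq_iff cos_diff sin_diff)
    then show ?thesis using Lncis[of "\<omega> - pi"] omega by (simp add: powr_def cis_conv_exp mult_ac)
  qed
  also have "of_real (Gamma (1 - z)) * cis ((z - 1) * (\<omega> - pi)) * k = of_real (Gamma (1 - z)) * cis ((1 - z) * pi)"
    by (simp add: k_def mult.assoc cis_mult algebra_simps)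
  finally have I: "(LINT r:{0<..}|lborel. g r) = of_real (Gamma (1 - z)) * cis ((1 - z) * pi)" .
  have "pi * rGamma z = Gamma (1 - z) * sin (pi * z)"
    using rGamma_reflection_real[OF z] by simp
  moreover have "sin ((1 - z) * pi) = sin (pi * z)" by (simp add: algebra_simps sin_diff)
  ultimately show "Im (LINT r:{0<..}|lborel. g r) = pi * rGamma z" by (simp add: I)
qed

text \<open>The starting point moves from 0 to 1. The two rays are parallel, so their far ends stay
  at distance 1; near 0 the end on the ray is joined to the positive axis, along which the imaginary
  part of the primitive is constant.\<close>

lemma rGamma_ray_less_1:
  assumes z: "z < 1" and a: "0 < a" "a < 1"
  shows "Im (LINT s:{0<..}|lborel. kernel 0 a z s) = pi * rGamma z"
proof -
  define f where "f \<zeta> = exp \<zeta> * \<zeta> powr (- of_real z)" for \<zeta> :: complex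
  have "f holomorphic_on (- \<real>\<^sub>\<le>\<^sub>0)"
    unfolding f_def by (intro holomorphic_intros) auto
  then obtain P where P: "\<And>z. z \<notin> \<real>\<^sub>\<le>\<^sub>0 \<Longrightarrow> (P has_field_derivative f z) (at z)"
    using slit_plane_primitive by blast
  define R where "R n = real (Suc n)" for n
  have R: "1 \<le> R n" "0 < R n" for n by (auto simp: R_def)
  have Rtop: "filterlim R at_top sequentially"
    unfolding R_def by (rule filterlim_compose[OF filterlim_real_sequentially filterlim_Suc])
  have slit: "of_real r * cis \<omega> \<notin> \<real>\<^sub>\<le>\<^sub>0" if "0 < r" for r
    using that sin_omega by (auto simp: complex_nonpos_Reals_iff)
  have vd: "((\<lambda>t. P (c + of_real t * cis \<omega>)) has_vector_derivative f (c + of_real t * cis \<omega>) * cis \<omega>) (at t)"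
    if "c + of_real t * cis \<omega> \<notin> \<real>\<^sub>\<le>\<^sub>0" for t c
  proof -
    have "(P \<circ> (\<lambda>t. c + of_real t * cis \<omega>) has_vector_derivative cis \<omega> * f (c + of_real t * cis \<omega>)) (at t)"
      using that by (intro field_vector_diff_chain_at P) (auto intro!: derivative_eq_intros)
    then show ?thesis by (simp add: o_def mult.commute)
  qed
  have l1: "(\<lambda>n. P (of_real (R n) * cis \<omega>) - P (of_real (1 / R n) * cis \<omega>)) \<longlonglongrightarrow>
      (LINT r:{0<..}|lborel. exp (of_real r * cis \<omega>) * (of_real r * cis \<omega>) powr (- of_real z) * cis \<omega>)"
    unfolding R_def
  proof (rule half_line_FTC_sequentially[of "\<lambda>t. P (of_real t * cis \<omega>)"])
    show "((\<lambda>t. P (of_real t * cis \<omega>)) has_vector_derivative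
        exp (of_real t * cis \<omega>) * (of_real t * cis \<omega>) powr (- of_real z) * cis \<omega>) (at t)" if "0 < t" for t
      using vd[of 0 t] slit[OF that] by (simp add: f_def)
    show "continuous_on {0<..} (\<lambda>r. exp (of_real r * cis \<omega>) * (of_real r * cis \<omega>) powr (- of_real z) * cis \<omega>)"
      by (intro continuous_intros) (use sin_omega in auto)
  qed (rule Im_integral_ray_from_0(1)[OF z])
  have ker: "kernel 0 a z s = f (1 + of_real s * cis \<omega>) * cis \<omega>" for s
    by (simp add: kernel_def f_def ray_def)
  have l2: "(\<lambda>n. P (1 + of_real (R n) * cis \<omega>) - P (1 + of_real (1 / R n) * cis \<omega>)) \<longlonglongrightarrow>
      (LINT s:{0<..}|lborel. kernel 0 a z s)"
    unfolding R_def
  proof (rule half_line_FTC_sequentially[of "\<lambda>t. P (1 + of_real t * cis \<omega>)"])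
    show "((\<lambda>t. P (1 + of_real t * cis \<omega>)) has_vector_derivative kernel 0 a z t) (at t)" if "0 < t" for t
      using vd[of 1 t] ray_slit[of t] that by (simp add: ker ray_def)
    show "continuous_on {0<..} (kernel 0 a z)"
      by (rule continuous_on_subset[OF continuous_on_kernel]) auto
  qed (rule kernel_integrable[OF a])
  have d1: "(\<lambda>n. P (of_real (R n) * cis \<omega>) - P (1 + of_real (R n) * cis \<omega>)) \<longlonglongrightarrow> 0"
  proof (rule Lim_null_comparison)
    show "\<forall>\<^sub>F n in sequentially. norm (P (of_real (R n) * cis \<omega>) - P (1 + of_real (R n) * cis \<omega>)) \<le> kernel_bound 0 a z (R n)"
    proof (intro always_eventually allI)
      fix n
      have "norm (P (of_real (R n) * cis \<omega>) - P (1 + of_real (R n) * cis \<omega>))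
        \<le> kernel_bound 0 a z (R n) * norm (of_real (R n) * cis \<omega> - (1 + of_real (R n) * cis \<omega>))"
      proof (rule primitive_diff_le[OF P])
        fix \<zeta> assume "\<zeta> \<in> closed_segment (of_real (R n) * cis \<omega>) (1 + of_real (R n) * cis \<omega>)"
        then obtain u where u: "0 \<le> u" "u \<le> 1" "\<zeta> = (1 - u) *\<^sub>R (of_real (R n) * cis \<omega>) + u *\<^sub>R (1 + of_real (R n) * cis \<omega>)"
          by (auto simp: in_segment)
        have zeta: "\<zeta> = of_real u + of_real (R n) * cis \<omega>" by (simp add: u(3) scaleR_conv_of_real algebra_simps)
        have Im: "Im \<zeta> = R n * sin \<omega>" by (simp add: zeta)
        have "1 * sin \<omega> \<le> R n * sin \<omega>" using R sin_omega by (intro mult_right_mono) auto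
        also have "\<dots> \<le> norm \<zeta>" using abs_Im_le_cmod[of \<zeta>] Im by simp
        finally have n1: "sin \<omega> \<le> norm \<zeta>" by simp
        have n2: "norm \<zeta> \<le> 1 + R n"
          unfolding zeta by (rule norm_triangle_le) (use u R[of n] in \<open>simp add: norm_mult\<close>)
        have "norm (f \<zeta>) = exp (u + R n * cos \<omega>) * norm \<zeta> powr (- z)"
          by (simp add: f_def norm_mult norm_powr_real_powr' zeta)
        also have "\<dots> \<le> exp (1 + R n * cos \<omega>) * (sin \<omega> powr (- \<bar>z\<bar>) * (1 + R n) powr \<bar>z\<bar>)"
          using powr_le_two_sided[OF sin_omega n1 n2, of "- z"] u R[of n] by (intro mult_mono) auto
        finally have "norm (f \<zeta>) \<le> kernel_bound 0 a z (R n)" by (simp add: kernel_bound_def)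
        moreover have "0 < Im \<zeta>" using Im R[of n] sin_omega by simp
        ultimately show "\<zeta> \<notin> \<real>\<^sub>\<le>\<^sub>0 \<and> norm (f \<zeta>) \<le> kernel_bound 0 a z (R n)"
          by (auto simp: complex_nonpos_Reals_iff)
      qed
      then show "norm (P (of_real (R n) * cis \<omega>) - P (1 + of_real (R n) * cis \<omega>)) \<le> kernel_bound 0 a z (R n)" by simp
    qed
    show "(\<lambda>n. kernel_bound 0 a z (R n)) \<longlonglongrightarrow> 0"
      by (rule filterlim_compose[OF kernel_bound_tendsto_0 Rtop]) (use a in auto)
  qed
  \<comment> \<open>The distance of the origin from the chord between \<open>cis \<omega>\<close>
    and 1: rotation by \<open>- \<omega> / 2\<close> makes the chord vertical with this abscissa. On
    the scaled chord the integrand is thus of order \<open>\<epsilon> powr (- z)\<close>, and the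
    difference of the primitive of order \<open>\<epsilon> powr (1 - z)\<close>.\<close>
  define k where "k = cos (\<omega> / 2)"
  have k: "0 < k" "k \<le> 1" using omega by (auto simp: k_def intro!: cos_gt_zero)
  have d2: "(\<lambda>n. P (of_real (1 / R n) * cis \<omega>) - P (of_real (1 / R n))) \<longlonglongrightarrow> 0"
  proof (rule Lim_null_comparison)
    show "\<forall>\<^sub>F n in sequentially. norm (P (of_real (1 / R n) * cis \<omega>) - P (of_real (1 / R n)))
       \<le> (exp 1 * (k powr (- \<bar>z\<bar>) * (1 / R n) powr (- z))) * (2 / R n)"
    proof (intro always_eventually allI)
      fix n
      define \<epsilon> where "\<epsilon> = 1 / R n"
      have e: "0 < \<epsilon>" "\<epsilon> \<le> 1" using R[of n] by (auto simp: \<epsilon>_def)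
      have "norm (P (of_real \<epsilon> * cis \<omega>) - P (of_real \<epsilon>))
        \<le> (exp 1 * (k powr (- \<bar>z\<bar>) * \<epsilon> powr (- z))) * norm (of_real \<epsilon> * cis \<omega> - of_real \<epsilon>)"
      proof (rule primitive_diff_le[OF P])
        fix \<zeta> assume "\<zeta> \<in> closed_segment (of_real \<epsilon> * cis \<omega>) (of_real \<epsilon>)"
        then obtain u where u: "0 \<le> u" "u \<le> 1" "\<zeta> = (1 - u) *\<^sub>R (of_real \<epsilon> * cis \<omega>) + u *\<^sub>R of_real \<epsilon>"
          by (auto simp: in_segment)
        define q where "q = of_real (1 - u) * cis \<omega> + of_real u"
        have zeta: "\<zeta> = of_real \<epsilon> * q" by (simp add: u(3) q_def scaleR_conv_of_real algebra_simps)
        have "cos \<omega> = 2 * k\<^sup>2 - 1" "sin \<omega> = 2 * sin (\<omega> / 2) * k"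
          using cos_double_cos[of "\<omega> / 2"] sin_double[of "\<omega> / 2"] by (auto simp: k_def)
        then have Rq: "Re (q * cis (- (\<omega> / 2))) = k"
          using sin_cos_squared_add[of "\<omega> / 2"] unfolding k_def[symmetric]
          by (simp add: q_def k_def[symmetric]) algebra
        have nq: "k \<le> norm q" 
          using complex_Re_le_cmod[of "q * cis (- (\<omega> / 2))"] Rq by (simp add: norm_mult)
        have Nq: "norm q \<le> 1"
          unfolding q_def by (rule norm_triangle_le) (use u in \<open>simp add: norm_mult del: of_real_diff\<close>)
        have slitq: "\<zeta> \<notin> \<real>\<^sub>\<le>\<^sub>0"
        proof
          assume "\<zeta> \<in> \<real>\<^sub>\<le>\<^sub>0"
          then obtain r where r: "\<zeta> = of_real r" "r \<le> 0" by (auto elim: nonpos_Reals_cases)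
          have "Re (\<zeta> * cis (- (\<omega> / 2))) = \<epsilon> * k" using Rq by (simp add: zeta mult.assoc)
          moreover have "Re (\<zeta> * cis (- (\<omega> / 2))) = r * k" by (simp add: r k_def)
          moreover have "0 < \<epsilon> * k" using e k by simp
          ultimately show False using r k by (simp add: zero_less_mult_iff)
        qed
        have "Re \<zeta> \<le> 1"
        proof -
          have "Re \<zeta> \<le> \<epsilon> * norm q" using complex_Re_le_cmod[of \<zeta>] e by (simp add: zeta norm_mult)
          also have "\<dots> \<le> 1 * 1" using e Nq by (intro mult_mono) auto
          finally show ?thesis by simp
        qed
        then have re: "exp (Re \<zeta>) \<le> exp 1" by simp
        have "norm \<zeta> = norm q * \<epsilon>" using e by (simp add: zeta norm_mult)
        moreover have "norm (f \<zeta>) = exp (Re \<zeta>) * norm \<zeta> powr (- z)"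
          by (simp add: f_def norm_mult norm_powr_real_powr')
        ultimately have "norm (f \<zeta>) = exp (Re \<zeta>) * (norm q powr (- z) * \<epsilon> powr (- z))"
          by (simp add: powr_mult)
        also have "\<dots> \<le> exp 1 * (norm q powr (- z) * \<epsilon> powr (- z))"
          by (intro mult_right_mono re) auto
        also have "\<dots> \<le> exp 1 * (k powr (- \<bar>z\<bar>) * \<epsilon> powr (- z))"
          using powr_le_two_sided[OF k nq Nq, of "- z"] by (intro mult_left_mono mult_right_mono) auto
        finally show "\<zeta> \<notin> \<real>\<^sub>\<le>\<^sub>0 \<and> norm (f \<zeta>) \<le> exp 1 * (k powr (- \<bar>z\<bar>) * \<epsilon> powr (- z))"
          using slitq by simp
      qed
      also have "\<dots> \<le> (exp 1 * (k powr (- \<bar>z\<bar>) * \<epsilon> powr (- z))) * (2 * \<epsilon>)"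
      proof (rule mult_left_mono)
        have "norm (of_real \<epsilon> * cis \<omega> - of_real \<epsilon>) \<le> norm (of_real \<epsilon> * cis \<omega>) + norm (complex_of_real \<epsilon>)"
          by (rule norm_triangle_ineq4)
        then show "norm (of_real \<epsilon> * cis \<omega> - of_real \<epsilon>) \<le> 2 * \<epsilon>" using e by (simp add: norm_mult)
      qed simp
      finally show "norm (P (of_real (1 / R n) * cis \<omega>) - P (of_real (1 / R n)))
       \<le> (exp 1 * (k powr (- \<bar>z\<bar>) * (1 / R n) powr (- z))) * (2 / R n)" by (simp add: \<epsilon>_def)
    qed
    have "((\<lambda>t. (exp 1 * (k powr (- \<bar>z\<bar>) * (1 / t) powr (- z))) * (2 / t)) \<longlongrightarrow> 0) at_top"
      using z k by real_asymp
    then show "(\<lambda>n. (exp 1 * (k powr (- \<bar>z\<bar>) * (1 / R n) powr (- z))) * (2 / R n)) \<longlonglongrightarrow> 0"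
      by (rule filterlim_compose[OF _ Rtop])
  qed
  have d3: "(\<lambda>n. P (1 + of_real (1 / R n) * cis \<omega>)) \<longlonglongrightarrow> P 1"
  proof (rule isCont_tendsto_compose[of 1 P])
    show "isCont P 1" using P[of 1] by (auto intro: DERIV_isCont)
    have "((\<lambda>t. 1 + of_real (1 / t) * cis \<omega>) \<longlongrightarrow> 1 + of_real 0 * cis \<omega>) at_top"
      by (intro tendsto_intros tendsto_of_real) real_asymp
    then show "(\<lambda>n. 1 + of_real (1 / R n) * cis \<omega>) \<longlonglongrightarrow> 1"
      using filterlim_compose[OF _ Rtop] by fastforce
  qed
  have Pr: "Im (P (of_real (1 / R n))) = Im (P 1)" for n
  proof (rule Im_primitive_const[OF P])
    fix t :: real assume "0 < t"
    then have "f (of_real t) = of_real (exp t * t powr (- z))"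
      using powr_of_real[of t "- z"] by (simp add: f_def exp_of_real)
    then show "Im (f (of_real t)) = 0" by simp
  qed (use R in auto)
  have "(\<lambda>n. Im (P (of_real (R n) * cis \<omega>) - P (of_real (1 / R n) * cis \<omega>))) \<longlonglongrightarrow> pi * rGamma z"
    using tendsto_Im[OF l1] Im_integral_ray_from_0(2)[OF z] by simp
  moreover have "(\<lambda>n. Im (P (of_real (R n) * cis \<omega>) - P (of_real (1 / R n) * cis \<omega>))) \<longlonglongrightarrow> Im (LINT s:{0<..}|lborel. kernel 0 a z s)"
  proof -
    have "(\<lambda>n. Im ((P (of_real (R n) * cis \<omega>) - P (1 + of_real (R n) * cis \<omega>))
       + (P (1 + of_real (R n) * cis \<omega>) - P (1 + of_real (1 / R n) * cis \<omega>))
       + P (1 + of_real (1 / R n) * cis \<omega>)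
       - (P (of_real (1 / R n) * cis \<omega>) - P (of_real (1 / R n)))) - Im (P 1))
       \<longlonglongrightarrow> Im (0 + (LINT s:{0<..}|lborel. kernel 0 a z s) + P 1 - 0) - Im (P 1)"
      by (intro tendsto_diff tendsto_Im tendsto_add d1 d2 d3 l2 tendsto_const)
    then show ?thesis using Pr by simp
  qed
  ultimately show ?thesis using LIMSEQ_unique by blast
qed

text \<open>The derivative of \<open>exp \<lambda> * \<lambda>^(-z)\<close> is integrated along the
  ray. The boundary term at the starting point 1 is the real number \<open>- exp 1\<close>, which
  has no imaginary part.\<close>

lemma rGamma_ray_recurrence:
  assumes a: "0 < a" "a < 1"
  shows "Im (LINT s:{0<..}|lborel. kernel 0 a z s) = z * Im (LINT s:{0<..}|lborel. kernel 0 a (z + 1) s)"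
proof -
  define G where "G s = exp (ray s) * ray s powr (- of_real z)" for s
  define g where "g s = kernel 0 a z s - of_real z * kernel 0 a (z + 1) s" for s
  have dray: "(ray has_vector_derivative cis \<omega>) (at s)" for s
    unfolding ray_def[abs_def] by (auto intro!: derivative_eq_intros)
  have int: "set_integrable lborel {0<..} (\<lambda>s. of_real z * kernel 0 a (z + 1) s)"
    by (intro set_integrable_mult_right kernel_integrable a)
  have "((\<lambda>R. G R - G 0) \<longlongrightarrow> (LINT s:{0<..}|lborel. g s)) at_top"
  proof (rule half_line_FTC_at_top)
    fix s :: real assume s: "0 \<le> s"
    define f where "f \<zeta> = exp \<zeta> * \<zeta> powr (- of_real z)" for \<zeta> :: complex
    have "(f has_field_derivative exp (ray s) * ray s powr (- of_real z)
        + (- of_real z * ray s powr (- of_real z - 1)) * exp (ray s)) (at (ray s))"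
      unfolding f_def using ray_slit[OF s] by (auto intro!: derivative_eq_intros)
    from field_vector_diff_chain_at[OF dray this]
    have "(f \<circ> ray has_vector_derivative cis \<omega> * (exp (ray s) * ray s powr (- of_real z)
        + (- of_real z * ray s powr (- of_real z - 1)) * exp (ray s))) (at s)" .
    moreover have "f \<circ> ray = G" by (auto simp: f_def G_def)
    moreover have "cis \<omega> * (exp (ray s) * ray s powr (- of_real z)
        + (- of_real z * ray s powr (- of_real z - 1)) * exp (ray s)) = g s"
    proof -
      have e: "- of_real (z + 1) = - of_real z - (1 :: complex)" by simp
      show ?thesis unfolding g_def kernel_def e by (simp add: algebra_simps)
    qed
    ultimately show "(G has_vector_derivative g s) (at s)" by simp
  next
    show "continuous_on {0..} g"
      unfolding g_def by (intro continuous_intros continuous_on_kernel)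
    show "set_integrable lborel {0<..} g"
      unfolding g_def[abs_def] by (intro set_integral_diff kernel_integrable int a)
  qed
  moreover have "(G \<longlongrightarrow> 0) at_top"
  proof (rule Lim_null_comparison)
    show "\<forall>\<^sub>F s in at_top. norm (G s) \<le> kernel_bound 0 a z s"
      using eventually_ge_at_top[of 0]
    proof eventually_elim
      case (elim s)
      have "norm (G s) = norm (kernel 0 a z s)" by (simp add: G_def kernel_def norm_mult)
      then show ?case using norm_kernel_le[OF elim a, of 0 z] by simp
    qed
  qed (rule kernel_bound_tendsto_0, use a in auto)
  then have "((\<lambda>R. G R - G 0) \<longlongrightarrow> 0 - G 0) at_top" by (intro tendsto_diff tendsto_const)
  ultimately have "(LINT s:{0<..}|lborel. g s) = - G 0"
    using tendsto_unique[OF trivial_limit_at_top_linorder] by fastforce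
  also have "(LINT s:{0<..}|lborel. g s) = (LINT s:{0<..}|lborel. kernel 0 a z s) - of_real z * (LINT s:{0<..}|lborel. kernel 0 a (z + 1) s)"
    unfolding g_def by (subst set_integral_diff(2)[OF kernel_integrable[OF a] int]) simp
  also have "G 0 = of_real (exp 1)" using exp_of_real[of 1, where 'a=complex] by (simp add: G_def ray_def)
  finally have "Im ((LINT s:{0<..}|lborel. kernel 0 a z s) - of_real z * (LINT s:{0<..}|lborel. kernel 0 a (z + 1) s)) = Im (- of_real (exp 1))"
    by simp
  then show ?thesis by simp
qed

text \<open>In the recurrence at \<open>z = 0\<close> the integral of index 1 is multiplied by 0, so
  this index cannot be reached from below by recurrence. It is obtained as the limit of smaller
  indices.\<close>

lemma rGamma_ray_1:
  assumes a: "0 < a" "a < 1"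
  shows "Im (LINT s:{0<..}|lborel. kernel 0 a 1 s) = pi * rGamma 1"
proof -
  define z where "z n = 1 - 1 / real (Suc n)" for n
  have z: "0 \<le> z n" "z n < 1" for n by (auto simp: z_def field_simps)
  have zlim: "z \<longlonglongrightarrow> 1"
  proof -
    have "(\<lambda>n. 1 - inverse (real (Suc n))) \<longlonglongrightarrow> 1 - 0"
      by (intro tendsto_diff tendsto_const LIMSEQ_inverse_real_of_nat)
    then show ?thesis by (simp add: z_def[abs_def] divide_inverse)
  qed
  obtain C where C: "0 \<le> C" "\<And>s. 0 \<le> s \<Longrightarrow> kernel_bound 0 a 1 s \<le> C * exp (- ((- cos \<omega> / 2) * s))"
    using kernel_bound_exp[of 0 a 1] a by auto
  have bound: "norm (kernel 0 a (z n) s) \<le> C * exp (- ((- cos \<omega> / 2) * s))" if s: "0 < s" for n s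
  proof -
    have "norm (kernel 0 a (z n) s) \<le> kernel_bound 0 a (z n) s"
      using norm_kernel_le[OF less_imp_le[OF s] a, of 0 "z n"] by simp
    also have "\<dots> \<le> kernel_bound 0 a 1 s"
    proof -
      have "sin \<omega> powr (- \<bar>z n\<bar>) \<le> sin \<omega> powr (- \<bar>1\<bar>)"
        using sin_omega z[of n] by (intro powr_mono') auto
      moreover have "(1 + s) powr \<bar>z n\<bar> \<le> (1 + s) powr \<bar>1\<bar>"
        using s z[of n] by (intro powr_mono) auto
      ultimately show ?thesis unfolding kernel_bound_def by (intro mult_mono) auto
    qed
    finally show ?thesis using C(2)[of s] s by simp
  qed
  have "(\<lambda>n. LINT s|lborel. indicator {0<..} s *\<^sub>R kernel 0 a (z n) s) \<longlonglongrightarrow> (LINT s|lborel. indicator {0<..} s *\<^sub>R kernel 0 a 1 s)"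
  proof (rule integral_dominated_convergence)
    have "set_integrable lborel {0<..} (\<lambda>s. C * exp (- ((- cos \<omega> / 2) * s)))"
      by (rule set_integrable_exp_bound[of _ "- cos \<omega> / 2" C])
        (use cos_omega C(1) in \<open>auto intro!: continuous_intros simp: abs_mult\<close>)
    then show "integrable lborel (\<lambda>s. indicator {0<..} s *\<^sub>R (C * exp (- ((- cos \<omega> / 2) * s))))"
      by (simp add: set_integrable_def)
    show "AE s in lborel. (\<lambda>n. indicator {0<..} s *\<^sub>R kernel 0 a (z n) s) \<longlonglongrightarrow> indicator {0<..} s *\<^sub>R kernel 0 a 1 s"
    proof (rule AE_I2)
      fix s
      have "(\<lambda>n. kernel 0 a (z n) s) \<longlonglongrightarrow> kernel 0 a 1 s"
        unfolding kernel_def powr_def using ray_nonzero[of s] tendsto_of_real[OF zlim, where 'a=complex]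
        by (auto intro!: tendsto_eq_intros zlim)
      then show "(\<lambda>n. indicator {0<..} s *\<^sub>R kernel 0 a (z n) s) \<longlonglongrightarrow> indicator {0<..} s *\<^sub>R kernel 0 a 1 s"
        by (intro tendsto_scaleR tendsto_const)
    qed
    show "AE s in lborel. norm (indicator {0<..} s *\<^sub>R kernel 0 a (z n) s) \<le> indicator {0<..} s *\<^sub>R (C * exp (- ((- cos \<omega> / 2) * s)))" for n
      using bound[of _ n] by (intro AE_I2) (auto simp: indicator_def)
  qed (use kernel_integrable[OF a] in \<open>auto simp: set_integrable_def\<close>)
  then have "(\<lambda>n. Im (LINT s:{0<..}|lborel. kernel 0 a (z n) s)) \<longlonglongrightarrow> Im (LINT s:{0<..}|lborel. kernel 0 a 1 s)"
    unfolding set_lebesgue_integral_def by (rule tendsto_Im)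
  moreover have "(\<lambda>n. Im (LINT s:{0<..}|lborel. kernel 0 a (z n) s)) \<longlonglongrightarrow> pi * rGamma 1"
  proof -
    have "isCont rGamma (1::real)" by (rule continuous_on_interior[of UNIV]) (auto intro: continuous_on_rGamma)
    then have "(\<lambda>n. pi * rGamma (z n)) \<longlonglongrightarrow> pi * rGamma 1"
      using zlim by (intro tendsto_intros isCont_tendsto_compose[of 1 rGamma])
    then show ?thesis using rGamma_ray_less_1[OF z(2) a] by simp
  qed
  ultimately show ?thesis using LIMSEQ_unique by blast
qed

lemma rGamma_ray:
  assumes a: "0 < a" "a < 1"
  shows "Im (LINT s:{0<..}|lborel. kernel 0 a z s) = pi * rGamma z"
proof -
  have "\<forall>z. z < real n + 1 \<longrightarrow> Im (LINT s:{0<..}|lborel. kernel 0 a z s) = pi * rGamma z" for n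
  proof (induction n)
    case 0
    then show ?case using rGamma_ray_less_1[OF _ a] by simp
  next
    case (Suc n)
    show ?case
    proof (intro allI impI)
      fix z assume "z < real (Suc n) + 1"
      then have "Im (LINT s:{0<..}|lborel. kernel 0 a (z - 1) s) = pi * rGamma (z - 1)"
        using Suc.IH by simp
      moreover have "rGamma (z - 1) = (z - 1) * rGamma z" using rGamma_plus1[of "z - 1"] by simp
      ultimately have "(z - 1) * Im (LINT s:{0<..}|lborel. kernel 0 a z s) = (z - 1) * (pi * rGamma z)"
        using rGamma_ray_recurrence[OF a, of "z - 1"] by simp
      then show "Im (LINT s:{0<..}|lborel. kernel 0 a z s) = pi * rGamma z"
        using rGamma_ray_1[OF a] by (cases "z = 1") auto
    qed
  qed
  then show ?thesis using real_arch_simple[of z] by (metis add.commute less_add_one order_le_less_trans)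
qed

text \<open>The exponential series in \<open>- x * \<lambda>^a\<close> is integrated term by term,
  each factor \<open>\<lambda>^a\<close> lowering the index by \<open>a\<close>. The sums of the
  norms are dominated by an exponentially decaying function because \<open>a < 1\<close>. The
  conclusion uses \<open>sums\<close> since convergence of the Wright series is obtained together
  with its value.\<close>

lemma wright_sums_ray:
  assumes a: "0 < a" "a < 1"
  shows "(\<lambda>n. (- x) ^ n / fact n * rGamma (b - a * real n)) sums
    (Im (LINT s:{0<..}|lborel. kernel x a b s) / pi)"
proof -
  define f where "f n s = indicator {0<..} s *\<^sub>R (of_real ((- x) ^ n / fact n) * kernel 0 a (b - a * real n) s)" for n s
  have summand: "of_real ((- x) ^ n / fact n) * kernel 0 a (b - a * real n) s
    = (exp (ray s) * ray s powr (- of_real b) * cis \<omega>) * ((- (of_real x * ray s powr of_real a)) ^ n /\<^sub>R fact n)" for n s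
  proof -
    have "ray s powr (- of_real (b - a * real n)) = ray s powr (- of_real b) * (ray s powr of_real a) ^ n"
      using ray_nonzero[of s]
      by (simp add: powr_def exp_of_nat_mult[symmetric] exp_add[symmetric] algebra_simps)
    moreover have "(- (of_real x * ray s powr of_real a)) ^ n = of_real ((- x) ^ n) * (ray s powr of_real a) ^ n"
      by (simp add: power_mult_distrib[symmetric])
    ultimately show ?thesis by (simp add: kernel_def scaleR_conv_of_real field_simps)
  qed
  have sums: "(\<lambda>n. of_real ((- x) ^ n / fact n) * kernel 0 a (b - a * real n) s) sums kernel x a b s" for s
  proof -
    have "(\<lambda>n. (- (of_real x * ray s powr of_real a)) ^ n /\<^sub>R fact n) sums exp (- (of_real x * ray s powr of_real a))"
      by (rule exp_converges)
    then have "(\<lambda>n. (exp (ray s) * ray s powr (- of_real b) * cis \<omega>) * ((- (of_real x * ray s powr of_real a)) ^ n /\<^sub>R fact n))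
      sums ((exp (ray s) * ray s powr (- of_real b) * cis \<omega>) * exp (- (of_real x * ray s powr of_real a)))"
      by (rule sums_mult)
    also have "(exp (ray s) * ray s powr (- of_real b) * cis \<omega>) * exp (- (of_real x * ray s powr of_real a)) = kernel x a b s"
      by (simp add: kernel_def exp_diff exp_minus field_simps)
    finally show ?thesis unfolding summand .
  qed
  define B where "B s = exp (Re (ray s)) * norm (ray s) powr (- b)" for s
  have normterm: "norm (of_real ((- x) ^ n / fact n) * kernel 0 a (b - a * real n) s)
     = B s * ((\<bar>x\<bar> * norm (ray s) powr a) ^ n /\<^sub>R fact n)" for n s
    unfolding summand
    using norm_powr_real_powr'[of "- of_real b" "ray s"] norm_powr_real_powr'[of "of_real a" "ray s"]
    by (simp add: B_def norm_mult norm_power power_mult_distrib)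
  have normsums: "(\<lambda>n. norm (of_real ((- x) ^ n / fact n) * kernel 0 a (b - a * real n) s)) sums
     (B s * exp (\<bar>x\<bar> * norm (ray s) powr a))" for s
    unfolding normterm by (intro sums_mult exp_converges)
  obtain C where C: "0 \<le> C" "\<And>s. 0 \<le> s \<Longrightarrow> kernel_bound \<bar>x\<bar> a b s \<le> C * exp (- ((- cos \<omega> / 2) * s))"
    using kernel_bound_exp[of "\<bar>x\<bar>" a b] a by auto
  have Bbound: "B s * exp (\<bar>x\<bar> * norm (ray s) powr a) \<le> C * exp (- ((- cos \<omega> / 2) * s))" if s: "0 < s" for s
  proof -
    have "\<bar>x\<bar> * norm (ray s) powr a \<le> \<bar>x\<bar> * (1 + s) powr a"
      using norm_ray_le[of s] s a by (intro mult_left_mono powr_mono2) auto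
    then have "exp (Re (ray s)) * exp (\<bar>x\<bar> * norm (ray s) powr a) \<le> exp (1 + s * cos \<omega> + \<bar>x\<bar> * (1 + s) powr a)"
      by (simp add: Re_ray flip: exp_add)
    moreover have "norm (ray s) powr (- b) \<le> sin \<omega> powr (- \<bar>b\<bar>) * (1 + s) powr \<bar>b\<bar>"
      using powr_le_two_sided[OF sin_omega norm_ray_ge[of s] norm_ray_le[of s], of "- b"] s by simp
    ultimately have "(exp (Re (ray s)) * exp (\<bar>x\<bar> * norm (ray s) powr a)) * norm (ray s) powr (- b) \<le> kernel_bound \<bar>x\<bar> a b s"
      unfolding kernel_bound_def by (intro mult_mono) auto
    then show ?thesis using C(2)[of s] s by (simp add: B_def mult_ac)
  qed
  define D where "D s = indicator {0<..} s *\<^sub>R (C * exp (- ((- cos \<omega> / 2) * s)))" for s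
  have D: "integrable lborel D"
  proof -
    have "set_integrable lborel {0<..} (\<lambda>s. C * exp (- ((- cos \<omega> / 2) * s)))"
      by (rule set_integrable_exp_bound[of _ "- cos \<omega> / 2" C])
        (use cos_omega C(1) in \<open>auto intro!: continuous_intros simp: abs_mult\<close>)
    then show ?thesis by (simp add: set_integrable_def D_def[abs_def])
  qed
  have fint: "integrable lborel (f n)" for n
    using set_integrable_mult_right[OF kernel_integrable[OF a, of 0 "b - a * real n"], of "of_real ((- x) ^ n / fact n)"]
    unfolding set_integrable_def f_def[abs_def] by (simp only:)
  have fnorm: "(\<lambda>n. norm (f n s)) sums (indicator {0<..} s *\<^sub>R (B s * exp (\<bar>x\<bar> * norm (ray s) powr a)))" for s
    using normsums[of s] by (cases "0 < s") (simp_all add: f_def)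
  have "(\<lambda>n. integral\<^sup>L lborel (f n)) sums (LINT s|lborel. (\<Sum>n. f n s))"
  proof (rule sums_integral[OF fint])
    show "AE s in lborel. summable (\<lambda>n. norm (f n s))"
      using fnorm by (intro AE_I2) (auto simp: sums_iff)
    show "summable (\<lambda>n. LINT s|lborel. norm (f n s))"
    proof (rule summableI_nonneg_bounded[where x="integral\<^sup>L lborel D"])
      fix N
      have "(\<Sum>n<N. LINT s|lborel. norm (f n s)) = (LINT s|lborel. (\<Sum>n<N. norm (f n s)))"
        by (rule Bochner_Integration.integral_sum[symmetric]) (intro integrable_norm fint)
      also have "\<dots> \<le> integral\<^sup>L lborel D"
      proof (rule integral_mono)
        show "integrable lborel (\<lambda>s. \<Sum>n<N. norm (f n s))"
          by (intro Bochner_Integration.integrable_sum integrable_norm fint)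
        fix s
        have "(\<Sum>n<N. norm (f n s)) \<le> indicator {0<..} s *\<^sub>R (B s * exp (\<bar>x\<bar> * norm (ray s) powr a))"
          using sum_le_suminf[of "\<lambda>n. norm (f n s)" "{..<N}"] fnorm[of s] by (auto simp: sums_iff)
        also have "\<dots> \<le> D s" using Bbound[of s] by (simp add: D_def indicator_def)
        finally show "(\<Sum>n<N. norm (f n s)) \<le> D s" .
      qed (rule D)
      finally show "(\<Sum>n<N. LINT s|lborel. norm (f n s)) \<le> integral\<^sup>L lborel D" .
    qed simp
  qed
  moreover have "(\<Sum>n. f n s) = indicator {0<..} s *\<^sub>R kernel x a b s" for s
    using sums[of s] by (cases "0 < s") (simp_all add: f_def sums_iff)
  ultimately have "(\<lambda>n. integral\<^sup>L lborel (f n)) sums (LINT s:{0<..}|lborel. kernel x a b s)"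
    by (simp add: set_lebesgue_integral_def)
  then have "(\<lambda>n. Im (integral\<^sup>L lborel (f n))) sums Im (LINT s:{0<..}|lborel. kernel x a b s)"
    by (rule bounded_linear.sums[OF bounded_linear_Im])
  moreover have "Im (integral\<^sup>L lborel (f n)) = pi * ((- x) ^ n / fact n * rGamma (b - a * real n))" for n
  proof -
    have "integral\<^sup>L lborel (f n) = of_real ((- x) ^ n / fact n) * (LINT s:{0<..}|lborel. kernel 0 a (b - a * real n) s)"
    proof -
      have "integral\<^sup>L lborel (f n) = (LINT s:{0<..}|lborel. of_real ((- x) ^ n / fact n) * kernel 0 a (b - a * real n) s)"
        unfolding f_def[abs_def] set_lebesgue_integral_def ..
      then show ?thesis by (simp only: set_integral_mult_right)
    qed
    then have "Im (integral\<^sup>L lborel (f n)) = ((- x) ^ n / fact n) * Im (LINT s:{0<..}|lborel. kernel 0 a (b - a * real n) s)"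
      by (simp del: of_real_divide of_real_power of_real_mult of_real_minus)
    then show ?thesis by (simp add: rGamma_ray[OF a])
  qed
  ultimately have "(\<lambda>n. pi * ((- x) ^ n / fact n * rGamma (b - a * real n))) sums Im (LINT s:{0<..}|lborel. kernel x a b s)"
    by simp
  from sums_divide[OF this, of pi] show ?thesis by simp
qed

lemma wright_ray:
  assumes a: "0 < a" "a < 1"
  shows "wright (- a) b (- x) = Im (LINT s:{0<..}|lborel. kernel x a b s) / pi"
  using wright_sums_ray[OF a, of x b] by (simp add: wright_def sums_iff)

text \<open>If \<open>a * \<omega> < \<pi>/2\<close>, the powers \<open>\<lambda>^a\<close> on the
  ray have real parts bounded below by a positive constant, so Euler's integral applies with
  \<open>w = \<lambda>^a\<close>. The range of the argument keeps these powers on the principal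
  branch.\<close>

lemma Re_ray_powr:
  assumes a: "0 < a" "a * \<omega> < pi / 2" and s: "0 \<le> s"
  shows "sin \<omega> powr a * cos (a * \<omega>) \<le> Re (ray s powr of_real a)" and "0 < sin \<omega> powr a * cos (a * \<omega>)"
    and "Im (Ln (ray s)) \<in> {0..\<omega>}"
proof -
  define t where "t = Im (Ln (ray s))"
  have r: "ray s = of_real (norm (ray s)) * cis t"
    using ray_nonzero[of s] by (metis Ln_exp cis_conv_exp exp_Ln exp_eq_polar norm_exp_eq_Re t_def)
  have t1: "- pi < t" "t \<le> pi" using mpi_less_Im_Ln Im_Ln_le_pi ray_nonzero by (auto simp: t_def)
  have t0: "0 \<le> t"
    unfolding t_def using Im_Ln_pos_le[OF ray_nonzero[of s]] s sin_omega by (simp add: ray_def)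
  \<comment> \<open>The ray lies on one side of the direction \<open>cis \<omega>\<close>: rotated
    by \<open>- \<omega>\<close>, its points have imaginary part
    \<open>- sin \<omega>\<close>.\<close>
  have tw: "t \<le> \<omega>"
  proof (rule ccontr)
    assume c: "\<not> t \<le> \<omega>"
    have "Im (ray s * cis (- \<omega>)) = - sin \<omega>"
      by (simp add: ray_def algebra_simps)
    moreover have "ray s * cis (- \<omega>) = of_real (norm (ray s)) * cis (t - \<omega>)"
      by (subst r) (simp add: mult.assoc cis_mult)
    ultimately have "norm (ray s) * sin (t - \<omega>) = - sin \<omega>" by simp
    moreover have "0 \<le> norm (ray s) * sin (t - \<omega>)"
      using c t1 omega by (intro mult_nonneg_nonneg sin_ge_zero) auto
    ultimately show False using sin_omega by simp
  qed
  show "Im (Ln (ray s)) \<in> {0..\<omega>}" using t0 tw by (simp add: t_def)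
  have c0: "0 < cos (a * \<omega>)" using a omega pi_gt_zero by (intro cos_gt_zero_pi) (auto intro: less_trans[of _ 0])
  then show "0 < sin \<omega> powr a * cos (a * \<omega>)" using sin_omega by simp
  have "Re (ray s powr of_real a) = norm (ray s) powr a * cos (a * t)"
    using ray_nonzero[of s] by (simp add: powr_def Re_exp t_def)
  moreover have "sin \<omega> powr a * cos (a * \<omega>) \<le> norm (ray s) powr a * cos (a * t)"
  proof (rule mult_mono)
    show "sin \<omega> powr a \<le> norm (ray s) powr a" using a sin_omega norm_ray_ge[of s] by (intro powr_mono2) auto
    have "a * t \<le> a * \<omega>" using a tw by simp
    moreover have "a * \<omega> \<le> pi" using a pi_gt_zero by linarith
    ultimately show "cos (a * \<omega>) \<le> cos (a * t)" using a t0 by (intro cos_monotone_0_pi_le) auto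
  qed (use c0 in auto)
  ultimately show "sin \<omega> powr a * cos (a * \<omega>) \<le> Re (ray s powr of_real a)" by simp
qed

end

subsection \<open>Wright functions\<close>

lemma wright_summable:
  fixes a b y :: real
  assumes "0 < a" "a < 1"
  shows "summable (\<lambda>n. rGamma (b - a * real n) / fact n * y ^ n)"
proof -
  interpret tilted_ray "3 * pi / 4" by unfold_locales auto
  have "summable (\<lambda>n. (- (- y)) ^ n / fact n * rGamma (b - a * real n))"
    using wright_sums_ray[OF assms] by (rule sums_summable)
  then show ?thesis by (simp add: mult_ac)
qed

lemma wright_eq_suminf:
  fixes a b y :: real
  shows "wright (- a) b y = (\<Sum>n. rGamma (b - a * real n) / fact n * y ^ n)"
  by (simp add: wright_def mult_ac)

lemma wright_has_derivative:
  fixes a b x :: real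
  assumes "0 < a" "a < 1"
  shows "((\<lambda>x. wright (- a) b (- x)) has_real_derivative - wright (- a) (b - a) (- x)) (at x)"
proof -
  define c where "c n = rGamma (b - a * real n) / fact n" for n
  have "((\<lambda>y. \<Sum>n. c n * y ^ n) has_field_derivative (\<Sum>n. diffs c n * (- x) ^ n)) (at (- x))"
    using wright_summable[OF assms] unfolding c_def by (rule termdiffs_strong_converges_everywhere)
  moreover have "diffs c n = rGamma (b - a - a * real n) / fact n" for n
    by (simp add: diffs_def c_def field_simps del: of_nat_Suc) (simp add: algebra_simps)
  ultimately have "((\<lambda>y. wright (- a) b y) has_field_derivative wright (- a) (b - a) (- x)) (at (- x))"
    by (simp add: wright_eq_suminf c_def)
  from DERIV_chain2[OF this DERIV_minus[OF DERIV_ident]] show ?thesis by simp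
qed

lemma wright_0:
  fixes a b :: real
  shows "wright (- a) b 0 = rGamma b"
  unfolding wright_eq_suminf by (subst suminf_finite[of "{0}"]) auto

text \<open>In the Laplace picture, where \<open>\<lambda>\<^bsup>-\<beta>\<^esup> exp (- x \<lambda>\<^sup>\<alpha>)\<close> corresponds to the Wright function of
  index \<open>\<beta>\<close>, this is Euler's integral for \<open>(\<lambda>\<^sup>\<alpha>)\<^bsup>-c\<^esup>\<close>.\<close>

lemma wright_fractional_integral:
  fixes a b c x :: real
  assumes a: "0 < a" "a < 1" and c: "0 < c" and x: "0 < x"
  shows "set_integrable lborel {0<..} (\<lambda>z. z powr (c - 1) * wright (- a) b (- (x + z)))"
    and "(LINT z:{0<..}|lborel. z powr (c - 1) * wright (- a) b (- (x + z))) = Gamma c * wright (- a) (b + a * c) (- x)"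
proof -
  \<comment> \<open>\<open>a < 1\<close> leaves room for an angle beyond \<open>\<pi>/2\<close> with
    \<open>a * \<omega> < \<pi>/2\<close>.\<close>
  have "pi / 2 < pi / (2 * a)" using a by (simp add: field_simps)
  then have "pi / 2 < min pi (pi / (2 * a))" using pi_gt_zero by simp
  then obtain \<omega> where om: "pi / 2 < \<omega>" "\<omega> < pi" "\<omega> < pi / (2 * a)"
    using dense[of "pi / 2" "min pi (pi / (2 * a))"] by auto
  have aom: "a * \<omega> < pi / 2" using a om by (simp add: field_simps)
  interpret tilted_ray \<omega> by unfold_locales (use om in auto)
  define \<mu> where "\<mu> = sin \<omega> powr a * cos (a * \<omega>)"
  have mu: "0 < \<mu>" unfolding \<mu>_def using Re_ray_powr(2)[OF a(1) aom, of 0] by simp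
  have Rew: "\<mu> \<le> Re (ray s powr of_real a)" if "0 < s" for s
    unfolding \<mu>_def using Re_ray_powr(1)[OF a(1) aom, of s] that by simp
  define k where "k s = indicator {0<..} s *\<^sub>R kernel x a b s" for s
  define rp where "rp s = indicator {0<..} s *\<^sub>R (ray s powr of_real a)" for s
  define q where "q z = indicator {0<..} z *\<^sub>R complex_of_real (z powr (c - 1))" for z
  define F where "F s z = k s * (q z * exp (- (of_real z * rp s)))" for s z
  have kint: "integrable lborel k"
    using kernel_integrable[OF a, of x b] unfolding k_def[abs_def] set_integrable_def .
  have [measurable]: "k \<in> borel_measurable borel" using kint by auto
  have [measurable]: "rp \<in> borel_measurable borel"
    unfolding rp_def[abs_def]
    by (rule borel_measurable_continuous_on_indicator)
      (use ray_slit ray_nonzero in \<open>auto simp: complex_nonpos_Reals_iff intro!: continuous_intros\<close>)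
  have [measurable]: "q \<in> borel_measurable borel"
    unfolding q_def[abs_def]
    by (rule borel_measurable_continuous_on_indicator) (auto intro!: continuous_intros)
  define g where "g z = indicator {0<..} z *\<^sub>R (z powr (c - 1) * exp (- (\<mu> * z)))" for z
  have gint: "integrable lborel g"
    using set_integrable_gamma[OF c mu] unfolding g_def[abs_def] set_integrable_def .
  \<comment> \<open>The lower bound \<open>\<mu>\<close> for the real part of
    \<open>\<lambda>^a\<close> is uniform along the ray, so the integrand is dominated by a product
    of two integrable functions and Fubini's theorem applies.\<close>
  have bound: "norm (F s z) \<le> norm (k s) * g z" for s z
  proof (cases "0 < s \<and> 0 < z")
    case True
    have "exp (- (z * Re (ray s powr of_real a))) \<le> exp (- (\<mu> * z))"
      using Rew[of s] True by (simp add: mult.commute)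
    then show ?thesis using True
      by (simp add: F_def norm_mult q_def g_def rp_def mult_left_mono)
  qed (auto simp: F_def k_def q_def g_def)
  have Fz: "integrable lborel (\<lambda>z. F s z)" for s
  proof (rule Bochner_Integration.integrable_bound)
    show "integrable lborel (\<lambda>z. norm (k s) * g z)" using gint by simp
    show "AE z in lborel. norm (F s z) \<le> norm (norm (k s) * g z)"
      using bound by (auto intro: order_trans[OF _ abs_ge_self])
    show "F s \<in> borel_measurable lborel" unfolding F_def[abs_def] by measurable
  qed
  have Fint: "integrable (lborel \<Otimes>\<^sub>M lborel) (\<lambda>(s, z). F s z)"
  proof (rule lborel_pair.Fubini_integrable)
    show "(\<lambda>(s, z). F s z) \<in> borel_measurable (lborel \<Otimes>\<^sub>M lborel)"
      unfolding F_def by measurable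
    show "integrable lborel (\<lambda>s. LINT z|lborel. norm (case (s, z) of (s, z) \<Rightarrow> F s z))"
    proof (rule Bochner_Integration.integrable_bound)
      show "integrable lborel (\<lambda>s. norm (k s) * integral\<^sup>L lborel g)" using kint by simp
      show "(\<lambda>s. LINT z|lborel. norm (case (s, z) of (s, z) \<Rightarrow> F s z)) \<in> borel_measurable lborel"
        unfolding F_def by measurable
      show "AE s in lborel. norm (LINT z|lborel. norm (case (s, z) of (s, z) \<Rightarrow> F s z)) \<le> norm (norm (k s) * integral\<^sup>L lborel g)"
      proof (rule AE_I2)
        fix s
        have "(LINT z|lborel. norm (F s z)) \<le> (LINT z|lborel. norm (k s) * g z)"
          by (rule integral_mono) (use Fz gint bound in auto)
        then show "norm (LINT z|lborel. norm (case (s, z) of (s, z) \<Rightarrow> F s z)) \<le> norm (norm (k s) * integral\<^sup>L lborel g)"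
          by (simp add: abs_of_nonneg)
      qed
    qed
    show "AE s in lborel. integrable lborel (\<lambda>z. case (s, z) of (s, z) \<Rightarrow> F s z)" using Fz by simp
  qed
  have inner_s: "(LINT s|lborel. F s z) = indicator {0<..} z *\<^sub>R (of_real (z powr (c - 1)) * (LINT s:{0<..}|lborel. kernel (x + z) a b s))" for z
  proof -
    have "F s z = q z * (indicator {0<..} s *\<^sub>R kernel (x + z) a b s)" for s
      by (cases "0 < s") (auto simp: F_def k_def rp_def kernel_def exp_diff exp_minus exp_add ring_distribs field_simps)
    then have "(LINT s|lborel. F s z) = (LINT s|lborel. q z * (indicator {0<..} s *\<^sub>R kernel (x + z) a b s))"
      by (intro Bochner_Integration.integral_cong refl)
    also have "\<dots> = q z * (LINT s:{0<..}|lborel. kernel (x + z) a b s)"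
      unfolding set_lebesgue_integral_def by (rule integral_mult_right_zero)
    finally have "(LINT s|lborel. F s z) = q z * (LINT s:{0<..}|lborel. kernel (x + z) a b s)" .
    then show ?thesis by (simp add: q_def)
  qed
  have inner_z: "(LINT z|lborel. F s z) = indicator {0<..} s *\<^sub>R (of_real (Gamma c) * kernel x a (b + a * c) s)" for s
  proof (cases "0 < s")
    case True
    define w where "w = ray s powr of_real a"
    have w: "0 < Re w" using Rew[OF True] mu by (simp add: w_def)
    have "(LINT z|lborel. F s z) = (LINT z|lborel. kernel x a b s * (indicator {0<..} z *\<^sub>R (of_real (z powr (c - 1)) * exp (- (of_real z * w)))))"
      using True by (intro Bochner_Integration.integral_cong) (auto simp: F_def k_def q_def rp_def w_def)
    also have "\<dots> = kernel x a b s * (LINT z:{0<..}|lborel. of_real (z powr (c - 1)) * exp (- (of_real z * w)))"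
      unfolding set_lebesgue_integral_def by (rule integral_mult_right_zero)
    also have "\<dots> = of_real (Gamma c) * (kernel x a b s * w powr (- of_real c))"
      by (simp add: Gamma_integral_rotated(2)[OF c w])
    \<comment> \<open>Powers compose only on the principal branch: the argument of
      \<open>\<lambda>^a\<close> is \<open>a\<close> times that of \<open>\<lambda>\<close> and
      stays below \<open>\<pi>/2\<close>.\<close>
    also have "w powr (- of_real c) = ray s powr (- of_real (a * c))"
    proof -
      have "Im (Ln (ray s)) \<in> {0..\<omega>}" by (rule Re_ray_powr(3)[OF a(1) aom]) (use True in simp)
      then have "0 \<le> a * Im (Ln (ray s))" "a * Im (Ln (ray s)) \<le> a * \<omega>" using a by auto
      then have "- pi < a * Im (Ln (ray s))" "a * Im (Ln (ray s)) \<le> pi" using aom pi_gt_zero by linarith+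
      then have "Ln w = of_real a * Ln (ray s)"
        unfolding w_def powr_def using ray_nonzero[of s] by (simp add: Ln_exp)
      then show ?thesis using w ray_nonzero[of s] by (auto simp: powr_def mult_ac)
    qed
    also have "kernel x a b s * ray s powr (- of_real (a * c)) = kernel x a (b + a * c) s"
    proof -
      have "ray s powr (- of_real (b + a * c)) = ray s powr (- of_real b) * ray s powr (- of_real (a * c))"
        using ray_nonzero[of s] by (simp add: powr_def exp_add[symmetric] algebra_simps)
      then show ?thesis unfolding kernel_def by (simp only: mult_ac)
    qed
    finally show ?thesis using True by simp
  qed (simp add: F_def k_def)
  have Sint: "integrable lborel (\<lambda>z. LINT s|lborel. F s z)"
    by (rule lborel_pair.integrable_snd[OF Fint])
  have Imz: "Im (LINT s|lborel. F s z) = pi * (indicator {0<..} z *\<^sub>R (z powr (c - 1) * wright (- a) b (- (x + z))))" for z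
    unfolding inner_s using wright_ray[OF a, of b "x + z"] by simp
  have "integrable lborel (\<lambda>z. Im (LINT s|lborel. F s z))"
    using Sint by (rule integrable_bounded_linear[OF bounded_linear_Im])
  then have "integrable lborel (\<lambda>z. pi * (indicator {0<..} z *\<^sub>R (z powr (c - 1) * wright (- a) b (- (x + z)))))"
    by (simp only: Imz)
  then have "integrable lborel (\<lambda>z. (1 / pi) * (pi * (indicator {0<..} z *\<^sub>R (z powr (c - 1) * wright (- a) b (- (x + z))))))"
    by (rule integrable_mult_right)
  then show "set_integrable lborel {0<..} (\<lambda>z. z powr (c - 1) * wright (- a) b (- (x + z)))"
    unfolding set_integrable_def by simp
  have "(LINT z|lborel. (LINT s|lborel. F s z)) = (LINT s|lborel. (LINT z|lborel. F s z))"
    by (rule lborel_pair.Fubini_integral[OF Fint])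
  also have "\<dots> = (LINT s:{0<..}|lborel. of_real (Gamma c) * kernel x a (b + a * c) s)"
    by (simp only: inner_z set_lebesgue_integral_def)
  also have "\<dots> = of_real (Gamma c) * (LINT s:{0<..}|lborel. kernel x a (b + a * c) s)" by (rule set_integral_mult_right)
  finally have "Im (LINT z|lborel. (LINT s|lborel. F s z)) = Gamma c * Im (LINT s:{0<..}|lborel. kernel x a (b + a * c) s)"
    by simp
  moreover have "Im (LINT z|lborel. (LINT s|lborel. F s z)) = (LINT z|lborel. Im (LINT s|lborel. F s z))"
    by (rule integral_bounded_linear[OF bounded_linear_Im Sint, symmetric])
  moreover have "\<dots> = pi * (LINT z:{0<..}|lborel. z powr (c - 1) * wright (- a) b (- (x + z)))"
    unfolding Imz set_lebesgue_integral_def by (rule integral_mult_right_zero)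
  ultimately show "(LINT z:{0<..}|lborel. z powr (c - 1) * wright (- a) b (- (x + z))) = Gamma c * wright (- a) (b + a * c) (- x)"
    by (simp add: wright_ray[OF a] field_simps)
qed

section \<open>Parametrisation of Kanter's curve and the integral along it\<close>

lemma decreasing_inverse:
  fixes T T' :: "real \<Rightarrow> real"
  assumes lu: "l < u"
    and T: "\<And>\<theta>. \<theta> \<in> {l<..<u} \<Longrightarrow> (T has_real_derivative T' \<theta>) (at \<theta>)"
    and T': "\<And>\<theta>. \<theta> \<in> {l<..<u} \<Longrightarrow> T' \<theta> < 0"
    and top: "filterlim T at_top (at_right l)" and zero: "(T \<longlongrightarrow> 0) (at_left u)"
  obtains \<tau> where "\<And>t. 0 < t \<Longrightarrow> \<tau> t \<in> {l<..<u}" "\<And>t. 0 < t \<Longrightarrow> T (\<tau> t) = t"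
    "\<And>\<theta>. \<theta> \<in> {l<..<u} \<Longrightarrow> \<tau> (T \<theta>) = \<theta>"
    "\<And>\<theta>. \<theta> \<in> {l<..<u} \<Longrightarrow> 0 < T \<theta>"
    "\<And>t. 0 < t \<Longrightarrow> (\<tau> has_real_derivative inverse (T' (\<tau> t))) (at t)"
    "(\<tau> \<longlongrightarrow> l) at_top" "(\<tau> \<longlongrightarrow> u) (at_right 0)"
proof -
  have dec: "T y < T x" if "x \<in> {l<..<u}" "y \<in> {l<..<u}" "x < y" for x y
  proof (rule DERIV_neg_imp_decreasing[OF that(3)])
    fix z assume "x \<le> z" "z \<le> y"
    then have "z \<in> {l<..<u}" using that by auto
    then show "\<exists>d. (T has_real_derivative d) (at z) \<and> d < 0" using T T' by blast
  qed
  have pos: "0 < T x" if x: "x \<in> {l<..<u}" for x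
  proof -
    define y where "y = (x + u) / 2"
    have y: "y \<in> {l<..<u}" "x < y" using x by (auto simp: y_def)
    have "\<forall>\<^sub>F z in at_left u. T z \<le> T y"
      using eventually_at_left_real[of y u] y
      by (auto elim!: eventually_mono intro!: less_imp_le dec)
    then have "0 \<le> T y" by (rule tendsto_upperbound[OF zero]) (auto simp: trivial_limit_at_left_real)
    then show ?thesis using dec[OF x y] by simp
  qed
  have ex: "\<exists>\<theta>. \<theta> \<in> {l<..<u} \<and> T \<theta> = t" if t: "0 < t" for t
  proof -
    have "eventually (\<lambda>\<theta>. t < T \<theta>) (at_right l)" using top by (simp add: filterlim_at_top_dense)
    moreover have "eventually (\<lambda>\<theta>. \<theta> \<in> {l<..<u}) (at_right l)" by (rule eventually_at_right_real[OF lu])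
    ultimately have "eventually (\<lambda>\<theta>. t < T \<theta> \<and> \<theta> \<in> {l<..<u}) (at_right l)" by eventually_elim auto
    then obtain p where p: "t < T p" "p \<in> {l<..<u}" using eventually_happens[of _ "at_right l"] by auto
    have "eventually (\<lambda>\<theta>. T \<theta> < t) (at_left u)" by (rule order_tendstoD(2)[OF zero t])
    moreover have "eventually (\<lambda>\<theta>. \<theta> \<in> {l<..<u}) (at_left u)" by (rule eventually_at_left_real[OF lu])
    ultimately have "eventually (\<lambda>\<theta>. T \<theta> < t \<and> \<theta> \<in> {l<..<u}) (at_left u)" by eventually_elim auto
    then obtain q where q: "T q < t" "q \<in> {l<..<u}" using eventually_happens[of _ "at_left u"] by auto
    have "\<not> q < p" using dec[OF q(2) p(2)] p q by linarith
    moreover have "p \<noteq> q" using p q by auto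
    ultimately have "p < q" by linarith
    have "\<exists>x\<ge>p. x \<le> q \<and> T x = t"
    proof (rule IVT2)
      show "\<forall>x. p \<le> x \<and> x \<le> q \<longrightarrow> isCont T x"
        using p q by (auto intro: DERIV_isCont[OF T])
    qed (use p q \<open>p < q\<close> in auto)
    then obtain x where "p \<le> x" "x \<le> q" "T x = t" by blast
    then show ?thesis using p q by (intro exI[of _ x]) auto
  qed
  define \<tau> where "\<tau> t = (SOME \<theta>. \<theta> \<in> {l<..<u} \<and> T \<theta> = t)" for t
  have \<tau>: "\<tau> t \<in> {l<..<u}" "T (\<tau> t) = t" if "0 < t" for t
    using someI_ex[OF ex[OF that]] by (auto simp: \<tau>_def)
  have \<tau>T: "\<tau> (T \<theta>) = \<theta>" if th: "\<theta> \<in> {l<..<u}" for \<theta>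
  proof -
    have "\<tau> (T \<theta>) \<in> {l<..<u}" "T (\<tau> (T \<theta>)) = T \<theta>" using \<tau>[OF pos[OF th]] by auto
    then show ?thesis using dec[of \<theta> "\<tau> (T \<theta>)"] dec[of "\<tau> (T \<theta>)" \<theta>] th by (metis less_irrefl linorder_cases)
  qed
  have der: "(\<tau> has_real_derivative inverse (T' (\<tau> t))) (at t)" if t: "0 < t" for t
  proof (rule DERIV_inverse_function[where a=0 and b="t + 1" and f=T])
    show "(T has_real_derivative T' (\<tau> t)) (at (\<tau> t))" by (rule T[OF \<tau>(1)[OF t]])
    show "T' (\<tau> t) \<noteq> 0" using T'[OF \<tau>(1)[OF t]] by simp
    define p q where "p = (l + \<tau> t) / 2" and "q = (\<tau> t + u) / 2"
    have "l < p" "p < \<tau> t" "\<tau> t < q" "q < u" using \<tau>(1)[OF t] by (auto simp: p_def q_def)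
    note pq = this
    have "isCont \<tau> (T (\<tau> t))"
    proof (rule isCont_inverse_function2[OF pq(2,3)])
      fix z assume "p \<le> z" "z \<le> q"
      then have z: "z \<in> {l<..<u}" using pq by auto
      show "\<tau> (T z) = z" by (rule \<tau>T[OF z])
      show "isCont T z" by (rule DERIV_isCont[OF T[OF z]])
    qed
    then show "isCont \<tau> t" using \<tau>(2)[OF t] by simp
  qed (use t \<tau> in auto)
  have mono: "\<tau> t < e" if "e \<in> {l<..<u}" "T e < t" for t e
  proof (rule ccontr)
    assume "\<not> \<tau> t < e"
    moreover have "0 < t" using pos[OF that(1)] that by simp
    ultimately show False using \<tau>[of t] dec[of e "\<tau> t"] that by (cases "e = \<tau> t") auto
  qed
  have mono': "e < \<tau> t" if "e \<in> {l<..<u}" "0 < t" "t < T e" for t e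
  proof (rule ccontr)
    assume "\<not> e < \<tau> t"
    then show False using \<tau>[of t] dec[of "\<tau> t" e] that by (cases "e = \<tau> t") auto
  qed
  have lim1: "(\<tau> \<longlongrightarrow> l) at_top"
  proof (rule order_tendstoI)
    fix e assume e: "e < l"
    show "\<forall>\<^sub>F t in at_top. e < \<tau> t"
      using eventually_gt_at_top[of "0::real"] by eventually_elim (use \<tau>(1) e in fastforce)
  next
    fix e assume e: "l < e"
    define e' where "e' = (l + min e u) / 2"
    have e': "e' \<in> {l<..<u}" "e' < e" using e lu by (auto simp: e'_def min_def)
    show "\<forall>\<^sub>F t in at_top. \<tau> t < e"
      using eventually_gt_at_top[of "T e'"] by eventually_elim (use mono e' in force)
  qed
  have lim2: "(\<tau> \<longlongrightarrow> u) (at_right 0)"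
  proof (rule order_tendstoI)
    fix e assume "u < e"
    then have "\<tau> t < e" if "0 < t" for t using \<tau>(1)[OF that] by auto
    then show "\<forall>\<^sub>F t in at_right 0. \<tau> t < e" by (auto simp: eventually_at_right_field intro: exI[of _ 1])
  next
    fix e assume e: "e < u"
    define e' where "e' = (max e l + u) / 2"
    have e': "e' \<in> {l<..<u}" "e < e'" using e lu by (auto simp: e'_def max_def)
    have "e < \<tau> t" if "0 < t" "t < T e'" for t using mono'[OF e'(1) that] e' by simp
    then show "\<forall>\<^sub>F t in at_right 0. e < \<tau> t"
      using pos[OF e'(1)] by (auto simp: eventually_at_right_field intro!: exI[of _ "T e'"])
  qed
  show ?thesis by (rule that[OF \<tau> \<tau>T pos der lim1 lim2])
qed

text \<open>For fixed \<open>x\<close> every \<open>y > 0\<close> thus determines one angle by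
  \<open>x / y = kanter_t\<close>, and \<open>y\<close> can serve as parameter. Small
  \<open>y\<close> belongs to angles near 0, where the curve meets the positive axis, and large
  \<open>y\<close> to angles near \<open>\<pi>\<close>.\<close>

lemma kanter_t_inverse:
  fixes a \<beta> :: real
  assumes a: "0 < a" "a < 1" and \<beta>: "\<beta> = 0 \<or> \<beta> = a"
  obtains \<tau> \<tau>' where "\<And>t. 0 < t \<Longrightarrow> \<tau> t \<in> {0<..<pi}" "\<And>t. 0 < t \<Longrightarrow> kanter_t \<beta> a (\<tau> t) = t"
    "\<And>t. 0 < t \<Longrightarrow> (\<tau> has_real_derivative \<tau>' t) (at t)"
    "(\<tau> \<longlongrightarrow> 0) at_top" "(\<tau> \<longlongrightarrow> pi) (at_right 0)"
proof -
  have "\<exists>t'. \<forall>\<theta>\<in>{0<..<pi}. (kanter_t \<beta> a has_real_derivative t' \<theta>) (at \<theta>) \<and> t' \<theta> < 0"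
  proof (cases "\<beta> = 0")
    case True
    have "\<forall>\<theta>\<in>{0<..<pi}. \<exists>d. (kanter_t 0 a has_real_derivative d) (at \<theta>) \<and> d < 0"
    proof
      fix \<theta> :: real assume "\<theta> \<in> {0<..<pi}"
      then have th: "0 < \<theta>" "\<theta> < pi" by auto
      show "\<exists>d. (kanter_t 0 a has_real_derivative d) (at \<theta>) \<and> d < 0"
        by (rule DERIV_kanter_t_0[OF a th]) blast
    qed
    then show ?thesis unfolding True by (rule bchoice)
  next
    case False
    then have "\<beta> = a" using \<beta> by simp
    show ?thesis unfolding \<open>\<beta> = a\<close> by (rule kanter_convex_a[OF a]) blast
  qed
  then obtain t' where t': "\<And>\<theta>. \<theta> \<in> {0<..<pi} \<Longrightarrow> (kanter_t \<beta> a has_real_derivative t' \<theta>) (at \<theta>)"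
    "\<And>\<theta>. \<theta> \<in> {0<..<pi} \<Longrightarrow> t' \<theta> < 0" by blast
  have s: "0 < sin (a * pi)" "0 < sin ((1 - a) * pi)" using a by (auto intro!: sin_gt_zero)
  have top: "filterlim (kanter_t \<beta> a) at_top (at_right 0)"
  proof (cases "\<beta> = 0")
    case True
    have "filterlim (\<lambda>\<theta>. sin \<theta> powr a / sin (a * \<theta>)) at_top (at_right 0)" using a by real_asymp
    then show ?thesis using True by (simp add: kanter_t_def[abs_def])
  next
    case False
    have "filterlim (\<lambda>\<theta>. sin \<theta> / (sin (a * \<theta>) * sin ((1 - a) * \<theta>))) at_top (at_right 0)" using a by real_asymp
    then show ?thesis using False by (simp add: kanter_t_def[abs_def])
  qed
  have zero: "(kanter_t \<beta> a \<longlongrightarrow> 0) (at_left pi)"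
  proof (cases "\<beta> = 0")
    case True
    have "((\<lambda>\<theta>. sin \<theta> powr a / sin (a * \<theta>)) \<longlongrightarrow> sin pi powr a / sin (a * pi)) (at_left pi)"
      using s a by (intro tendsto_intros tendsto_powr') 
        (auto simp: eventually_at_left_field intro!: exI[of _ 0] sin_ge_zero)
    then show ?thesis using True by (simp add: kanter_t_def[abs_def])
  next
    case False
    have "((\<lambda>\<theta>. sin \<theta> / (sin (a * \<theta>) * sin ((1 - a) * \<theta>))) \<longlongrightarrow> sin pi / (sin (a * pi) * sin ((1 - a) * pi))) (at_left pi)"
      using s a by (intro tendsto_intros) auto
    then show ?thesis using False by (simp add: kanter_t_def[abs_def])
  qed
  show ?thesis
  proof (rule decreasing_inverse[OF pi_gt_zero t' top zero])
    fix \<tau>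
    assume "\<And>t. 0 < t \<Longrightarrow> \<tau> t \<in> {0<..<pi}" "\<And>t. 0 < t \<Longrightarrow> kanter_t \<beta> a (\<tau> t) = t"
      "\<And>t. 0 < t \<Longrightarrow> (\<tau> has_real_derivative inverse (t' (\<tau> t))) (at t)"
      "(\<tau> \<longlongrightarrow> 0) at_top" "(\<tau> \<longlongrightarrow> pi) (at_right 0)"
    then show thesis by (rule that)
  qed
qed

text \<open>On Kanter's curve \<open>\<Lambda>\<close> the exponent \<open>\<lambda> - x \<lambda>\<^sup>a\<close> is real, and the imaginary part of
  \<open>\<Lambda>\<^bsup>1-\<beta>\<^esup>\<close> is \<open>y\<^bsup>(1-\<beta>)/(1-a)\<^esup>\<close>.\<close>

lemma wright_kanter:
  fixes a \<beta> x :: real and \<tau> \<tau>' :: "real \<Rightarrow> real"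
  assumes a: "0 < a" "a < 1" and \<beta>: "\<beta> = 0 \<or> \<beta> = a" and x: "0 < x"
    and \<tau>: "\<And>t. 0 < t \<Longrightarrow> \<tau> t \<in> {0<..<pi}" "\<And>t. 0 < t \<Longrightarrow> kanter_t \<beta> a (\<tau> t) = t"
    and d\<tau>: "\<And>t. 0 < t \<Longrightarrow> (\<tau> has_real_derivative \<tau>' t) (at t)"
    and \<tau>_top: "(\<tau> \<longlongrightarrow> 0) at_top" and \<tau>_0: "(\<tau> \<longlongrightarrow> pi) (at_right 0)"
  defines "w \<equiv> \<lambda>y. 1 / (1 - a) * y powr ((1 - \<beta>) / (1 - a) - 1)
      * exp (- ((y * kanter_n \<beta> a (\<tau> (x / y))) powr (1 / (1 - a))))"
  shows "continuous_on {0<..} w" and "\<And>y. 0 < y \<Longrightarrow> 0 < w y"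
    and "set_integrable lborel {0<..} w"
    and "(LINT y:{0<..}|lborel. w y) = pi * wright (- a) \<beta> (- x)"
proof -
  define \<gamma> where "\<gamma> = 1 / (1 - a)"
  define \<delta> where "\<delta> = (1 - \<beta>) / (1 - a)"
  have g: "1 < \<gamma>" "\<gamma> * (1 - a) = 1" "a * \<gamma> = \<gamma> - 1" using a by (auto simp: \<gamma>_def field_simps)
  have b: "0 \<le> \<beta>" "\<beta> < 1" using \<beta> a by auto
  have del: "\<delta> = \<gamma> * (1 - \<beta>)" by (simp add: \<delta>_def \<gamma>_def)
  define \<theta> where "\<theta> y = \<tau> (x / y)" for y
  \<comment> \<open>The radius solves
    \<open>R * sin \<theta> = x * R^a * sin (a * \<theta>)\<close>, which is the vanishing of the
    imaginary part of the exponent.\<close>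
  define R where "R y = (x * sin (a * \<theta> y) / sin (\<theta> y)) powr \<gamma>" for y
  define \<Lambda> where "\<Lambda> y = of_real (R y) * cis (\<theta> y)" for y
  have th: "0 < \<theta> y" "\<theta> y < pi" if "0 < y" for y
    using \<tau>(1)[of "x / y"] x that by (auto simp: \<theta>_def)
  have kt: "kanter_t \<beta> a (\<theta> y) = x / y" if "0 < y" for y
    using \<tau>(2)[of "x / y"] x that by (auto simp: \<theta>_def)
  have sp: "0 < sin (a * \<theta> y)" "0 < sin ((1 - a) * \<theta> y)" "0 < sin (\<theta> y)" if "0 < y" for y
    using sin_mult_pos[of a "\<theta> y"] sin_mult_pos[of "1 - a" "\<theta> y"] sin_gt_zero[of "\<theta> y"] a th[OF that] by auto
  have R0: "0 < R y" if "0 < y" for y using sp[OF that] x by (simp add: R_def)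
  have slit: "\<Lambda> y \<notin> \<real>\<^sub>\<le>\<^sub>0" if "0 < y" for y
    using R0[OF that] sp[OF that] by (auto simp: \<Lambda>_def complex_nonpos_Reals_iff)
  have nz: "\<Lambda> y \<noteq> 0" if "0 < y" for y using R0[OF that] by (simp add: \<Lambda>_def)
  have lam_powr: "\<Lambda> y powr of_real r = of_real (R y powr r) * cis (r * \<theta> y)" if "0 < y" for y r
  proof -
    have "Ln (\<Lambda> y) = of_real (ln (R y)) + \<i> * of_real (\<theta> y)"
      using R0[OF that] th[OF that] unfolding \<Lambda>_def by (subst Ln_times_of_real) (auto simp: cis_conv_exp Ln_exp Ln_of_real)
    then show ?thesis using nz[OF that] R0[OF that]
      by (simp add: powr_def ring_distribs exp_add cis_conv_exp mult_ac flip: exp_of_real)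
  qed
  have R1a: "R y powr (1 - a) = x * sin (a * \<theta> y) / sin (\<theta> y)" if "0 < y" for y
    using sp[OF that] x g(2) by (simp add: R_def powr_powr)
  have R_split: "R y = x * R y powr a * sin (a * \<theta> y) / sin (\<theta> y)" if "0 < y" for y
  proof -
    have "R y = R y powr (a + (1 - a))" using R0[OF that] by simp
    also have "\<dots> = R y powr a * R y powr (1 - a)" by (rule powr_add)
    finally show ?thesis by (simp add: R1a[OF that] mult_ac)
  qed
  define E where "E y = (y * kanter_n \<beta> a (\<theta> y)) powr \<gamma>" for y
  have expo: "\<Lambda> y - of_real x * \<Lambda> y powr of_real a = of_real (- E y)" if y: "0 < y" for y
  proof -
    define A where "A = a * \<theta> y"
    define C where "C = (1 - a) * \<theta> y"
    have s: "0 < sin A" "0 < sin C" "0 < sin (\<theta> y)" using sp[OF y] by (auto simp: A_def C_def)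
    have thA: "sin C = sin (\<theta> y) * cos A - cos (\<theta> y) * sin A"
      by (simp add: C_def A_def left_diff_distrib sin_diff)
    have Ra: "x * R y powr a = R y * sin (\<theta> y) / sin A" using R_split[OF y] s by (simp add: A_def field_simps)
    have im: "Im (\<Lambda> y - of_real x * \<Lambda> y powr of_real a) = 0"
    proof -
      have "Im (\<Lambda> y - of_real x * \<Lambda> y powr of_real a) = R y * sin (\<theta> y) - x * R y powr a * sin A"
        by (simp add: lam_powr[OF y] A_def) (simp add: \<Lambda>_def)
      also have "\<dots> = 0" unfolding Ra using s by simp
      finally show ?thesis .
    qed
    have re: "Re (\<Lambda> y - of_real x * \<Lambda> y powr of_real a) = - E y"
    proof -
      have "Re (\<Lambda> y - of_real x * \<Lambda> y powr of_real a) = R y * cos (\<theta> y) - x * R y powr a * cos A"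
        by (simp add: lam_powr[OF y] A_def) (simp add: \<Lambda>_def)
      also have "\<dots> = - (R y * sin C / sin A)" unfolding Ra thA using s by (simp add: field_simps)
      also have "R y * sin C / sin A = E y"
      proof -
        have "y * kanter_n \<beta> a (\<theta> y) = x * (sin A powr a * sin C powr (1 - a) / sin (\<theta> y))"
          using kt[OF y] y by (simp add: kanter_n_def A_def C_def)
        then have "E y = x powr \<gamma> * (sin A powr (a * \<gamma>) * sin C powr ((1 - a) * \<gamma>) / sin (\<theta> y) powr \<gamma>)"
          unfolding E_def using x s by (simp add: powr_mult powr_divide powr_powr)
        also have "sin C powr ((1 - a) * \<gamma>) = sin C" using g(2) s by (simp add: mult.commute)
        also have "sin A powr (a * \<gamma>) = sin A powr \<gamma> / sin A" unfolding g(3) using s by (simp add: powr_diff)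
        finally have "E y = x powr \<gamma> * sin A powr \<gamma> * sin C / (sin A * sin (\<theta> y) powr \<gamma>)" by simp
        moreover have "R y = x powr \<gamma> * sin A powr \<gamma> / sin (\<theta> y) powr \<gamma>"
          using x s by (simp add: R_def A_def powr_mult powr_divide)
        ultimately show ?thesis by simp
      qed
      finally show ?thesis .
    qed
    show ?thesis using re im by (simp add: complex_eq_iff)
  qed
  have Im_powr: "Im (\<Lambda> y powr of_real (1 - \<beta>)) = y powr \<delta>" if y: "0 < y" for y
  proof -
    note s = sp[OF y]
    have I: "Im (\<Lambda> y powr of_real (1 - \<beta>)) = R y powr (1 - \<beta>) * sin ((1 - \<beta>) * \<theta> y)"
      unfolding lam_powr[OF y] by simp
    have yx: "y = x / kanter_t \<beta> a (\<theta> y)" using kt[OF y] x y by simp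
    show ?thesis
    proof (cases "\<beta> = 0")
      case True
      then have "y = x * sin (a * \<theta> y) / sin (\<theta> y) powr a" using yx by (simp add: kanter_t_def)
      then have "y powr \<delta> = (x * sin (a * \<theta> y) / sin (\<theta> y) powr a) powr \<gamma>" using True by (simp add: del)
      also have "\<dots> = x powr \<gamma> * sin (a * \<theta> y) powr \<gamma> / sin (\<theta> y) powr (a * \<gamma>)"
        using s x by (simp add: powr_mult powr_divide powr_powr)
      also have "sin (\<theta> y) powr (a * \<gamma>) = sin (\<theta> y) powr \<gamma> / sin (\<theta> y)" unfolding g(3) using s by (simp add: powr_diff)
      also have "x powr \<gamma> * sin (a * \<theta> y) powr \<gamma> / (sin (\<theta> y) powr \<gamma> / sin (\<theta> y)) = R y * sin (\<theta> y)"
        using s x by (simp add: R_def powr_mult powr_divide)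
      finally show ?thesis using True R0[OF y] I by simp
    next
      case False
      then have ba: "\<beta> = a" using \<beta> by simp
      then have "y = x * sin (a * \<theta> y) / sin (\<theta> y) * sin ((1 - a) * \<theta> y)" using yx a by (simp add: kanter_t_def)
      moreover have "\<delta> = 1" using ba g(2) by (simp add: del)
      ultimately show ?thesis using I ba R1a[OF y] y by simp
    qed
  qed
  define f where "f \<zeta> = exp (\<zeta> - of_real x * \<zeta> powr of_real a) * \<zeta> powr (- of_real \<beta>)" for \<zeta> :: complex
  have "f holomorphic_on (- \<real>\<^sub>\<le>\<^sub>0)"
    unfolding f_def by (intro holomorphic_intros) auto
  then obtain P where P: "\<And>z. z \<notin> \<real>\<^sub>\<le>\<^sub>0 \<Longrightarrow> (P has_field_derivative f z) (at z)"
    using slit_plane_primitive by blast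
  define F where "F y = Im (P (\<Lambda> y))" for y
  have w_eq: "w y = exp (- E y) * (\<gamma> * y powr (\<delta> - 1))" for y
    by (simp add: w_def E_def \<gamma>_def \<delta>_def \<theta>_def)
  have dtheta: "(\<theta> has_real_derivative \<tau>' (x / y) * (- x / y\<^sup>2)) (at y)" if y: "0 < y" for y
  proof -
    have "((\<lambda>y. x / y) has_real_derivative - x / y\<^sup>2) (at y)"
      using y by (auto intro!: derivative_eq_intros simp: power2_eq_square)
    from DERIV_chain2[OF d\<tau> this] show ?thesis using x y by (simp add: \<theta>_def[abs_def])
  qed
  have dF: "(F has_real_derivative w y) (at y)" if y: "0 < y" for y
  proof -
    obtain \<theta>' where \<theta>': "(\<theta> has_real_derivative \<theta>') (at y)" using dtheta[OF y] by blast
    have dsin: "((\<lambda>y. sin (k * \<theta> y)) has_real_derivative cos (k * \<theta> y) * (k * \<theta>')) (at y)" for k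
      by (rule DERIV_fun_sin[OF DERIV_cmult[OF \<theta>']])
    have "\<exists>R'. (R has_real_derivative R') (at y)"
    proof -
      have "((\<lambda>y. x * sin (a * \<theta> y) / sin (1 * \<theta> y)) has_real_derivative
        ((x * (cos (a * \<theta> y) * (a * \<theta>'))) * sin (1 * \<theta> y) - x * sin (a * \<theta> y) * (cos (1 * \<theta> y) * (1 * \<theta>'))) / (sin (1 * \<theta> y) * sin (1 * \<theta> y))) (at y)"
        by (rule DERIV_divide[OF DERIV_cmult[OF dsin] dsin]) (use sp[OF y] in simp)
      from DERIV_chain2[OF has_real_derivative_powr this, of \<gamma>] show ?thesis
        using sp[OF y] x unfolding R_def[abs_def] by auto
    qed
    then obtain R' where R': "(R has_real_derivative R') (at y)" by blast
    have dL: "(\<Lambda> has_vector_derivative of_real R' * cis (\<theta> y) + of_real (R y) * (of_real \<theta>' * (\<i> * cis (\<theta> y)))) (at y)"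
    proof -
      have v1: "((\<lambda>y. complex_of_real (R y)) has_vector_derivative of_real R') (at y)"
        using R' by (intro has_vector_derivative_of_real) (simp add: has_real_derivative_iff_has_vector_derivative)
      have v2: "((\<lambda>y. \<i> * complex_of_real (\<theta> y)) has_vector_derivative \<i> * of_real \<theta>') (at y)"
        using \<theta>' by (intro has_vector_derivative_mult_right has_vector_derivative_of_real)
          (simp add: has_real_derivative_iff_has_vector_derivative)
      have "(exp \<circ> (\<lambda>y. \<i> * complex_of_real (\<theta> y)) has_vector_derivative (\<i> * of_real \<theta>') * exp (\<i> * complex_of_real (\<theta> y))) (at y)"
        by (rule field_vector_diff_chain_at[OF v2 DERIV_exp])
      then have "((\<lambda>y. cis (\<theta> y)) has_vector_derivative of_real \<theta>' * (\<i> * cis (\<theta> y))) (at y)"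
        by (simp add: o_def cis_conv_exp mult_ac)
      from has_vector_derivative_mult[OF v1 this] show ?thesis
        unfolding \<Lambda>_def[abs_def] by (simp add: add.commute)
    qed
    define L' where "L' = of_real R' * cis (\<theta> y) + of_real (R y) * (of_real \<theta>' * (\<i> * cis (\<theta> y)))"
    have dL: "(\<Lambda> has_vector_derivative L') (at y)" using dL by (simp only: L'_def)
    \<comment> \<open>Up to the factor \<open>1 - \<beta>\<close>, the derivative of
      \<open>\<Lambda>^(1-\<beta>)\<close> is \<open>L' * \<Lambda>^(-\<beta>)\<close>. Its
      imaginary part is read off from the closed form in \<open>Im_powr\<close>, so neither
      \<open>R'\<close> nor \<open>\<theta>'\<close> has to be computed.\<close>
    have "((\<lambda>z. z powr of_real (1 - \<beta>)) has_field_derivative of_real (1 - \<beta>) * \<Lambda> y powr (of_real (1 - \<beta>) - 1)) (at (\<Lambda> y))"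
      by (rule has_field_derivative_powr[OF slit[OF y]])
    from field_vector_diff_chain_at[OF dL this]
    have "((\<lambda>y. Im (\<Lambda> y powr of_real (1 - \<beta>))) has_real_derivative Im (L' * (of_real (1 - \<beta>) * \<Lambda> y powr (of_real (1 - \<beta>) - 1)))) (at y)"
      unfolding has_real_derivative_iff_has_vector_derivative o_def
      by (rule bounded_linear.has_vector_derivative[OF bounded_linear_Im])
    moreover have "((\<lambda>y. Im (\<Lambda> y powr of_real (1 - \<beta>))) has_real_derivative \<delta> * y powr (\<delta> - 1)) (at y)"
    proof (rule has_field_derivative_transform_within_open[OF has_real_derivative_powr[OF y], of "{0<..}"])
      show "v powr \<delta> = Im (\<Lambda> v powr of_real (1 - \<beta>))" if "v \<in> {0<..}" for v
        using that by (intro Im_powr[symmetric]) simp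
    qed (use y in auto)
    ultimately have "Im (L' * (of_real (1 - \<beta>) * \<Lambda> y powr (of_real (1 - \<beta>) - 1))) = \<delta> * y powr (\<delta> - 1)"
      by (rule DERIV_unique)
    moreover have "L' * (of_real (1 - \<beta>) * \<Lambda> y powr (of_real (1 - \<beta>) - 1)) = of_real (1 - \<beta>) * (L' * \<Lambda> y powr (- of_real \<beta>))"
      by (simp add: mult_ac)
    moreover have ImR: "Im (of_real r * Z) = r * Im Z" for r Z by simp
    ultimately have "(1 - \<beta>) * Im (L' * \<Lambda> y powr (- of_real \<beta>)) = \<delta> * y powr (\<delta> - 1)"
      by (simp only:)
    also have "\<delta> * y powr (\<delta> - 1) = (1 - \<beta>) * (\<gamma> * y powr (\<delta> - 1))" by (simp add: del mult_ac)
    finally have key: "Im (L' * \<Lambda> y powr (- of_real \<beta>)) = \<gamma> * y powr (\<delta> - 1)" using b by simp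
    have "(P \<circ> \<Lambda> has_vector_derivative L' * f (\<Lambda> y)) (at y)"
      by (rule field_vector_diff_chain_at[OF dL P[OF slit[OF y]]])
    then have "(F has_real_derivative Im (L' * f (\<Lambda> y))) (at y)"
      unfolding has_real_derivative_iff_has_vector_derivative F_def[abs_def] o_def
      by (rule bounded_linear.has_vector_derivative[OF bounded_linear_Im])
    moreover have "L' * f (\<Lambda> y) = of_real (exp (- E y)) * (L' * \<Lambda> y powr (- of_real \<beta>))"
      unfolding f_def expo[OF y] exp_of_real by (simp add: mult_ac)
    ultimately show ?thesis unfolding w_eq by (simp only: ImR key)
  qed
  obtain \<omega> :: real where om: "pi / 2 < \<omega>" "\<omega> < pi" using dense[of "pi / 2" pi] by auto
  interpret tilted_ray \<omega> by unfold_locales (use om in auto)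
  have lim_th0: "filterlim \<theta> (at_right 0) (at_right 0)"
  proof -
    have "filterlim (\<lambda>y. x / y) at_top (at_right 0)" using x by real_asymp
    then have "(\<theta> \<longlongrightarrow> 0) (at_right 0)" unfolding \<theta>_def[abs_def] by (rule filterlim_compose[OF \<tau>_top])
    moreover have "\<forall>\<^sub>F y in at_right 0. \<theta> y \<in> {0<..} \<and> \<theta> y \<noteq> 0"
    proof -
      have "\<theta> y \<in> {0<..} \<and> \<theta> y \<noteq> 0" if "0 < y" for y using th(1)[OF that] by simp
      then show ?thesis by (auto simp: eventually_at_right_field intro!: exI[of _ 1])
    qed
    ultimately show ?thesis unfolding filterlim_at by simp
  qed
  have lim_thpi: "(\<theta> \<longlongrightarrow> pi) at_top"
  proof -
    have "filterlim (\<lambda>y. x / y) (at_right 0) at_top" using x by real_asymp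
    then show ?thesis unfolding \<theta>_def[abs_def] by (rule filterlim_compose[OF \<tau>_0])
  qed
  \<comment> \<open>The point where the curve meets the positive axis, since
    \<open>sin (a * \<theta>) / sin \<theta>\<close> tends to \<open>a\<close>.\<close>
  define r0 where "r0 = (x * a) powr \<gamma>"
  have r0: "0 < r0" using x a by (simp add: r0_def)
  have R_0: "(R \<longlongrightarrow> r0) (at_right 0)"
  proof -
    have "((\<lambda>u. sin (a * u) / sin u) \<longlongrightarrow> a) (at_right 0)" using a by real_asymp
    from filterlim_compose[OF this lim_th0]
    have "((\<lambda>y. sin (a * \<theta> y) / sin (\<theta> y)) \<longlongrightarrow> a) (at_right 0)" .
    then have "((\<lambda>y. (x * (sin (a * \<theta> y) / sin (\<theta> y))) powr \<gamma>) \<longlongrightarrow> (x * a) powr \<gamma>) (at_right 0)"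
      using x a by (intro tendsto_intros) auto
    then show ?thesis by (simp add: R_def[abs_def] r0_def)
  qed
  have F_0: "(F \<longlongrightarrow> Im (P 1)) (at_right 0)"
  proof -
    have th0: "(\<theta> \<longlongrightarrow> 0) (at_right 0)" using lim_th0 by (simp add: filterlim_at)
    have "((\<lambda>y. of_real (R y) * cis (\<theta> y)) \<longlongrightarrow> of_real r0 * cis 0) (at_right 0)"
      unfolding cis_conv_exp by (intro tendsto_intros R_0 th0)
    then have L0: "(\<Lambda> \<longlongrightarrow> of_real r0) (at_right 0)" by (simp add: \<Lambda>_def[abs_def])
    have "of_real r0 \<notin> (\<real>\<^sub>\<le>\<^sub>0 :: complex set)" using r0 by (auto simp: complex_nonpos_Reals_iff)
    then have "isCont P (of_real r0)" by (rule DERIV_isCont[OF P])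
    then have "((\<lambda>y. Im (P (\<Lambda> y))) \<longlongrightarrow> Im (P (of_real r0))) (at_right 0)"
      by (intro tendsto_Im isCont_tendsto_compose[OF _ L0])
    moreover have "Im (P (of_real r0)) = Im (P 1)"
    proof (rule Im_primitive_const[OF P])
      fix t :: real assume t: "0 < t"
      have "f (of_real t) = of_real (exp (t - x * t powr a) * t powr (- \<beta>))"
        using t powr_of_real[of t "- \<beta>"] powr_of_real[of t a] by (simp add: f_def flip: exp_of_real)
      then show "Im (f (of_real t)) = 0" by (simp only: Im_complex_of_real)
    qed (use r0 in auto)
    ultimately show ?thesis by (simp add: F_def[abs_def])
  qed
  have R_top: "filterlim R at_top at_top"
  proof -
    have n: "((\<lambda>y. x * sin (a * \<theta> y)) \<longlongrightarrow> x * sin (a * pi)) at_top"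
      by (intro tendsto_intros lim_thpi)
    have pos: "0 < x * sin (a * pi)" using x a by (intro mult_pos_pos sin_gt_zero) auto
    have d: "((\<lambda>y. sin (\<theta> y)) \<longlongrightarrow> 0) at_top" using tendsto_sin[OF lim_thpi] by simp
    have "\<forall>\<^sub>F y in at_top. sin (\<theta> y) \<in> {0<..} \<and> sin (\<theta> y) \<noteq> 0"
      by (rule eventually_mono[OF eventually_gt_at_top[of "0::real"]]) (use sp(3) in force)
    then have "filterlim (\<lambda>y. sin (\<theta> y)) (at_right 0) at_top"
      unfolding filterlim_at using d by simp
    from filterlim_compose[OF filterlim_inverse_at_top_right this]
    have "filterlim (\<lambda>y. x * sin (a * \<theta> y) * inverse (sin (\<theta> y))) at_top at_top"
      by (rule filterlim_tendsto_pos_mult_at_top[OF n pos])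
    then have q: "filterlim (\<lambda>y. x * sin (a * \<theta> y) / sin (\<theta> y)) at_top at_top"
      by (simp only: divide_inverse)
    have p: "filterlim (\<lambda>v. v powr \<gamma>) at_top at_top" using g by real_asymp
    show ?thesis unfolding R_def[abs_def] by (rule filterlim_compose[OF p q])
  qed
  have ray_lim: "((\<lambda>r. P (ray r) - P (ray 0)) \<longlongrightarrow> (LINT s:{0<..}|lborel. kernel x a \<beta> s)) at_top"
  proof (rule half_line_FTC_at_top[OF _ continuous_on_kernel kernel_integrable[OF a]])
    fix s :: real assume s: "0 \<le> s"
    have "(ray has_vector_derivative cis \<omega>) (at s)"
      unfolding ray_def[abs_def] by (auto intro!: derivative_eq_intros)
    from field_vector_diff_chain_at[OF this P[OF ray_slit[OF s]]]
    show "((\<lambda>r. P (ray r)) has_vector_derivative kernel x a \<beta> s) (at s)"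
      by (simp add: o_def kernel_def f_def mult_ac)
  qed
  have PR: "((\<lambda>y. Im (P (ray (R y)))) \<longlongrightarrow> Im (P 1) + pi * wright (- a) \<beta> (- x)) at_top"
  proof -
    have "((\<lambda>y. Im (P (ray (R y)) - P (ray 0)) + Im (P (ray 0))) \<longlongrightarrow> Im (LINT s:{0<..}|lborel. kernel x a \<beta> s) + Im (P (ray 0))) at_top"
      by (intro tendsto_add tendsto_Im tendsto_const filterlim_compose[OF ray_lim R_top])
    moreover have "ray 0 = 1" by (simp add: ray_def)
    ultimately show ?thesis by (simp add: wright_ray[OF a] add.commute)
  qed
  have cosw: "cos (\<omega>) < 0" using cos_omega .
  have F_top: "(F \<longlongrightarrow> Im (P 1) + pi * wright (- a) \<beta> (- x)) at_top"
  proof -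
    \<comment> \<open>The curve at \<open>y\<close> is compared with the ray at parameter
      \<open>R y\<close>. Once \<open>\<theta> y\<close> exceeds \<open>\<omega>\<close>, the
      joining segment lies in the upper half-plane with real part at most
      \<open>1 + R y * cos \<omega>\<close>, so the integrand is exponentially small on it.\<close>
    have "((\<lambda>y. F y - Im (P (ray (R y)))) \<longlongrightarrow> 0) at_top"
    proof (rule Lim_null_comparison)
      have "\<forall>\<^sub>F y in at_top. \<omega> < \<theta> y" by (rule order_tendstoD(1)[OF lim_thpi om(2)])
      \<comment> \<open>Keeps the real part on the segment below \<open>-1\<close>, so that
        \<open>norm \<zeta> \<ge> 1\<close> and the factor \<open>\<zeta>^(-\<beta>)\<close> is
        bounded by 1.\<close>
      moreover have "\<forall>\<^sub>F y in at_top. 2 / (- cos (\<omega>)) \<le> R y" using R_top by (simp add: filterlim_at_top)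
      moreover note eventually_gt_at_top[of "0::real"]
      ultimately show "\<forall>\<^sub>F y in at_top. norm (F y - Im (P (ray (R y)))) \<le> 2 * kernel_bound x a 1 (R y)"
      proof eventually_elim
        case (elim y)
        define c where "c = cos (\<omega>)"
        have c: "c < 0" using cosw by (simp add: c_def)
        note y = elim(3)
        have "0 < - c" using c by simp
        from iffD1[OF pos_divide_le_eq[OF this] elim(2)[folded c_def]]
        have Rc: "2 \<le> - c * R y" by (simp only: mult.commute)
        have Rp: "0 < R y" by (rule R0[OF y])
        have cth: "cos (\<theta> y) \<le> c" unfolding c_def using elim(1) th[OF y] om pi_gt_zero by (intro cos_monotone_0_pi_le) linarith+
        define M where "M = exp (1 + R y * c + x * (1 + R y) powr a)"
        have "norm (P (\<Lambda> y) - P (ray (R y))) \<le> M * norm (\<Lambda> y - ray (R y))"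
        proof (rule primitive_diff_le[OF P])
          fix \<zeta> assume "\<zeta> \<in> closed_segment (\<Lambda> y) (ray (R y))"
          then obtain u where u: "0 \<le> u" "u \<le> 1" "\<zeta> = (1 - u) *\<^sub>R \<Lambda> y + u *\<^sub>R ray (R y)"
            by (auto simp: in_segment)
          have "Re \<zeta> = (1 - u) * (R y * cos (\<theta> y)) + u * (1 + R y * c)"
            by (simp add: u(3) \<Lambda>_def Re_ray c_def)
          also have "\<dots> \<le> (1 - u) * (1 + R y * c) + u * (1 + R y * c)"
            using u cth Rp by (intro add_mono mult_left_mono) (auto intro: order_trans[of _ "R y * c"])
          finally have Re: "Re \<zeta> \<le> 1 + R y * c" by (simp add: algebra_simps)
          have "norm \<zeta> \<le> (1 - u) * norm (\<Lambda> y) + u * norm (ray (R y))"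
            unfolding u(3) by (rule norm_triangle_le) (use u in simp)
          also have "\<dots> \<le> (1 - u) * (1 + R y) + u * (1 + R y)"
            using u Rp norm_ray_le[of "R y"] by (intro add_mono mult_left_mono) (auto simp: \<Lambda>_def norm_mult)
          finally have N: "norm \<zeta> \<le> 1 + R y" by (simp add: algebra_simps)
          have "1 \<le> - Re \<zeta>" using Re Rc by (simp add: mult.commute)
          also have "\<dots> \<le> norm \<zeta>" using abs_Re_le_cmod[of \<zeta>] by simp
          finally have n1: "1 \<le> norm \<zeta>" .
          have Im: "0 < Im \<zeta>"
          proof -
            have "Im \<zeta> = (1 - u) * (R y * sin (\<theta> y)) + u * (R y * sin (\<omega>))"
              by (simp add: u(3) \<Lambda>_def ray_def)
            moreover have "0 < R y * sin (\<theta> y)" "0 < R y * sin (\<omega>)"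
              using Rp sp(3)[OF y] sin_omega by auto
            ultimately show ?thesis
            proof (cases "u = 0")
              case False
              have "0 \<le> (1 - u) * (R y * sin (\<theta> y))" "0 < u * (R y * sin \<omega>)"
                using u False Rp sp(3)[OF y] sin_omega by auto
              then show ?thesis unfolding \<open>Im \<zeta> = _\<close> by linarith
            qed simp
          qed
          have "Re (- (of_real x * \<zeta> powr of_real a)) \<le> norm (- (of_real x * \<zeta> powr of_real a))"
            by (rule complex_Re_le_cmod)
          also have "\<dots> = x * norm \<zeta> powr a" using x by (simp add: norm_mult norm_powr_real_powr')
          also have "\<dots> \<le> x * (1 + R y) powr a" using N x a by (intro mult_left_mono powr_mono2) auto
          finally have "exp (Re (\<zeta> - of_real x * \<zeta> powr of_real a)) \<le> M"
            using Re by (simp add: M_def)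
          moreover have "norm \<zeta> powr (- \<beta>) \<le> 1"
          proof -
            have "norm \<zeta> powr (- \<beta>) \<le> norm \<zeta> powr 0" using n1 b by (intro powr_mono) auto
            moreover have "\<zeta> \<noteq> 0" using n1 by auto
            ultimately show ?thesis by simp
          qed
          ultimately have "exp (Re (\<zeta> - of_real x * \<zeta> powr of_real a)) * norm \<zeta> powr (- \<beta>) \<le> M * 1"
            by (intro mult_mono) (auto simp: M_def)
          moreover have "norm (f \<zeta>) = exp (Re (\<zeta> - of_real x * \<zeta> powr of_real a)) * norm \<zeta> powr (- \<beta>)"
            unfolding f_def norm_mult norm_exp_eq_Re using norm_powr_real_powr'[of "- of_real \<beta>" \<zeta>] by simp
          ultimately have "norm (f \<zeta>) \<le> M" by simp
          then show "\<zeta> \<notin> \<real>\<^sub>\<le>\<^sub>0 \<and> norm (f \<zeta>) \<le> M" using Im by (auto simp: complex_nonpos_Reals_iff)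
        qed
        also have "\<dots> \<le> M * (2 * (1 + R y))"
        proof (rule mult_left_mono)
          have "norm (\<Lambda> y - ray (R y)) \<le> norm (\<Lambda> y) + norm (ray (R y))" by (rule norm_triangle_ineq4)
          also have "\<dots> \<le> R y + (1 + R y)" using Rp norm_ray_le[of "R y"] by (intro add_mono) (auto simp: \<Lambda>_def norm_mult)
          finally show "norm (\<Lambda> y - ray (R y)) \<le> 2 * (1 + R y)" by simp
        qed (simp add: M_def)
        \<comment> \<open>Index 1 contributes a factor \<open>1 + R y\<close> to
          \<open>kernel_bound\<close>, which absorbs the length of the segment.\<close>
        also have "\<dots> \<le> 2 * kernel_bound x a 1 (R y)"
        proof -
          have "1 \<le> inverse (sin (\<omega>))" using sin_omega by (intro one_le_inverse) auto
          then have "1 * (1 + R y) \<le> inverse (sin (\<omega>)) * (1 + R y)" using Rp by (intro mult_right_mono) auto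
          then have "M * (1 + R y) \<le> M * (inverse (sin (\<omega>)) * (1 + R y))"
            by (intro mult_left_mono) (auto simp: M_def)
          also have "\<dots> = kernel_bound x a 1 (R y)"
            using Rp sin_omega by (simp add: kernel_bound_def M_def c_def powr_minus)
          finally have "M * (1 + R y) \<le> kernel_bound x a 1 (R y)" .
          moreover have "M * (2 * (1 + R y)) = 2 * (M * (1 + R y))" by simp
          ultimately show ?thesis by linarith
        qed
        finally have "norm (P (\<Lambda> y) - P (ray (R y))) \<le> 2 * kernel_bound x a 1 (R y)" .
        moreover have "norm (F y - Im (P (ray (R y)))) \<le> norm (P (\<Lambda> y) - P (ray (R y)))"
          using abs_Im_le_cmod[of "P (\<Lambda> y) - P (ray (R y))"] by (simp add: F_def)
        ultimately show ?case by linarith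
      qed
      have "((\<lambda>y. kernel_bound x a 1 (R y)) \<longlongrightarrow> 0) at_top"
        by (rule filterlim_compose[OF kernel_bound_tendsto_0 R_top]) (use x a in auto)
      then show "((\<lambda>y. 2 * kernel_bound x a 1 (R y)) \<longlongrightarrow> 0) at_top" by (rule tendsto_mult_right_zero)
    qed
    from tendsto_add[OF this PR] show ?thesis by simp
  qed
  have wcont: "isCont w y" if y: "0 < y" for y
  proof -
    have ct: "isCont \<theta> y" by (rule DERIV_isCont[OF dtheta[OF y]])
    have ck: "isCont (\<lambda>y. kanter_n \<beta> a (\<theta> y)) y"
    proof (cases "\<beta> = 0")
      case True
      then have e: "kanter_n \<beta> a (\<theta> y) = sin (\<theta> y) powr a / sin (a * \<theta> y)
        * (sin (a * \<theta> y) powr a * sin ((1 - a) * \<theta> y) powr (1 - a) / sin (\<theta> y))" for y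
        by (simp add: kanter_n_def kanter_t_def)
      show ?thesis unfolding e using sp[OF y] a by (intro continuous_intros ct) auto
    next
      case False
      then have e: "kanter_n \<beta> a (\<theta> y) = sin (\<theta> y) / (sin (a * \<theta> y) * sin ((1 - a) * \<theta> y))
        * (sin (a * \<theta> y) powr a * sin ((1 - a) * \<theta> y) powr (1 - a) / sin (\<theta> y))" for y
        by (simp add: kanter_n_def kanter_t_def)
      show ?thesis unfolding e using sp[OF y] a by (intro continuous_intros ct) auto
    qed
    have "0 < y * kanter_n \<beta> a (\<theta> y)"
      using kt[OF y] x y sp[OF y] by (simp add: kanter_n_def)
    then show ?thesis unfolding w_eq[abs_def] E_def[abs_def] using y
      by (intro continuous_intros ck) auto
  qed
  show "continuous_on {0<..} w" by (intro continuous_at_imp_continuous_on ballI wcont) simp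
  show "0 < w y" if "0 < y" for y using that g by (simp add: w_eq)
  have F1: "AE y in lborel. 0 < ereal y \<longrightarrow> ereal y < \<infinity> \<longrightarrow> 0 \<le> w y"
    using g by (auto simp: w_eq)
  have F2: "((F \<circ> real_of_ereal) \<longlongrightarrow> Im (P 1)) (at_right 0)"
    unfolding zero_ereal_def using F_0 by (simp add: ereal_tendsto_simps)
  have F3: "((F \<circ> real_of_ereal) \<longlongrightarrow> Im (P 1) + pi * wright (- a) \<beta> (- x)) (at_left \<infinity>)"
    using F_top by (simp add: ereal_tendsto_simps)
  have F4: "(F has_real_derivative w y) (at y)" "isCont w y" if "0 < ereal y" "ereal y < \<infinity>" for y
    using dF wcont that by auto
  \<comment> \<open>The integrand is nonnegative and its antiderivative has finite limits at both
    ends, so integrability and the value of the integral come together.\<close>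
  note FTC = interval_integral_FTC_nonneg[OF _ F4 F1 F2 F3, simplified]
  have e: "einterval 0 \<infinity> = {0::real<..}" by (auto simp: einterval_iff)
  show "set_integrable lborel {0<..} w" using FTC(1) by (simp only: e)
  show "(LINT y:{0<..}|lborel. w y) = pi * wright (- a) \<beta> (- x)"
    using FTC(2) by (simp add: interval_lebesgue_integral_def e)
qed

subsection \<open>Log-concavity\<close>

lemma concave_on_eqI:
  assumes "concave_on S f" "\<And>x. x \<in> S \<Longrightarrow> f x = g x"
  shows "concave_on S g"
  using assms by (auto simp: concave_on_iff convexD)

lemma integral_half_line_pos:
  fixes f :: "real \<Rightarrow> real"
  assumes "continuous_on {0<..} f" "\<forall>y>0. 0 < f y" "set_integrable lborel {0<..} f"
  shows "0 < (LINT y:{0<..}|lborel. f y)"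
  using cdf_pos[OF assms, of 1] cdf_less[OF assms, of 1] by simp

lemma wright_pos_0_or_a:
  fixes a \<beta> x :: real
  assumes a: "0 < a" "a < 1" and \<beta>: "\<beta> = 0 \<or> \<beta> = a" and x: "0 < x"
  shows "0 < wright (- a) \<beta> (- x)"
proof -
  obtain \<tau> \<tau>' where \<tau>: "\<And>t. 0 < t \<Longrightarrow> \<tau> t \<in> {0<..<pi}" "\<And>t. 0 < t \<Longrightarrow> kanter_t \<beta> a (\<tau> t) = t"
    "\<And>t. 0 < t \<Longrightarrow> (\<tau> has_real_derivative \<tau>' t) (at t)"
    "(\<tau> \<longlongrightarrow> 0) at_top" "(\<tau> \<longlongrightarrow> pi) (at_right 0)"
    by (rule kanter_t_inverse[OF a \<beta>]) blast
  define \<gamma> where "\<gamma> = 1 / (1 - a)"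
  define \<delta> where "\<delta> = (1 - \<beta>) / (1 - a)"
  define N where "N t = kanter_n \<beta> a (\<tau> t)" for t
  define w where "w x y = \<gamma> * y powr (\<delta> - 1) * exp (- ((y * N (x / y)) powr \<gamma>))" for x y
  note K = wright_kanter[OF a \<beta> _ \<tau>, folded \<gamma>_def \<delta>_def N_def, folded w_def]
  have "0 < pi * wright (- a) \<beta> (- x)"
    using integral_half_line_pos[of "w x"] K[OF x] by simp
  then show ?thesis by (simp add: zero_less_mult_iff)
qed

text \<open>\<open>D\<close> expresses the convexity of \<open>kanter_n\<close> in terms of
  \<open>kanter_t\<close> by supporting lines, which pass to the perspective without differentiation
  in \<open>x\<close> or \<open>y\<close>. A power with exponent \<open>\<gamma> \<ge> 1\<close>
  preserves convexity, and \<open>\<delta> \<ge> 1\<close> makes the remaining factor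
  log-concave.\<close>

lemma kanter_log_concave:
  fixes a \<beta> :: real and D :: "real \<Rightarrow> real"
  assumes a: "0 < a" "a < 1" and \<beta>: "\<beta> = 0 \<or> \<beta> = a"
    and D: "\<And>\<theta> \<eta>. \<theta> \<in> {0<..<pi} \<Longrightarrow> \<eta> \<in> {0<..<pi} \<Longrightarrow>
       kanter_n \<beta> a \<theta> + D \<theta> * (kanter_t \<beta> a \<eta> - kanter_t \<beta> a \<theta>) \<le> kanter_n \<beta> a \<eta>"
  shows "concave_on {0<..} (\<lambda>x. ln (wright (- a) \<beta> (- x)))"
proof -
  obtain \<tau> \<tau>' where \<tau>: "\<And>t. 0 < t \<Longrightarrow> \<tau> t \<in> {0<..<pi}" "\<And>t. 0 < t \<Longrightarrow> kanter_t \<beta> a (\<tau> t) = t"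
    "\<And>t. 0 < t \<Longrightarrow> (\<tau> has_real_derivative \<tau>' t) (at t)"
    "(\<tau> \<longlongrightarrow> 0) at_top" "(\<tau> \<longlongrightarrow> pi) (at_right 0)"
    by (rule kanter_t_inverse[OF a \<beta>]) blast
  define \<gamma> where "\<gamma> = 1 / (1 - a)"
  define \<delta> where "\<delta> = (1 - \<beta>) / (1 - a)"
  have g: "1 \<le> \<gamma>" "1 \<le> \<delta>" using a \<beta> by (auto simp: \<gamma>_def \<delta>_def field_simps)
  define N where "N t = kanter_n \<beta> a (\<tau> t)" for t
  define w where "w x y = \<gamma> * y powr (\<delta> - 1) * exp (- ((y * N (x / y)) powr \<gamma>))" for x y
  note K = wright_kanter[OF a \<beta> _ \<tau>, folded \<gamma>_def \<delta>_def N_def, folded w_def]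
  note pos = wright_pos_0_or_a[OF a \<beta>]
  have N0: "0 < N t" if t: "0 < t" for t
  proof -
    have th: "0 < \<tau> t" "\<tau> t < pi" using \<tau>(1)[OF t] by auto
    then show ?thesis
      using sin_mult_pos[of a "\<tau> t"] sin_mult_pos[of "1 - a" "\<tau> t"] sin_gt_zero[of "\<tau> t"] a t \<tau>(2)[OF t]
      by (simp add: N_def kanter_n_def)
  qed
  have supp: "N s + D (\<tau> s) * (t - s) \<le> N t" if "0 < s" "0 < t" for s t
    using D[OF \<tau>(1)[OF that(1)] \<tau>(1)[OF that(2)]] \<tau>(2) that by (simp add: N_def)
  have conc: "w x1 y1 powr (1 - u) * w x2 y2 powr u \<le> w ((1 - u) * x1 + u * x2) ((1 - u) * y1 + u * y2)"
    if x: "0 < x1" "0 < x2" and u: "0 < u" "u < 1" and y: "0 < y1" "0 < y2" for x1 x2 u y1 y2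
  proof -
    define x0 where "x0 = (1 - u) * x1 + u * x2"
    define y0 where "y0 = (1 - u) * y1 + u * y2"
    have p0: "0 < x0" "0 < y0" using x y u by (auto simp: x0_def y0_def intro!: add_pos_pos)
    define v1 v2 v0 where "v1 = y1 * N (x1 / y1)" and "v2 = y2 * N (x2 / y2)" and "v0 = y0 * N (x0 / y0)"
    have v: "0 < v1" "0 < v2" "0 < v0" using N0 x y p0 by (auto simp: v1_def v2_def v0_def)
    \<comment> \<open>The slope at \<open>x0 / y0\<close>, which is the mean of
      \<open>x1 / y1\<close> and \<open>x2 / y2\<close> with weights proportional to
      \<open>(1 - u) * y1\<close> and \<open>u * y2\<close>; with these weights the linear terms
      cancel.\<close>
    define d where "d = D (\<tau> (x0 / y0))"
    have "v0 = (1 - u) * (y1 * (N (x0 / y0) + d * (x1 / y1 - x0 / y0))) + u * (y2 * (N (x0 / y0) + d * (x2 / y2 - x0 / y0)))"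
    proof -
      have "(1 - u) * (y1 * (n + d * (x1 / y1 - t))) + u * (y2 * (n + d * (x2 / y2 - t)))
        = y0 * n + d * (x0 - y0 * t)" for n t
        using y by (simp add: x0_def y0_def field_simps)
      from this[of "N (x0 / y0)" "x0 / y0"] show ?thesis using p0 by (simp add: v0_def)
    qed
    also have "\<dots> \<le> (1 - u) * v1 + u * v2"
      unfolding v1_def v2_def d_def using x y p0 u by (intro add_mono mult_left_mono supp) auto
    finally have "v0 powr \<gamma> \<le> ((1 - u) * v1 + u * v2) powr \<gamma>" using v g by (intro powr_mono2) auto
    also have "\<dots> \<le> (1 - u) * v1 powr \<gamma> + u * v2 powr \<gamma>"
      using convex_onD[OF powr_convex[OF g(1)], of u v1 v2] u v by simp
    finally have E: "exp (- ((1 - u) * v1 powr \<gamma>) + - (u * v2 powr \<gamma>)) \<le> exp (- (v0 powr \<gamma>))" by simp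
    have "y1 powr (1 - u) * y2 powr u \<le> y0"
      using Youngs_inequality_0[of "1 - u" u y1 y2] u y by (simp add: y0_def)
    then have Y: "(y1 powr (1 - u) * y2 powr u) powr (\<delta> - 1) \<le> y0 powr (\<delta> - 1)"
      using g by (intro powr_mono2) auto
    have ep: "exp v powr r = exp (r * v)" for v r :: real by (simp add: powr_def)
    have "w x1 y1 powr (1 - u) * w x2 y2 powr u
      = (\<gamma> powr (1 - u) * \<gamma> powr u) * (y1 powr (1 - u) * y2 powr u) powr (\<delta> - 1)
        * (exp (- ((1 - u) * v1 powr \<gamma>)) * exp (- (u * v2 powr \<gamma>)))"
      using g y by (simp add: w_def v1_def v2_def powr_mult powr_powr ep mult_ac)
    also have "\<gamma> powr (1 - u) * \<gamma> powr u = \<gamma>" using g by (simp flip: powr_add)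
    also have "\<gamma> * (y1 powr (1 - u) * y2 powr u) powr (\<delta> - 1)
        * (exp (- ((1 - u) * v1 powr \<gamma>)) * exp (- (u * v2 powr \<gamma>))) \<le> \<gamma> * y0 powr (\<delta> - 1) * exp (- (v0 powr \<gamma>))"
      by (rule mult_mono[OF mult_left_mono[OF Y] E[unfolded exp_add]]) (use g in auto)
    also have "\<dots> = w x0 y0" by (simp add: w_def v0_def)
    finally show ?thesis by (simp add: x0_def y0_def)
  qed
  have main: "(1 - u) * ln (wright (- a) \<beta> (- x1)) + u * ln (wright (- a) \<beta> (- x2))
      \<le> ln (wright (- a) \<beta> (- ((1 - u) * x1 + u * x2)))"
    if x: "0 < x1" "0 < x2" and u: "0 < u" "u < 1" for x1 x2 u
  proof -
    define x0 where "x0 = (1 - u) * x1 + u * x2"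
    have x0: "0 < x0" using x u by (auto simp: x0_def intro!: add_pos_pos)
    define f where "f x = wright (- a) \<beta> (- x)" for x
    have f: "0 < f x1" "0 < f x2" "0 < f x0" using pos x x0 by (auto simp: f_def)
    have i: "pi * f x = (LINT y:{0<..}|lborel. w x y)" if "0 < x" for x
      using K(4)[OF that] by (simp add: f_def)
    have "(pi * f x1) powr (1 - u) * (pi * f x2) powr u \<le> pi * f x0"
      unfolding i[OF x(1)] i[OF x(2)] i[OF x0]
      by (rule prekopa_leindler_half_line)
        (use K[OF x(1)] K[OF x(2)] K[OF x0] u conc[OF x u] in \<open>auto simp: x0_def\<close>)
    moreover have "(pi * f x1) powr (1 - u) * (pi * f x2) powr u = pi * (f x1 powr (1 - u) * f x2 powr u)"
    proof -
      have "pi powr (1 - u) * pi powr u = pi" by (simp flip: powr_add)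
      then show ?thesis by (simp add: powr_mult mult_ac)
    qed
    ultimately have "f x1 powr (1 - u) * f x2 powr u \<le> f x0" by simp
    then have "ln (f x1 powr (1 - u) * f x2 powr u) \<le> ln (f x0)" using f by simp
    then show ?thesis using f by (simp add: ln_mult ln_powr f_def x0_def)
  qed
  show "concave_on {0<..} (\<lambda>x. ln (wright (- a) \<beta> (- x)))"
    unfolding concave_on_iff
  proof (intro conjI ballI allI impI)
    fix x1 x2 u v :: real assume x: "x1 \<in> {0<..}" "x2 \<in> {0<..}" and u: "0 \<le> u" "0 \<le> v" "u + v = 1"
    have e: "u = 1 - v" using u by simp
    consider "v = 0" | "v = 1" | "0 < v" "v < 1" using u by fastforce
    then show "u * ln (wright (- a) \<beta> (- x1)) + v * ln (wright (- a) \<beta> (- x2)) \<le> ln (wright (- a) \<beta> (- (u *\<^sub>R x1 + v *\<^sub>R x2)))"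
    proof cases
      case 3
      then show ?thesis using main[of x1 x2 v] x unfolding e by simp
    qed (use e in auto)
  qed (rule convex_real_interval)
qed

section \<open>Hazard rates under fractional integration\<close>

lemma wright_isCont:
  fixes a b x :: real
  assumes "0 < a" "a < 1"
  shows "isCont (\<lambda>x. wright (- a) b (- x)) x"
  by (rule DERIV_isCont[OF wright_has_derivative[OF assms]])

text \<open>\<open>H = G - v F\<close> changes sign at most once, from negative to positive. Passing from \<open>x1\<close> to \<open>x2\<close>
  increases the integral of its positive part, since the weight decreases, and decreases the
  integral of its negative part, which is a decreasing function.\<close>

lemma fractional_average_mono:
  fixes F G :: "real \<Rightarrow> real"
  assumes c: "0 < c" "c \<le> 1"
    and F0: "\<And>x. 0 < x \<Longrightarrow> 0 < F x" and F: "\<And>x y. 0 < x \<Longrightarrow> x \<le> y \<Longrightarrow> F y \<le> F x"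
    and r: "\<And>x y. 0 < x \<Longrightarrow> x \<le> y \<Longrightarrow> G x / F x \<le> G y / F y"
    and iF: "\<And>x. 0 < x \<Longrightarrow> set_integrable lborel {0<..} (\<lambda>z. z powr (c - 1) * F (x + z))"
    and iG: "\<And>x. 0 < x \<Longrightarrow> set_integrable lborel {0<..} (\<lambda>z. z powr (c - 1) * G (x + z))"
    and pos: "\<And>x. 0 < x \<Longrightarrow> 0 < (LINT z:{0<..}|lborel. z powr (c - 1) * F (x + z))"
    and x: "0 < x1" "x1 \<le> x2"
  shows "(LINT z:{0<..}|lborel. z powr (c - 1) * G (x1 + z)) / (LINT z:{0<..}|lborel. z powr (c - 1) * F (x1 + z))
    \<le> (LINT z:{0<..}|lborel. z powr (c - 1) * G (x2 + z)) / (LINT z:{0<..}|lborel. z powr (c - 1) * F (x2 + z))"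
proof -
  define IF where "IF x = (LINT z:{0<..}|lborel. z powr (c - 1) * F (x + z))" for x
  define IG where "IG x = (LINT z:{0<..}|lborel. z powr (c - 1) * G (x + z))" for x
  \<comment> \<open>With this value the integral of \<open>h x1\<close> vanishes, and the claim is
    that the integral of \<open>h x2\<close> is nonnegative.\<close>
  define v where "v = IG x1 / IF x1"
  define H where "H x = G x - v * F x" for x
  define h where "h x z = indicator {0<..} z * (z powr (c - 1) * H (x + z))" for x z :: real
  have x2: "0 < x2" using x by simp
  have hint: "integrable lborel (h y)" and hval: "(LINT z|lborel. h y z) = IG y - v * IF y" if y: "0 < y" for y
  proof -
    have i: "set_integrable lborel {0<..} (\<lambda>z. v * (z powr (c - 1) * F (y + z)))"
      by (intro set_integrable_mult_right iF y)
    have e: "(\<lambda>z. z powr (c - 1) * G (y + z) - v * (z powr (c - 1) * F (y + z))) = (\<lambda>z. z powr (c - 1) * H (y + z))"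
      by (simp add: H_def fun_eq_iff algebra_simps)
    show "integrable lborel (h y)"
      using set_integral_diff(1)[OF iG[OF y] i] unfolding e by (simp add: set_integrable_def h_def[abs_def])
    show "(LINT z|lborel. h y z) = IG y - v * IF y"
      using set_integral_diff(2)[OF iG[OF y] i] unfolding e
      by (simp add: set_lebesgue_integral_def h_def[abs_def] IG_def IF_def)
  qed
  have Hr: "H X = (G X / F X - v) * F X" if "0 < X" for X using F0[OF that] by (simp add: H_def field_simps)
  have "0 \<le> (LINT z|lborel. h x2 z)"
  proof (cases "\<forall>X>x2. 0 \<le> H X")
    case True
    then show ?thesis by (intro integral_nonneg_AE AE_I2) (auto simp: h_def indicator_def)
  next
    case False
    then obtain X0 where X0: "x2 < X0" "H X0 < 0" by (auto simp: not_le)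
    have neg: "H X < 0" if X: "0 < X" "X \<le> X0" for X
    proof -
      have "G X0 / F X0 < v" using X0 x2 F0[of X0] Hr[of X0] by (simp add: mult_less_0_iff)
      then have "G X / F X < v" using r[OF X] by simp
      then show ?thesis using Hr[OF X(1)] F0[OF X(1)] by (simp add: mult_neg_pos)
    qed
    \<comment> \<open>Where \<open>H\<close> is negative, \<open>- H = (v - G / F) * F\<close> is a
      product of two nonnegative decreasing factors.\<close>
    have Hneg: "max 0 (- H Y) \<le> max 0 (- H X)" if XY: "0 < X" "X \<le> Y" for X Y
    proof (cases "0 \<le> H Y")
      case False
      have p: "0 < F X" "0 < F Y" using F0 XY by auto
      have rv: "G Y / F Y < v" using False Hr[of Y] p XY by (simp add: mult_less_0_iff not_le)
      have "- H Y = (v - G Y / F Y) * F Y" using Hr[of Y] XY by (simp add: algebra_simps)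
      also have "\<dots> \<le> (v - G X / F X) * F X"
        using r[OF XY] F[OF XY] rv p by (intro mult_mono) auto
      also have "\<dots> = - H X" using Hr[of X] XY by (simp add: algebra_simps)
      finally show ?thesis by simp
    qed simp
    have mi: "integrable lborel (\<lambda>z. max 0 (h y z))" "integrable lborel (\<lambda>z. max 0 (- h y z))" if "0 < y" for y
      using hint[OF that] by auto
    have split: "(LINT z|lborel. h y z) = (LINT z|lborel. max 0 (h y z)) - (LINT z|lborel. max 0 (- h y z))" if "0 < y" for y
    proof -
      have "(LINT z|lborel. h y z) = (LINT z|lborel. max 0 (h y z) - max 0 (- h y z))"
        by (intro Bochner_Integration.integral_cong) (auto simp: max_def)
      also have "\<dots> = (LINT z|lborel. max 0 (h y z)) - (LINT z|lborel. max 0 (- h y z))"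
        by (rule Bochner_Integration.integral_diff[OF mi[OF that]])
      finally show ?thesis .
    qed
    \<comment> \<open>For the negative part the variable \<open>z\<close> is kept: the weights agree
      and the shift from \<open>x1\<close> to \<open>x2\<close> decreases the function.\<close>
    have B: "(LINT z|lborel. max 0 (- h x2 z)) \<le> (LINT z|lborel. max 0 (- h x1 z))"
    proof (rule integral_mono[OF mi(2)[OF x2] mi(2)[OF x(1)]])
      fix z :: real
      show "max 0 (- h x2 z) \<le> max 0 (- h x1 z)"
      proof (cases "0 < z")
        case True
        have e: "max 0 (- h y z) = z powr (c - 1) * max 0 (- H (y + z))" for y
          using True by (simp add: h_def max_def mult_le_0_iff) 
        show ?thesis unfolding e using Hneg[of "x1 + z" "x2 + z"] x True by (intro mult_left_mono) auto
      qed (simp add: h_def)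
    qed
    \<comment> \<open>For the positive part the substitution \<open>X = y + z\<close> aligns the
      values of \<open>H\<close> instead. What changes is the weight
      \<open>(X - y) powr (c - 1)\<close>, which increases in \<open>y\<close> because
      \<open>c \<le> 1\<close>.\<close>
    have trans: "(LINT z|lborel. max 0 (h y z)) = (LINT X|lborel. max 0 (h y (X - y)))"
      "integrable lborel (\<lambda>X. max 0 (h y (X - y)))" if "0 < y" for y
    proof -
      show "(LINT z|lborel. max 0 (h y z)) = (LINT X|lborel. max 0 (h y (X - y)))"
        using lborel_integral_real_affine[of 1 "\<lambda>z. max 0 (h y z)" "- y"] by simp
      show "integrable lborel (\<lambda>X. max 0 (h y (X - y)))"
        using lborel_integrable_real_affine[OF mi(1)[OF that], of 1 "- y"] by simp
    qed
    have A: "(LINT z|lborel. max 0 (h x1 z)) \<le> (LINT z|lborel. max 0 (h x2 z))"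
      unfolding trans(1)[OF x(1)] trans(1)[OF x2]
    proof (rule integral_mono[OF trans(2)[OF x(1)] trans(2)[OF x2]])
      fix X :: real
      show "max 0 (h x1 (X - x1)) \<le> max 0 (h x2 (X - x2))"
      proof (cases "X \<le> X0")
        case True
        have "h x1 (X - x1) \<le> 0"
        proof (cases "x1 < X")
          case t: True
          have "H X < 0" using neg[of X] t True x by simp
          then show ?thesis using t by (simp add: h_def mult_nonneg_nonpos)
        qed (simp add: h_def)
        then show ?thesis by simp
      next
        case False
        then have X: "x2 < X" "x1 < X" using X0 x by auto
        show ?thesis
        proof (cases "0 \<le> H X")
          case True
          have "(X - x1) powr (c - 1) \<le> (X - x2) powr (c - 1)"
            using X x c by (intro powr_mono2') auto
          then have "(X - x1) powr (c - 1) * H X \<le> (X - x2) powr (c - 1) * H X" using True by (rule mult_right_mono)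
          then show ?thesis using X by (simp add: h_def max.coboundedI2)
        next
          case f: False
          then have "h x1 (X - x1) \<le> 0" using X by (simp add: h_def mult_nonneg_nonpos)
          then show ?thesis by simp
        qed
      qed
    qed
    have "(LINT z|lborel. h x1 z) = 0"
      using hval[OF x(1)] pos[OF x(1)] by (simp add: v_def IF_def)
    then show ?thesis using A B split[OF x(1)] split[OF x2] by simp
  qed
  then have "v * IF x2 \<le> IG x2" using hval[OF x2] by simp
  then have "v \<le> IG x2 / IF x2" using pos[OF x2] by (simp add: IF_def pos_le_divide_eq)
  then show ?thesis by (simp add: v_def IF_def IG_def)
qed

text \<open>The quotient is \<open>- F' / F\<close> for the Wright function \<open>F\<close> of
  index \<open>b\<close>, a hazard rate with density of index \<open>b - a\<close>; its monotonicity
  is the log-concavity of \<open>F\<close>. The nonnegative numerator makes \<open>F\<close>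
  decreasing, as the averaging argument requires.\<close>

definition wright_increasing_hazard :: "real \<Rightarrow> real \<Rightarrow> bool" where
  "wright_increasing_hazard a b \<longleftrightarrow>
     (\<forall>x>0. 0 < wright (- a) b (- x) \<and> 0 \<le> wright (- a) (b - a) (- x)) \<and>
     (\<forall>x y. 0 < x \<and> x \<le> y \<longrightarrow>
        wright (- a) (b - a) (- x) / wright (- a) b (- x) \<le> wright (- a) (b - a) (- y) / wright (- a) b (- y))"

text \<open>Fractional integration of order \<open>c\<close> raises numerator and denominator by the
  same amount \<open>a * c\<close>, so the averaged quotient is again a quotient of this
  shape.\<close>

lemma wright_increasing_hazard_step:
  assumes a: "0 < a" "a < 1" and c: "0 < c" "c \<le> 1" and V: "wright_increasing_hazard a b"
  shows "wright_increasing_hazard a (b + a * c)"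
proof -
  define F where "F x = wright (- a) b (- x)" for x
  define G where "G x = wright (- a) (b - a) (- x)" for x
  have F0: "0 < F x" and G0: "0 \<le> G x" if "0 < x" for x
    using V that by (auto simp: wright_increasing_hazard_def F_def G_def)
  have r: "G x / F x \<le> G y / F y" if "0 < x" "x \<le> y" for x y
    using V that by (auto simp: wright_increasing_hazard_def F_def G_def)
  have F: "F y \<le> F x" if xy: "0 < x" "x \<le> y" for x y
  proof (rule DERIV_nonpos_imp_nonincreasing[OF xy(2)])
    fix z assume "x \<le> z" "z \<le> y"
    then have "- G z \<le> 0" using G0[of z] xy by simp
    moreover have "(F has_real_derivative - G z) (at z)"
      unfolding F_def[abs_def] G_def by (rule wright_has_derivative[OF a])
    ultimately show "\<exists>d. (F has_real_derivative d) (at z) \<and> d \<le> 0" by blast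
  qed
  have iF: "set_integrable lborel {0<..} (\<lambda>z. z powr (c - 1) * F (x + z))"
    and vF: "(LINT z:{0<..}|lborel. z powr (c - 1) * F (x + z)) = Gamma c * wright (- a) (b + a * c) (- x)" if "0 < x" for x
    unfolding F_def using wright_fractional_integral[OF a c(1) that] by auto
  have iG: "set_integrable lborel {0<..} (\<lambda>z. z powr (c - 1) * G (x + z))"
    and vG: "(LINT z:{0<..}|lborel. z powr (c - 1) * G (x + z)) = Gamma c * wright (- a) (b + a * c - a) (- x)" if "0 < x" for x
    unfolding G_def using wright_fractional_integral[OF a c(1) that, of "b - a"] by (auto simp: algebra_simps)
  have G: "0 < Gamma c" using c by (simp add: Gamma_real_pos)
  have pos: "0 < (LINT z:{0<..}|lborel. z powr (c - 1) * F (x + z))" if x: "0 < x" for x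
  proof (rule integral_half_line_pos[OF _ _ iF[OF x]])
    have "isCont (\<lambda>z. F (x + z)) z" for z
      unfolding F_def[abs_def] by (rule isCont_o2[of _ "\<lambda>z. x + z", OF _ wright_isCont[OF a]]) simp
    then have "continuous_on {0<..} (\<lambda>z. F (x + z))" by (simp add: continuous_at_imp_continuous_on)
    then show "continuous_on {0<..} (\<lambda>z. z powr (c - 1) * F (x + z))"
      by (intro continuous_on_mult) (auto intro!: continuous_intros)
  qed (use F0 x in auto)
  have posw: "0 < wright (- a) (b + a * c) (- x)" if "0 < x" for x
    using pos[OF that] G unfolding vF[OF that] by (simp add: zero_less_mult_iff)
  have nn: "0 \<le> wright (- a) (b + a * c - a) (- x)" if x: "0 < x" for x
  proof -
    have "0 \<le> (LINT z:{0<..}|lborel. z powr (c - 1) * G (x + z))"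
      unfolding set_lebesgue_integral_def
      by (intro integral_nonneg_AE AE_I2) (use G0 x in \<open>auto simp: indicator_def\<close>)
    then show ?thesis using G unfolding vG[OF x] by (simp add: zero_le_mult_iff)
  qed
  have "wright (- a) (b + a * c - a) (- x) / wright (- a) (b + a * c) (- x)
      \<le> wright (- a) (b + a * c - a) (- y) / wright (- a) (b + a * c) (- y)" if xy: "0 < x" "x \<le> y" for x y
  proof -
    have y: "0 < y" using xy by simp
    show ?thesis
      using fractional_average_mono[OF c F0 F r iF iG pos xy] G
      unfolding vF[OF xy(1)] vG[OF xy(1)] vF[OF y] vG[OF y] by simp
  qed
  then show ?thesis unfolding wright_increasing_hazard_def using posw nn by blast
qed

text \<open>The only index at which the property comes from Kanter's curve. Log-concavity is turned
  into monotonicity of the quotient by adding the tangent inequalities at two points; the numerator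
  is the Wright function of index 0, which is positive by its own integral along the curve.\<close>

lemma wright_increasing_hazard_base:
  assumes a: "0 < a" "a < 1"
  shows "wright_increasing_hazard a a"
proof -
  obtain D where D: "\<And>\<theta> \<eta>. \<theta> \<in> {0<..<pi} \<Longrightarrow> \<eta> \<in> {0<..<pi} \<Longrightarrow>
       kanter_n a a \<theta> + D \<theta> * (kanter_t a a \<eta> - kanter_t a a \<theta>) \<le> kanter_n a a \<eta>"
    by (rule kanter_convex_a[OF a]) blast
  have pos: "0 < wright (- a) a (- x)" if "0 < x" for x
    using wright_pos_0_or_a[OF a _ that] by simp
  have conc: "concave_on {0<..} (\<lambda>x. ln (wright (- a) a (- x)))"
    using kanter_log_concave[OF a _ D] by simp
  have pos0: "0 \<le> wright (- a) 0 (- x)" if "0 < x" for x :: real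
    by (rule less_imp_le, rule wright_pos_0_or_a[OF a _ that]) simp
  define f where "f x = - ln (wright (- a) a (- x))" for x
  have cf: "convex_on {0<..} f" using conc by (simp add: concave_on_def f_def[abs_def])
  have df: "(f has_real_derivative wright (- a) 0 (- x) / wright (- a) a (- x)) (at x)" if "0 < x" for x
  proof -
    have "((\<lambda>x. wright (- a) a (- x)) has_real_derivative - wright (- a) 0 (- x)) (at x)"
      using wright_has_derivative[OF a, of a x] by simp
    from DERIV_minus[OF DERIV_chain2[OF DERIV_ln_divide[OF pos[OF that]] this]] show ?thesis
      by (simp add: f_def[abs_def])
  qed
  have "wright (- a) 0 (- x) / wright (- a) a (- x) \<le> wright (- a) 0 (- y) / wright (- a) a (- y)"
    if xy: "0 < x" "x \<le> y" for x y
  proof (cases "x = y")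
    case False
    have y: "0 < y" using xy by simp
    have t: "f' * (q - p) \<le> f q - f p" if "0 < p" "0 < q" "(f has_real_derivative f') (at p)" for p q f'
      by (rule convex_on_imp_above_tangent[OF cf])
        (use that in \<open>auto intro: has_field_derivative_at_within simp: interior_open\<close>)
    define k where "k x = wright (- a) 0 (- x) / wright (- a) a (- x)" for x
    have "k x * (y - x) \<le> f y - f x" "k y * (x - y) \<le> f x - f y"
      using t[OF xy(1) y df[OF xy(1)]] t[OF y xy(1) df[OF y]] by (simp_all only: k_def)
    then have "0 \<le> (k y - k x) * (y - x)" by (simp add: algebra_simps)
    then show ?thesis using False xy by (simp add: zero_le_mult_iff k_def)
  qed simp
  then show ?thesis using pos pos0 by (simp add: wright_increasing_hazard_def)
qed

text \<open>The total order \<open>(b - a) / a\<close> may exceed 1, the largest order allowed in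
  one step, and is therefore split into \<open>n\<close> equal parts.\<close>

lemma wright_increasing_hazard:
  assumes a: "0 < a" "a < 1" and b: "a \<le> b"
  shows "wright_increasing_hazard a b"
proof (cases "b = a")
  case True
  then show ?thesis using wright_increasing_hazard_base[OF a] by simp
next
  case False
  define q where "q = (b - a) / a"
  have q: "0 < q" using False a b by (simp add: q_def)
  obtain n :: nat where n: "q \<le> real n" using real_arch_simple by blast
  then have n0: "0 < n" using q by (cases n) auto
  define c where "c = q / real n"
  have c: "0 < c" "c \<le> 1" using q n n0 by (auto simp: c_def)
  have "wright_increasing_hazard a (a + real k * (a * c))" for k
  proof (induction k)
    case (Suc k)
    have "a + real (Suc k) * (a * c) = a + real k * (a * c) + a * c" by (simp add: algebra_simps)
    then show ?case using wright_increasing_hazard_step[OF a c Suc.IH] by (simp only:)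
  qed (use wright_increasing_hazard_base[OF a] in simp)
  from this[of n] show ?thesis using n0 a by (simp add: c_def q_def)
qed

lemma wright_log_concave:
  assumes a: "0 < a" "a < 1" and V: "wright_increasing_hazard a b"
  shows "concave_on {0<..} (\<lambda>x. ln (wright (- a) b (- x)))"
  unfolding concave_on_def
proof (rule convex_on_realI)
  fix x :: real assume "x \<in> {0<..}"
  then have "0 < wright (- a) b (- x)" using V by (simp add: wright_increasing_hazard_def)
  from DERIV_minus[OF DERIV_chain2[OF DERIV_ln_divide[OF this] wright_has_derivative[OF a, of b x]]]
  show "((\<lambda>x. - ln (wright (- a) b (- x))) has_real_derivative wright (- a) (b - a) (- x) / wright (- a) b (- x)) (at x)"
    by simp
next
  fix x y :: real assume "x \<in> {0<..}" "y \<in> {0<..}" "x \<le> y"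
  then show "wright (- a) (b - a) (- x) / wright (- a) b (- x) \<le> wright (- a) (b - a) (- y) / wright (- a) b (- y)"
    using V by (simp add: wright_increasing_hazard_def)
qed (rule convex_connected, simp)

section \<open>Log-concavity of the densities\<close>

lemma M_log_concave_of_wright:
  assumes a: "0 < a" "a < 1" and b: "0 \<le> b"
    and pos: "\<And>x. 0 < x \<Longrightarrow> 0 < wright (- a) b (- x)"
    and conc: "concave_on {0<..} (\<lambda>x. ln (wright (- a) b (- x)))"
  shows "(\<forall>x\<in>M_support_interior a. 0 < M_density a b x) \<and> M_log_concave a b"
proof
  have G: "0 < Gamma (a + b)" using a b by (simp add: Gamma_real_pos)
  have d: "M_density a b x = Gamma (a + b) * wright (- a) b (- x)" if "0 < x" for x
    using a that by (simp add: M_density_def)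
  have s: "M_support_interior a = {0<..}" using a by (simp add: M_support_interior_def)
  show "\<forall>x\<in>M_support_interior a. 0 < M_density a b x" using G d pos s by simp
  have "concave_on {0<..} (\<lambda>x. ln (Gamma (a + b)) + ln (wright (- a) b (- x)))"
    by (intro concave_on_add conc) (simp add: concave_on_const)
  then have "concave_on {0<..} (\<lambda>x. ln (M_density a b x))"
  proof (rule concave_on_eqI)
    fix x :: real assume "x \<in> {0<..}"
    then have "0 < x" by simp
    then show "ln (Gamma (a + b)) + ln (wright (- a) b (- x)) = ln (M_density a b x)"
      using G pos[of x] by (simp add: d ln_mult)
  qed
  then show "M_log_concave a b" by (simp add: M_log_concave_def s)
qed

lemma M_log_concave_beta_0:
  assumes "0 \<le> a" "a \<le> 4 / 5"
  shows "(\<forall>x\<in>M_support_interior a. 0 < M_density a 0 x) \<and> M_log_concave a 0"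
proof (cases "a = 0")
  case True
  have "concave_on {0<..} (\<lambda>x::real. ln (M_density 0 0 x))"
    by (rule concave_on_eqI[of _ "\<lambda>x. - x"]) (auto simp: M_density_def concave_on_def convex_on_ident)
  then show ?thesis using True by (simp add: M_log_concave_def M_support_interior_def M_density_def)
next
  case False
  then have a: "0 < a" "a < 1" using assms by auto
  obtain D where D: "\<And>\<theta> \<eta>. \<theta> \<in> {0<..<pi} \<Longrightarrow> \<eta> \<in> {0<..<pi} \<Longrightarrow>
       kanter_n 0 a \<theta> + D \<theta> * (kanter_t 0 a \<eta> - kanter_t 0 a \<theta>) \<le> kanter_n 0 a \<eta>"
    by (rule kanter_convex_0[OF a(1) assms(2)]) blast
  show ?thesis
    by (rule M_log_concave_of_wright[OF a]) (use kanter_log_concave[OF a _ D] wright_pos_0_or_a[OF a, of 0] in auto)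
qed

lemma M_log_concave_beta_ge:
  assumes "0 \<le> a" "a \<le> 1" "a \<le> b"
  shows "(\<forall>x\<in>M_support_interior a. 0 < M_density a b x) \<and> M_log_concave a b"
proof -
  consider "a = 0" | "a = 1" | "0 < a" "a < 1" using assms by fastforce
  then show ?thesis
  proof cases
    case 1
    have "concave_on {0<..} (\<lambda>x::real. ln (M_density 0 b x))"
      by (rule concave_on_eqI[of _ "\<lambda>x. - x"]) (auto simp: M_density_def concave_on_def convex_on_ident)
    then show ?thesis using 1 by (simp add: M_log_concave_def M_support_interior_def M_density_def)
  next
    case 2
    have b: "1 \<le> b" using assms 2 by simp
    have "concave_on {0<..<1} (\<lambda>x::real. ln (M_density 1 b x))"
      unfolding concave_on_def
    proof (rule convex_on_realI)
      fix x :: real assume x: "x \<in> {0<..<1}"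
      have "((\<lambda>x. - (ln b + (b - 1) * ln (1 - x))) has_real_derivative (b - 1) / (1 - x)) (at x)"
        using x by (auto intro!: derivative_eq_intros)
      then show "((\<lambda>x. - ln (M_density 1 b x)) has_real_derivative (b - 1) / (1 - x)) (at x)"
        by (rule has_field_derivative_transform_within_open[of _ _ _ "{0<..<1}"])
          (use x b in \<open>auto simp: M_density_def ln_mult ln_powr\<close>)
    next
      fix x y :: real assume "x \<in> {0<..<1}" "y \<in> {0<..<1}" "x \<le> y"
      then show "(b - 1) / (1 - x) \<le> (b - 1) / (1 - y)" using b by (intro divide_left_mono) auto
    qed (rule convex_connected, simp)
    then show ?thesis using 2 b by (auto simp: M_log_concave_def M_support_interior_def M_density_def)
  next
    case 3
    have V: "wright_increasing_hazard a b" by (rule wright_increasing_hazard[OF 3 assms(3)])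
    then have pos: "0 < wright (- a) b (- x)" if "0 < x" for x using that by (simp add: wright_increasing_hazard_def)
    show ?thesis
      by (rule M_log_concave_of_wright[OF 3 _ pos wright_log_concave[OF 3 V]]) (use assms in auto)
  qed
qed

subsection \<open>Failure of log-concavity\<close>

text \<open>The derivative is twice \<open>Digamma (p + 2 * x) - Digamma (p + x)\<close>, positive
  for \<open>x > 0\<close> and zero at 0, hence the argument on the open interval. It serves twice:
  with \<open>p = 1 - \<beta>\<close> for the Gamma factor of the quotient, and with
  \<open>s = 0\<close> as strict midpoint log-convexity of Gamma.\<close>

lemma ln_Gamma_diff_less:
  fixes p s t :: real
  assumes "0 < p" "0 \<le> s" "s < t"
  shows "ln_Gamma (p + 2 * s) - 2 * ln_Gamma (p + s) < ln_Gamma (p + 2 * t) - 2 * ln_Gamma (p + t)"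
proof (rule DERIV_pos_imp_increasing_open[OF assms(3)])
  have D: "((\<lambda>t. ln_Gamma (p + 2 * t) - 2 * ln_Gamma (p + t)) has_real_derivative
      Digamma (p + 2 * x) * 2 - 2 * (Digamma (p + x) * 1)) (at x)" if "s \<le> x" for x
    using that assms by (auto intro!: derivative_eq_intros)
  show "\<exists>d. ((\<lambda>t. ln_Gamma (p + 2 * t) - 2 * ln_Gamma (p + t)) has_real_derivative d) (at x) \<and> 0 < d"
    if x: "s < x" "x < t" for x
  proof -
    have "Digamma (p + x) < Digamma (p + 2 * x)"
      using x assms by (intro Digamma_real_strict_mono) auto
    then show ?thesis using D[of x] x
      by (intro exI[of _ "Digamma (p + 2 * x) * 2 - 2 * (Digamma (p + x) * 1)"]) simp
  qed
  show "continuous_on {s..t} (\<lambda>t. ln_Gamma (p + 2 * t) - 2 * ln_Gamma (p + t))"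
    by (rule DERIV_continuous_on, rule has_field_derivative_at_within, rule D) simp
qed

lemma rGamma_diff_nonzero:
  fixes \<beta> a :: real
  assumes "\<beta> < a" "a < 1 + \<beta>"
  shows "rGamma (\<beta> - a) \<noteq> 0"
proof -
  have "\<beta> - a \<notin> \<int>\<^sub>\<le>\<^sub>0"
  proof
    assume "\<beta> - a \<in> \<int>\<^sub>\<le>\<^sub>0"
    then obtain n where "\<beta> - a = - real n" by (auto elim: nonpos_Ints_cases')
    then have "real n < 1" "0 < real n" using assms by auto
    then show False by simp
  qed
  then show ?thesis by (simp add: rGamma_eq_zero_iff)
qed

text \<open>The quotient of the two sides of the equation for \<open>\<alpha>\<^sub>*\<close>. By the reflection formula it is, up to
  a constant, \<open>\<Gamma>(1 - \<beta> + 2a) / \<Gamma>(1 - \<beta> + a)\<^sup>2\<close> times \<open>sin (\<pi>(\<beta> - 2a)) / (sin (\<pi>(\<beta> - a)))\<^sup>2\<close>, and the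
  latter is the quadratic polynomial \<open>2 X cos (\<pi>\<beta>) - (X\<^sup>2 - 1) sin (\<pi>\<beta>)\<close> in \<open>X = cot (\<pi>(\<beta> - a))\<close>.\<close>

lemma rGamma_quotient_strict_mono:
  fixes \<beta> a b :: real
  assumes \<beta>: "0 < \<beta>" "\<beta> < 1" and ab: "(\<beta> + 1) / 2 \<le> a" "a < b" "b \<le> 1"
  shows "rGamma (\<beta> - 2 * a) / (rGamma (\<beta> - a))\<^sup>2 < rGamma (\<beta> - 2 * b) / (rGamma (\<beta> - b))\<^sup>2"
proof -
  define L where "L a = ln_Gamma (1 - \<beta> + 2 * a) - 2 * ln_Gamma (1 - \<beta> + a)" for a
  \<comment> \<open>Using \<open>1 + \<beta> - a\<close> instead of \<open>\<beta> - a\<close>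
    leaves the cotangent unchanged and brings its argument into \<open>(0, \<pi>)\<close>.\<close>
  define X where "X a = cot (pi * (1 + \<beta> - a))" for a
  define q where "q X = 2 * X * cos (pi * \<beta>) - (X\<^sup>2 - 1) * sin (pi * \<beta>)" for X
  have sb: "0 < sin (pi * \<beta>)" using \<beta> by (intro sin_gt_zero) auto
  have arg: "0 < pi * (1 + \<beta> - a)" "pi * (1 + \<beta> - a) < pi" if "(\<beta> + 1) / 2 \<le> a" "a \<le> 1" for a
    using that \<beta> by auto
  have sa: "0 < sin (pi * (1 + \<beta> - a))" if "(\<beta> + 1) / 2 \<le> a" "a \<le> 1" for a
    using arg[OF that] by (rule sin_gt_zero)
  have rep: "rGamma (\<beta> - 2 * a) / (rGamma (\<beta> - a))\<^sup>2 = pi * (exp (L a) * q (X a))"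
    if a: "(\<beta> + 1) / 2 \<le> a" "a \<le> 1" for a
  proof -
    define u where "u = pi * (1 + \<beta> - a)"
    have su: "0 < sin u" using sa[OF a] by (simp add: u_def)
    have s1: "sin (pi * (\<beta> - a)) = - sin u"
    proof -
      have "pi * (\<beta> - a) = u - pi" by (simp add: u_def algebra_simps)
      then show ?thesis by simp
    qed
    have s2: "sin (pi * (\<beta> - 2 * a)) = sin (2 * u) * cos (pi * \<beta>) - cos (2 * u) * sin (pi * \<beta>)"
    proof -
      have "pi * (\<beta> - 2 * a) = (2 * u - pi * \<beta>) - 2 * pi" by (simp add: u_def algebra_simps)
      then have "sin (pi * (\<beta> - 2 * a)) = sin (2 * u - pi * \<beta>)"
        using sin_periodic[of "(2 * u - pi * \<beta>) - 2 * pi"] by simp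
      then show ?thesis by (simp add: sin_diff)
    qed
    have "sin (2 * u) * cos (pi * \<beta>) - cos (2 * u) * sin (pi * \<beta>) = (sin u)\<^sup>2 * q (cot u)"
      using su by (simp add: q_def cot_def sin_double cos_double power2_eq_square distrib_left left_diff_distrib
          right_diff_distrib)
    then have s3: "sin (pi * (\<beta> - 2 * a)) = (sin u)\<^sup>2 * q (X a)" by (simp add: s2 X_def u_def)
    have g1: "rGamma (\<beta> - 2 * a) = Gamma (1 - \<beta> + 2 * a) * ((sin u)\<^sup>2 * q (X a)) / pi"
      using rGamma_reflection_real[of "\<beta> - 2 * a"] a \<beta> s3 by (simp add: algebra_simps)
    have g2: "rGamma (\<beta> - a) = - (Gamma (1 - \<beta> + a) * sin u / pi)"
      using rGamma_reflection_real[of "\<beta> - a"] a \<beta> s1 by (simp add: algebra_simps)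
    have G: "Gamma (1 - \<beta> + 2 * a) = exp (ln_Gamma (1 - \<beta> + 2 * a))" "Gamma (1 - \<beta> + a) = exp (ln_Gamma (1 - \<beta> + a))"
      using a \<beta> by (auto simp: Gamma_real_pos_exp)
    have "exp (L a) = Gamma (1 - \<beta> + 2 * a) / (Gamma (1 - \<beta> + a))\<^sup>2"
      by (simp add: L_def exp_diff G exp_double)
    moreover have "0 < Gamma (1 - \<beta> + a)" unfolding G by simp
    ultimately show ?thesis unfolding g1 g2 using su by (simp add: field_simps power2_eq_square)
  qed
  have cb: "X a \<le> cot (pi * \<beta>)" and Xmono: "X a \<le> X b" if a: "(\<beta> + 1) / 2 \<le> a" "a \<le> b" "b \<le> 1" for a b
  proof -
    have cm: "cot v \<le> cot w" if "0 < w" "w \<le> v" "v < pi" for v w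
    proof -
      have "cot w - cot v = sin (v - w) / (sin v * sin w)"
        using sin_gt_zero[of v] sin_gt_zero[of w] that by (simp add: cot_def sin_diff field_simps)
      moreover have "0 \<le> sin (v - w) / (sin v * sin w)"
        using that by (intro divide_nonneg_nonneg mult_nonneg_nonneg sin_ge_zero) auto
      ultimately show ?thesis by simp
    qed
    show "X a \<le> cot (pi * \<beta>)" unfolding X_def using arg[of a] a \<beta> by (intro cm) auto
    show "X a \<le> X b" unfolding X_def using arg[of a] arg[of b] a \<beta> by (intro cm) auto
  qed
  \<comment> \<open>\<open>cot (pi * \<beta>)\<close> is the vertex of the concave quadratic
    \<open>q\<close>, and \<open>X\<close> stays on its left because
    \<open>a \<le> 1\<close>.\<close>
  have qmono: "q x \<le> q y" if xy: "x \<le> y" "y \<le> cot (pi * \<beta>)" for x y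
  proof -
    have "q y - q x = sin (pi * \<beta>) * ((y - x) * (2 * cot (pi * \<beta>) - (x + y)))"
      using sb by (simp add: q_def cot_def field_simps power2_eq_square)
    moreover have "0 \<le> sin (pi * \<beta>) * ((y - x) * (2 * cot (pi * \<beta>) - (x + y)))"
      using sb xy by (intro mult_nonneg_nonneg) auto
    ultimately show ?thesis by simp
  qed
  \<comment> \<open>Strictness comes from the exponential factor, so the factor multiplying it must
    be positive. Its sign is that of \<open>rGamma (\<beta> - 2 * b)\<close>, whose argument lies
    strictly between \<open>-2\<close> and \<open>-1\<close>.\<close>
  have qb: "0 < q (X b)"
  proof (rule ccontr)
    assume "\<not> 0 < q (X b)"
    then have z: "q (X b) \<le> 0" by simp
    have "rGamma (\<beta> - 2 * b) \<le> 0"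
    proof -
      have "pi * (exp (L b) * q (X b)) \<le> 0" using z by (intro mult_nonneg_nonpos) auto
      then have "rGamma (\<beta> - 2 * b) / (rGamma (\<beta> - b))\<^sup>2 \<le> 0" using rep[of b] ab by simp
      moreover have "rGamma (\<beta> - b) \<noteq> 0"
        using rGamma_diff_nonzero[of \<beta> b] ab \<beta> by auto
      ultimately show ?thesis by (simp add: divide_le_0_iff)
    qed
    moreover have "0 < rGamma (\<beta> - 2 * b)"
    proof -
      have "pi * (\<beta> - 2 * b) = (pi * (2 + \<beta> - 2 * b)) - 2 * pi" by (simp add: algebra_simps)
      then have "sin (pi * (\<beta> - 2 * b)) = sin (pi * (2 + \<beta> - 2 * b))"
        using sin_periodic[of "pi * (2 + \<beta> - 2 * b) - 2 * pi"] by simp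
      moreover have "0 < sin (pi * (2 + \<beta> - 2 * b))" using ab \<beta> by (intro sin_gt_zero) auto
      ultimately show ?thesis using rGamma_reflection_real[of "\<beta> - 2 * b"] ab \<beta> Gamma_real_pos[of "1 - (\<beta> - 2 * b)"] by simp
    qed
    ultimately show False by simp
  qed
  have "exp (L a) * q (X a) \<le> exp (L a) * q (X b)"
    using Xmono[of a b] cb[of b b] ab by (intro mult_left_mono qmono) auto
  also have "\<dots> < exp (L b) * q (X b)"
    using ln_Gamma_diff_less[of "1 - \<beta>" a b] ab \<beta> qb by (intro mult_strict_right_mono) (auto simp: L_def)
  finally show ?thesis using rep[of a] rep[of b] ab by simp
qed

section \<open>The threshold and the failure beyond it\<close>

text \<open>The difference \<open>h\<close> of the two sides is positive up to \<open>m\<close>.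
  Beyond \<open>m\<close> the strictly increasing quotient \<open>\<rho>\<close> admits at most one
  zero, and \<open>h 1 = (\<beta> - 1) * (rGamma \<beta>)^2 < 0\<close> ensures that there is
  one.\<close>

lemma alpha_star_equation:
  fixes \<beta> :: real
  assumes \<beta>: "0 < \<beta>" "\<beta> < 1"
  shows "\<exists>!a. is_alpha_star \<beta> a"
    and "\<And>\<alpha>. alpha_star \<beta> < \<alpha> \<Longrightarrow> \<alpha> \<le> 1 \<Longrightarrow> (rGamma (\<beta> - \<alpha>))\<^sup>2 < rGamma \<beta> * rGamma (\<beta> - 2 * \<alpha>)"
    and "0 < alpha_star \<beta>"
proof -
  \<comment> \<open>\<open>rGamma (\<beta> - 2 * a)\<close> vanishes at
    \<open>a = \<beta> / 2\<close> and at \<open>a = m\<close> and is negative in between; for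
    smaller \<open>a\<close> it is positive, and strict log-convexity of Gamma decides.\<close>
  define m where "m = (\<beta> + 1) / 2"
  define h where "h a = (rGamma (\<beta> - a))\<^sup>2 - rGamma \<beta> * rGamma (\<beta> - 2 * a)" for a
  have rb: "0 < rGamma \<beta>" using \<beta> by (simp add: rGamma_inverse_Gamma Gamma_real_pos)
  note nz = rGamma_diff_nonzero[of \<beta>]
  have hpos: "0 < h a" if a: "0 < a" "a \<le> m" for a
  proof -
    show ?thesis
    proof (cases "2 * a < \<beta>")
      case True
      have "ln_Gamma (\<beta> - 2 * a + 2 * 0) - 2 * ln_Gamma (\<beta> - 2 * a + 0) < ln_Gamma (\<beta> - 2 * a + 2 * a) - 2 * ln_Gamma (\<beta> - 2 * a + a)"
        by (rule ln_Gamma_diff_less) (use True a in auto)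
      then have l: "2 * ln_Gamma (\<beta> - a) < ln_Gamma \<beta> + ln_Gamma (\<beta> - 2 * a)" by simp
      have G: "rGamma x = exp (- ln_Gamma x)" if "0 < x" for x :: real
        using that by (simp add: rGamma_inverse_Gamma Gamma_real_pos_exp exp_minus)
      have "rGamma \<beta> * rGamma (\<beta> - 2 * a) = exp (- (ln_Gamma \<beta> + ln_Gamma (\<beta> - 2 * a)))"
        using True \<beta> by (simp add: G flip: exp_add)
      also have "\<dots> < exp (- (2 * ln_Gamma (\<beta> - a)))" using l by simp
      also have "\<dots> = (rGamma (\<beta> - a))\<^sup>2" using True a by (simp add: G exp_double[symmetric])
      finally show ?thesis by (simp add: h_def)
    next
      case False
      have s: "sin (pi * (\<beta> - 2 * a)) = - sin (pi * (2 * a - \<beta>))"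
        using sin_minus[of "pi * (2 * a - \<beta>)"] by (simp add: algebra_simps)
      have G: "0 < Gamma (1 - (\<beta> - 2 * a))" using False by (intro Gamma_real_pos) simp
      have r: "rGamma (\<beta> - 2 * a) = - (Gamma (1 - (\<beta> - 2 * a)) * sin (pi * (2 * a - \<beta>)) / pi)"
        using rGamma_reflection_real[of "\<beta> - 2 * a"] False unfolding s by simp
      show ?thesis
      proof (cases "a = \<beta>")
        case True
        \<comment> \<open>At \<open>a = \<beta>\<close> the square \<open>(rGamma 0)^2\<close>
          vanishes, so positivity of \<open>h\<close> rests on
          \<open>rGamma (- \<beta>) < 0\<close>.\<close>
        have "0 < sin (pi * (2 * a - \<beta>))" using True \<beta> by (intro sin_gt_zero) auto
        then have "rGamma (\<beta> - 2 * a) < 0" using G by (simp add: r)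
        then have "rGamma \<beta> * rGamma (\<beta> - 2 * a) < 0" using rb by (intro mult_pos_neg)
        then show ?thesis by (simp add: h_def True)
      next
        case ab: False
        have "0 \<le> sin (pi * (2 * a - \<beta>))" using a False by (intro sin_ge_zero) (auto simp: m_def)
        then have "rGamma (\<beta> - 2 * a) \<le> 0" using G by (simp add: r)
        then have "rGamma \<beta> * rGamma (\<beta> - 2 * a) \<le> 0" using rb by (intro mult_nonneg_nonpos) auto
        moreover have "rGamma (\<beta> - a) \<noteq> 0"
        proof (cases "\<beta> < a")
          case False
          then have "0 < rGamma (\<beta> - a)" using ab by (simp add: rGamma_inverse_Gamma Gamma_real_pos)
          then show ?thesis by simp
        qed (use nz[of a] a \<beta> in \<open>simp add: m_def\<close>)
        then have "0 < (rGamma (\<beta> - a))\<^sup>2" by simp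
        ultimately show ?thesis unfolding h_def by linarith
      qed
    qed
  qed
  define \<rho> where "\<rho> a = rGamma (\<beta> - 2 * a) / (rGamma (\<beta> - a))\<^sup>2" for a
  have \<rho>mono: "\<rho> a < \<rho> b" if "m \<le> a" "a < b" "b \<le> 1" for a b
    using rGamma_quotient_strict_mono[OF \<beta>, of a b] that by (simp add: \<rho>_def m_def)
  have m: "0 < m" "\<beta> < m" "m < 1" using \<beta> by (auto simp: m_def)
  have hrho: "h a = (rGamma (\<beta> - a))\<^sup>2 * (1 - rGamma \<beta> * \<rho> a)" if "m \<le> a" "a \<le> 1" for a
    using nz[of a] that m \<beta> by (simp add: h_def \<rho>_def field_simps)
  have h1: "h 1 < 0"
  proof -
    have r1: "rGamma (\<beta> - 1) = (\<beta> - 1) * rGamma \<beta>" using rGamma_plus1[of "\<beta> - 1"] by simp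
    have r2: "rGamma (\<beta> - 2) = (\<beta> - 2) * rGamma (\<beta> - 1)" using rGamma_plus1[of "\<beta> - 2"] by simp
    have "h 1 = (\<beta> - 1) * (rGamma \<beta>)\<^sup>2"
      unfolding h_def mult_1_right r2 r1 by (simp add: power2_eq_square algebra_simps)
    then show ?thesis using \<beta> rb by (simp add: mult_neg_pos)
  qed
  have hm: "0 < h m" using hpos[of m] m by simp
  have hc: "isCont h x" for x
  proof -
    have "isCont rGamma y" for y :: real by (rule continuous_on_interior[of UNIV]) (auto intro: continuous_on_rGamma)
    then show ?thesis unfolding h_def
      by (intro continuous_intros isCont_o2[of _ "\<lambda>a. \<beta> - a" rGamma] isCont_o2[of _ "\<lambda>a. \<beta> - 2 * a" rGamma])
  qed
  then have "\<exists>x\<ge>m. x \<le> 1 \<and> h x = 0"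
    using IVT2[of h 1 0 m] m hm h1 by auto
  then obtain a0 where a0: "m \<le> a0" "a0 \<le> 1" "h a0 = 0" by blast
  have a01: "m < a0" "a0 < 1" using a0 hm h1 by (auto simp: le_less)
  have after: "h a < 0" if "a0 < a" "a \<le> 1" for a
  proof -
    have "rGamma \<beta> * \<rho> a0 = 1"
      using hrho[of a0] a0 a01 nz[of a0] m \<beta> by simp
    moreover have "rGamma \<beta> * \<rho> a0 < rGamma \<beta> * \<rho> a" using \<rho>mono[of a0 a] a01 that rb by simp
    ultimately have "1 - rGamma \<beta> * \<rho> a < 0" by simp
    moreover have "0 < (rGamma (\<beta> - a))\<^sup>2" using nz[of a] that a01 m \<beta> by simp
    ultimately show ?thesis using hrho[of a] that a01 by (simp add: mult_pos_neg)
  qed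
  have before: "0 < h a" if "m \<le> a" "a < a0" for a
  proof -
    have "rGamma \<beta> * \<rho> a0 = 1"
      using hrho[of a0] a0 a01 nz[of a0] m \<beta> by simp
    moreover have "rGamma \<beta> * \<rho> a < rGamma \<beta> * \<rho> a0" using \<rho>mono[of a a0] a01 that rb by simp
    ultimately have "0 < 1 - rGamma \<beta> * \<rho> a" by simp
    moreover have "0 < (rGamma (\<beta> - a))\<^sup>2" using nz[of a] that a01 m \<beta> by simp
    ultimately show ?thesis using hrho[of a] that a01 by simp
  qed
  have iff: "is_alpha_star \<beta> a \<longleftrightarrow> a = a0" for a
  proof
    assume "is_alpha_star \<beta> a"
    then have a: "0 < a" "a < 1" "h a = 0" by (auto simp: is_alpha_star_def h_def)
    show "a = a0"
    proof (rule ccontr)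
      assume "a \<noteq> a0"
      then consider "a \<le> m" | "m \<le> a" "a < a0" | "a0 < a" by linarith
      then show False using hpos[of a] before[of a] after[of a] a by cases auto
    qed
  next
    assume "a = a0"
    then show "is_alpha_star \<beta> a" using a01 m a0 by (auto simp: is_alpha_star_def h_def)
  qed
  then show "\<exists>!a. is_alpha_star \<beta> a" by auto
  have as: "alpha_star \<beta> = a0" unfolding alpha_star_def by (rule the_equality) (simp_all add: iff)
  show "0 < alpha_star \<beta>" using as a01 m by simp
  show "(rGamma (\<beta> - \<alpha>))\<^sup>2 < rGamma \<beta> * rGamma (\<beta> - 2 * \<alpha>)" if "alpha_star \<beta> < \<alpha>" "\<alpha> \<le> 1" for \<alpha>
    using after[of \<alpha>] that as by (simp add: h_def)
qed

text \<open>Up to the sign \<open>(-1)^k\<close>, \<open>f k\<close> is the \<open>k\<close>-th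
  derivative of the Wright function, and the hypothesis says that \<open>f 0 * f 2 - (f 1)^2\<close>
  is positive at 0. These functions are smooth across 0, so positivity persists nearby; there the
  logarithmic derivative \<open>- f 1 / f 0\<close> is strictly increasing, which contradicts
  concavity on the positive side.\<close>

lemma not_M_log_concave_less_1:
  fixes \<alpha> \<beta> :: real
  assumes \<beta>: "0 < \<beta>" and a: "0 < \<alpha>" "\<alpha> < 1"
    and gt: "(rGamma (\<beta> - \<alpha>))\<^sup>2 < rGamma \<beta> * rGamma (\<beta> - 2 * \<alpha>)"
  shows "\<not> M_log_concave \<alpha> \<beta>"
proof
  assume M: "M_log_concave \<alpha> \<beta>"
  define f where "f k x = wright (- \<alpha>) (\<beta> - real k * \<alpha>) (- x)" for k :: nat and x
  have df: "(f k has_real_derivative - f (Suc k) x) (at x)" for k x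
    using wright_has_derivative[OF a, of "\<beta> - real k * \<alpha>" x] by (simp add: f_def[abs_def] algebra_simps)
  have cf: "isCont (f k) x" for k x by (rule DERIV_isCont[OF df])
  have f0: "f k 0 = rGamma (\<beta> - real k * \<alpha>)" for k by (simp add: f_def wright_0)
  have G: "0 < Gamma (\<alpha> + \<beta>)" using a \<beta> by (simp add: Gamma_real_pos)
  have rb: "0 < rGamma \<beta>" using \<beta> by (simp add: rGamma_inverse_Gamma Gamma_real_pos)
  have "\<forall>\<^sub>F x in nhds 0. 0 < f 0 x"
    using order_tendstoD(1)[OF cf[of 0 0, unfolded isCont_def tendsto_at_iff_tendsto_nhds], of 0] rb by (simp add: f0)
  moreover have "\<forall>\<^sub>F x in nhds 0. 0 < f 0 x * f 2 x - (f 1 x)\<^sup>2"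
  proof -
    have "isCont (\<lambda>x. f 0 x * f 2 x - (f 1 x)\<^sup>2) 0" by (intro continuous_intros cf)
    from order_tendstoD(1)[OF this[unfolded isCont_def tendsto_at_iff_tendsto_nhds], of 0]
    show ?thesis using gt by (simp add: f0 eventually_nhds_conv_at)
  qed
  ultimately have "\<forall>\<^sub>F x in nhds 0. 0 < f 0 x \<and> 0 < f 0 x * f 2 x - (f 1 x)\<^sup>2" by eventually_elim auto
  then obtain e where e: "0 < e" "\<And>x. \<bar>x\<bar> < e \<Longrightarrow> 0 < f 0 x \<and> 0 < f 0 x * f 2 x - (f 1 x)\<^sup>2"
    by (auto simp: eventually_nhds_metric dist_real_def)
  define l where "l x = ln (Gamma (\<alpha> + \<beta>)) + ln (f 0 x)" for x
  have dl: "(l has_real_derivative - (f 1 x / f 0 x)) (at x)" if "\<bar>x\<bar> < e" for x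
  proof -
    have "0 < f 0 x" using e that by simp
    from DERIV_add[OF DERIV_const DERIV_chain2[OF DERIV_ln_divide[OF this] df[of 0 x]], of "ln (Gamma (\<alpha> + \<beta>))"]
    show ?thesis by (simp add: l_def[abs_def])
  qed
  have "concave_on {0<..} (\<lambda>x. ln (M_density \<alpha> \<beta> x))"
    using M a by (simp add: M_log_concave_def M_support_interior_def)
  then have "concave_on {0<..<e} (\<lambda>x. ln (M_density \<alpha> \<beta> x))"
    unfolding concave_on_def by (rule convex_on_subset) auto
  then have "concave_on {0<..<e} l"
  proof (rule concave_on_eqI)
    fix x assume x: "x \<in> {0<..<e}"
    have "0 < f 0 x" using e(2)[of x] x by simp
    then show "ln (M_density \<alpha> \<beta> x) = l x" using x a G by (simp add: M_density_def l_def ln_mult f_def)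
  qed
  then have cv: "convex_on {0<..<e} (\<lambda>x. - l x)" by (simp add: concave_on_def)
  have dm: "((\<lambda>x. - l x) has_real_derivative f 1 x / f 0 x) (at x)" if "x \<in> {0<..<e}" for x
    using DERIV_minus[OF dl[of x]] that by simp
  define p where "p = e / 3"
  define q where "q = 2 * e / 3"
  have pq: "p \<in> {0<..<e}" "q \<in> {0<..<e}" "p < q" using e by (auto simp: p_def q_def)
  have t: "(f 1 x / f 0 x) * (y - x) \<le> - l y - (- l x)" if "x \<in> {0<..<e}" "y \<in> {0<..<e}" for x y
    by (rule convex_on_imp_above_tangent[OF cv])
      (use that dm[of x] in \<open>auto intro: has_field_derivative_at_within simp: interior_open\<close>)
  have "f 1 p / f 0 p * (q - p) + f 1 q / f 0 q * (p - q) \<le> 0"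
    using t[OF pq(1,2)] t[OF pq(2,1)] by linarith
  then have "0 \<le> (f 1 q / f 0 q - f 1 p / f 0 p) * (q - p)"
    unfolding left_diff_distrib right_diff_distrib by linarith
  then have ge: "f 1 p / f 0 p \<le> f 1 q / f 0 q" using pq by (simp add: zero_le_mult_iff)
  have "f 1 q / f 0 q < f 1 p / f 0 p"
  proof (rule DERIV_neg_imp_decreasing[OF pq(3)])
    fix x assume "p \<le> x" "x \<le> q"
    then have x: "\<bar>x\<bar> < e" using pq by auto
    have "0 < f 0 x" using e(2)[OF x] by simp
    then have "((\<lambda>x. f 1 x / f 0 x) has_real_derivative (- f (Suc 1) x * f 0 x - f 1 x * - f (Suc 0) x) / (f 0 x * f 0 x)) (at x)"
      by (intro DERIV_divide df) simp
    moreover have "(- f (Suc 1) x * f 0 x - f 1 x * - f (Suc 0) x) / (f 0 x * f 0 x) < 0"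
      using e(2)[OF x] by (intro divide_neg_pos) (auto simp: power2_eq_square mult.commute numeral_2_eq_2)
    ultimately show "\<exists>d. ((\<lambda>x. f 1 x / f 0 x) has_real_derivative d) (at x) \<and> d < 0" by blast
  qed
  then show False using ge by simp
qed

text \<open>Midpoint concavity fails between \<open>1/4\<close> and \<open>3/4\<close>: the exponent
  \<open>\<beta> - 1\<close> is negative and \<open>3/4 * 1/4 < (1/2)^2\<close>.\<close>

lemma not_M_log_concave_1:
  fixes \<beta> :: real
  assumes \<beta>: "0 < \<beta>" "\<beta> < 1"
  shows "\<not> M_log_concave 1 \<beta>"
proof
  assume "M_log_concave 1 \<beta>"
  then have "concave_on {0<..<1} (\<lambda>x. ln (M_density 1 \<beta> x))"
    by (simp add: M_log_concave_def M_support_interior_def)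
  from concave_onD[OF this, of "1 / 2" "1 / 4" "3 / 4"]
  have "(1 / 2) * ln (M_density 1 \<beta> (1 / 4)) + (1 / 2) * ln (M_density 1 \<beta> (3 / 4)) \<le> ln (M_density 1 \<beta> (1 / 2))"
    by simp
  moreover have "ln (M_density 1 \<beta> x) = ln \<beta> + (\<beta> - 1) * ln (1 - x)" if "0 < x" "x < 1" for x
    using that \<beta> by (simp add: M_density_def ln_mult ln_powr)
  ultimately have "(\<beta> - 1) * (ln (3 / 4) + ln (1 / 4)) \<le> (\<beta> - 1) * (2 * ln (1 / 2))"
    by (simp add: algebra_simps)
  then have "2 * ln (1 / 2) \<le> ln (3 / 4) + ln (1 / 4 :: real)" using \<beta> by (simp add: mult_le_cancel_left)
  also have "\<dots> = ln (3 / 16)" using ln_mult_pos[of "3 / 4" "1 / 4 :: real"] by simp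
  also have "2 * ln (1 / 2) = ln (1 / 4 :: real)" using ln_realpow[of "1 / 2 :: real" 2] by (simp add: power2_eq_square)
  finally show False by simp
qed

theorem theoremD:
  shows "(\<forall>\<beta>::real. 0 < \<beta> \<and> \<beta> < 1 \<longrightarrow>
            (\<exists>!a. is_alpha_star \<beta> a) \<and>
            (\<forall>\<alpha>. alpha_star \<beta> < \<alpha> \<and> \<alpha> \<le> 1 \<longrightarrow> \<not> M_log_concave \<alpha> \<beta>)) \<and>
         (\<forall>\<alpha>::real. 0 \<le> \<alpha> \<and> \<alpha> \<le> 4 / 5 \<longrightarrow>
            (\<forall>x\<in>M_support_interior \<alpha>. 0 < M_density \<alpha> 0 x) \<and> M_log_concave \<alpha> 0) \<and>
         (\<forall>\<alpha> \<beta>::real. 0 \<le> \<alpha> \<and> \<alpha> \<le> 1 \<and> \<alpha> \<le> \<beta> \<longrightarrow>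
            (\<forall>x\<in>M_support_interior \<alpha>. 0 < M_density \<alpha> \<beta> x) \<and> M_log_concave \<alpha> \<beta>)"
proof (intro conjI allI impI)
  fix \<beta> :: real assume b: "0 < \<beta> \<and> \<beta> < 1"
  note star = alpha_star_equation[OF conjunct1[OF b] conjunct2[OF b]]
  show "\<exists>!a. is_alpha_star \<beta> a" by (rule star(1))
  fix \<alpha> assume al: "alpha_star \<beta> < \<alpha> \<and> \<alpha> \<le> 1"
  show "\<not> M_log_concave \<alpha> \<beta>"
  proof (cases "\<alpha> = 1")
    case True
    then show ?thesis using not_M_log_concave_1[of \<beta>] b by simp
  next
    case False
    show ?thesis by (rule not_M_log_concave_less_1) (use star(2)[of \<alpha>] star(3) b al False in auto)
  qed
qed (use M_log_concave_beta_0 M_log_concave_beta_ge in auto)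

end
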